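(* Let $\mathcal{X}$ be a hereditary graph class that is small and weakly sparse. Then $\mathcal{X}$ has bounded expansion.
   Context: A class of graphs is a set of graphs closed under isomorphism. It is hereditary if it is closed under taking induced subgraphs. For a class $\mathcal{X}$, $\mathcal{X}_n$ denotes the set of graphs in $\mathcal{X}$ with vertex set $[n]$ (labeled graphs; isomorphic but distinct labeled graphs are counted separately). A hereditary class $\mathcal{X}$ is small if there is a constant $c$ such that $|\mathcal{X}_n| \le n!\cdot c^n$ for every $n\in\mathbb{N}$. A hereditary class is weakly sparse if there is an integer $t$ such that the complete bipartite graph $K_{t,t}$ is not a (not necessarily induced) subgraph of any graph in the class. For an integer $r\ge 0$, the $r$-subdivision of a graph $G$ is obtained by replacing each edge by a path with $r$ internal (new) vertices (the $0$-subdivision is $G$ itself). A class $\mathcal{C}$ has bounded expansion if there is a function $f:\mathbb{N}\to\mathbb{R}$ such that for every integer $r\ge 0$, no $r$-subdivision of a graph of average degree larger than $f(r)$ is a subgraph of a graph in $\mathcal{C}$. *)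

theory Defs
  imports "Graph_Theory.Graph_Theory"
begin

text \<open>
  Finite simple graphs are the \<^const>\<open>pair_graph\<close>s: each undirected edge is the pair of its two
  orientations. Vertices of the members of a class are natural numbers, which loses nothing:
  a class is closed under isomorphism, and every finite graph is isomorphic to one on naturals.
\<close>

definition graph_class :: "nat pair_pre_digraph set \<Rightarrow> bool" where
  "graph_class X \<longleftrightarrow>
    (\<forall>G\<in>X. pair_graph G) \<and>
    (\<forall>G\<in>X. \<forall>H. digraph_iso (with_proj G) (with_proj H) \<longrightarrow> H \<in> X)"

definition hereditary :: "nat pair_pre_digraph set \<Rightarrow> bool" where
  "hereditary X \<longleftrightarrow>
    (\<forall>G\<in>X. \<forall>H. induced_subgraph (with_proj H) (with_proj G) \<longrightarrow> H \<in> X)"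

definition labeled :: "nat pair_pre_digraph set \<Rightarrow> nat \<Rightarrow> nat pair_pre_digraph set" where
  "labeled X n = {G \<in> X. pverts G = {1..n}}"

definition small :: "nat pair_pre_digraph set \<Rightarrow> bool" where
  "small X \<longleftrightarrow> (\<exists>c::real. \<forall>n. real (card (labeled X n)) \<le> fact n * c ^ n)"

definition weakly_sparse :: "nat pair_pre_digraph set \<Rightarrow> bool" where
  "weakly_sparse X \<longleftrightarrow>
    (\<exists>t::nat. \<not> (\<exists>G\<in>X. \<exists>H :: nat pair_pre_digraph.
      complete_bipartite_digraph t t (with_proj H) \<and> subgraph (with_proj H) (with_proj G)))"

text \<open>
  In a symmetric digraph the out-degree is the undirected degree. The null graph gets
  average degree \<open>0\<close>.
\<close>

definition average_degree :: "'a pair_pre_digraph \<Rightarrow> real" where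
  "average_degree G =
    (\<Sum>v\<in>pverts G. real (out_degree (with_proj G) v)) / real (card (pverts G))"

text \<open>
  \<open>S (u, v)\<close> lists the internal vertices of the path replacing the edge \<open>uv\<close>, read from \<open>u\<close>
  to \<open>v\<close>; the other orientation \<open>(v, u)\<close> gives the same path reversed.
\<close>

definition is_subdivision :: "nat \<Rightarrow> 'a pair_pre_digraph \<Rightarrow> 'a pair_pre_digraph \<Rightarrow> bool" where
  "is_subdivision r G H \<longleftrightarrow> pair_graph G \<and>
    (\<exists>S :: 'a \<times> 'a \<Rightarrow> 'a list.
      (\<forall>(u, v)\<in>parcs G.
        length (S (u, v)) = r \<and> distinct (S (u, v)) \<and>
        set (S (u, v)) \<inter> pverts G = {} \<and> S (v, u) = rev (S (u, v))) \<and>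
      (\<forall>(u, v)\<in>parcs G. \<forall>(x, y)\<in>parcs G.
        {u, v} \<noteq> {x, y} \<longrightarrow> set (S (u, v)) \<inter> set (S (x, y)) = {}) \<and>
      pverts H = pverts G \<union> (\<Union>e\<in>parcs G. set (S e)) \<and>
      parcs H = (\<Union>(u, v)\<in>parcs G. set (vwalk_arcs (u # S (u, v) @ [v]))))"

definition bounded_expansion :: "nat pair_pre_digraph set \<Rightarrow> bool" where
  "bounded_expansion X \<longleftrightarrow>
    (\<exists>f :: nat \<Rightarrow> real. \<forall>r. \<not> (\<exists>G H :: nat pair_pre_digraph.
      average_degree G > f r \<and> is_subdivision r G H \<and>
      (\<exists>K\<in>X. subgraph (with_proj H) (with_proj K))))"

end

theory Submission
  imports Defs
begin

text \<open>
  Counting principle: if many vertex sets \<open>Y \<union> \<Union>I\<^sub>j\<close> of a graph of the class share a connected part \<open>Y\<close>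
  of moderate degree, and each item \<open>I\<^sub>j\<close> is determined, up to boundedly many choices, by its
  attachment to \<open>Y\<close>, then a labelled graph has few embeddings onto such a set. So there would be
  too many labelled induced subgraphs for a small class.

  Items that are the subdivided edges of an induced \<open>l\<close>-subdivision of a graph \<open>Q\<close> of large density
  \<open>D\<close> show that \<open>Q\<close> cannot have half of its edges among vertices of degree at most polynomial in \<open>D\<close>.
  Otherwise many vertices have many neighbours in the small set \<open>T\<close> of vertices of high degree. Let each of
  them subdivide a pair of its neighbours in \<open>T\<close>, distinct vertices taking distinct pairs. Either all
  succeed, which gives a \<open>(2l+1)\<close>-subdivision of a graph of density \<open>D\<^sup>5\<close>, or some vertex fails, and its
  neighbourhood carries a subdivided clique, where the counting principle applies again. Taking \<open>D\<close>
  maximal in a fixed graph, the class has no induced \<open>l\<close>-subdivisions, \<open>l \<ge> 1\<close>, of dense graphs.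

  If the graphs of the class have bounded density, a subdivision contained in one of them can be
  thinned out to an induced one by random sampling. The density is bounded: in a dense graph without
  \<open>K\<^bsub>t,t\<^esub>\<close>, if the degrees are moderate, take as items the single vertices with \<open>t\<close> neighbours in a
  suitable small set; if they are not, assigning pairs as above yields 1-subdivisions that
  are dense compared with the graph itself, hence induced ones, because \<open>K\<^bsub>t,t\<^esub>\<close>-freeness bounds the number of failures.
\<close>

subsection \<open>Connected vertex sets and counting homomorphisms\<close>

text \<open>The factor \<open>fact n\<close> in \<open>small\<close> is the number of bijections
  from \<open>n\<close> labels onto an \<open>n\<close>-set, so it cancels and only exponential
  factors remain. Connectivity of the shared part \<open>Y\<close> is what keeps the count
  exponential: its labels have at most \<open>card Z * \<Delta> ^ card Y\<close> placements, where
  arbitrary ones would have a power of \<open>card Z\<close>.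

  The obstacle is that no absolute degree bound \<Delta> is available; at best \<Delta> is
  polynomial in the density. The cost \<open>\<Delta> ^ card Y\<close> is paid for by adding
  \<open>m\<close> items out of \<open>s * m\<close>, with \<open>m\<close> about
  \<open>card Y * log \<Delta>\<close>: this gives at least \<open>s ^ m\<close> sets, more than any
  exponential in \<open>m\<close> whose base does not depend on \<open>s\<close>. So the density
  must exceed a constant times \<open>log \<Delta>\<close>, which holds for \<Delta> polynomial in a
  large density. Vertices of higher degree need the separate argument with pairs.

  There the subdivision length about doubles, so the density demanded of a counterexample rises as
  well. The constants are arranged so that the demand rises to its fourth power and the density to
  its fifth, which contradicts a choice of maximal density over all lengths.\<close>

definition conn :: "('a \<Rightarrow> 'a \<Rightarrow> bool) \<Rightarrow> 'a set \<Rightarrow> bool" where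
  "conn R S \<longleftrightarrow> S \<noteq> {} \<and> (\<forall>U. U \<subset> S \<and> U \<noteq> {} \<longrightarrow> (\<exists>x\<in>U. \<exists>y\<in>S - U. R x y))"

lemma conn_singleton: "conn R {x}"
  unfolding conn_def by blast

lemma conn_Un:
  assumes sym: "symp R" and A: "conn R A" and B: "conn R B"
    and ab: "a \<in> A" "b \<in> B" "R a b"
  shows "conn R (A \<union> B)"
  unfolding conn_def
proof (intro conjI allI impI)
  show "A \<union> B \<noteq> {}" using A by (auto simp: conn_def)
  fix U assume U: "U \<subset> A \<union> B \<and> U \<noteq> {}"
  have ba: "R b a" using ab sym by (auto dest: sympD)
  show "\<exists>x\<in>U. \<exists>y\<in>A \<union> B - U. R x y"
  proof (cases "(U \<inter> A \<noteq> {} \<and> U \<inter> A \<noteq> A) \<or> (U \<inter> B \<noteq> {} \<and> U \<inter> B \<noteq> B)")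
    case True
    then show ?thesis
    proof
      assume h: "U \<inter> A \<noteq> {} \<and> U \<inter> A \<noteq> A"
      then have "U \<inter> A \<subset> A" by blast
      then obtain x y where "x \<in> U \<inter> A" "y \<in> A - U \<inter> A" "R x y"
        using A h unfolding conn_def by meson
      then show ?thesis by blast
    next
      assume h: "U \<inter> B \<noteq> {} \<and> U \<inter> B \<noteq> B"
      then have "U \<inter> B \<subset> B" by blast
      then obtain x y where "x \<in> U \<inter> B" "y \<in> B - U \<inter> B" "R x y"
        using B h unfolding conn_def by meson
      then show ?thesis by blast
    qed
  next
    case False
    then consider "A \<subseteq> U" "U \<inter> B = {}" | "B \<subseteq> U" "U \<inter> A = {}"
      using U by blast
    then show ?thesis
      using ab ba by cases blast+
  qed
qed

lemma conn_insert:
  assumes "symp R" "conn R A" "a \<in> A" "R a v"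
  shows "conn R (insert v A)"
  using conn_Un[OF assms(1,2) conn_singleton assms(3) _ assms(4)] by simp

lemma conn_attach:
  assumes sym: "symp R" and A: "conn R A" and S: "finite S"
    and att: "\<And>v. v \<in> S \<Longrightarrow> \<exists>a\<in>A. R a v"
  shows "conn R (A \<union> S)"
  using S att
proof (induction S rule: finite_induct)
  case empty then show ?case using A by simp
next
  case (insert v S)
  then have c: "conn R (A \<union> S)" by simp
  obtain a where "a \<in> A" "R a v" using insert.prems by blast
  then have "conn R (insert v (A \<union> S))" using conn_insert[OF sym c, of a v] by simp
  then show ?case by simp
qed

text \<open>Serves the labels that an embedding sends onto a connected set: they are connected in
  the labelled graph pulled back by the embedding, so homomorphisms from them can be
  counted.\<close>

lemma conn_iso:
  assumes \<sigma>: "bij_betw \<sigma> D Y" and Y: "conn R Y"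
    and G: "\<And>i j. i \<in> D \<Longrightarrow> j \<in> D \<Longrightarrow> R (\<sigma> i) (\<sigma> j) \<Longrightarrow> Q i j"
  shows "conn Q D"
  unfolding conn_def
proof (intro conjI allI impI)
  show "D \<noteq> {}" using \<sigma> Y by (auto simp: conn_def bij_betw_def)
  fix U assume U: "U \<subset> D \<and> U \<noteq> {}"
  have inj: "inj_on \<sigma> D" and im: "\<sigma> ` D = Y" using \<sigma> by (auto simp: bij_betw_def)
  have "\<sigma> ` U \<subset> Y"
  proof -
    obtain d where "d \<in> D" "d \<notin> U" using U by blast
    then have "\<sigma> d \<notin> \<sigma> ` U" using inj U by (auto simp: inj_on_def)
    then show ?thesis using im U \<open>d \<in> D\<close> by blast
  qed
  moreover have "\<sigma> ` U \<noteq> {}" using U by blast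
  ultimately obtain x y where xy: "x \<in> \<sigma> ` U" "y \<in> Y - \<sigma> ` U" "R x y"
    using Y unfolding conn_def by meson
  then obtain i j where "i \<in> U" "x = \<sigma> i" "j \<in> D" "y = \<sigma> j" using im by blast
  then show "\<exists>x\<in>U. \<exists>y\<in>D - U. Q x y" using xy G U by blast
qed

section \<open>Counting homomorphisms and embeddings of labelled graphs\<close>

definition homs :: "('b \<Rightarrow> 'b \<Rightarrow> bool) \<Rightarrow> ('a \<Rightarrow> 'a \<Rightarrow> bool) \<Rightarrow> 'b set \<Rightarrow> 'a set \<Rightarrow> ('b \<Rightarrow> 'a) set" where
  "homs Q R D Z = {\<tau> \<in> D \<rightarrow>\<^sub>E Z. \<forall>i\<in>D. \<forall>j\<in>D. Q i j \<longrightarrow> R (\<tau> i) (\<tau> j)}"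

lemma finite_homs: "finite D \<Longrightarrow> finite Z \<Longrightarrow> finite (homs Q R D Z)"
  unfolding homs_def by (simp add: finite_PiE)

text \<open>A homomorphism on \<open>insert j U\<close> is determined by its restriction to
  \<open>U\<close> and its value at \<open>j\<close>, which is one of at most \<Delta> neighbours of
  the value at \<open>i\<close>.\<close>

lemma card_homs_insert:
  assumes fin: "finite U" "finite Z" and deg: "\<And>z. z \<in> Z \<Longrightarrow> card {w\<in>Z. R z w} \<le> \<Delta>"
    and ij: "i \<in> U" "j \<notin> U" "Q i j"
  shows "card (homs Q R (insert j U) Z) \<le> card (homs Q R U Z) * \<Delta>"
proof -
  let ?S = "SIGMA \<tau>:homs Q R U Z. {w\<in>Z. R (\<tau> i) w}"
  let ?g = "\<lambda>\<tau>. (restrict \<tau> U, \<tau> j)"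
  have "inj_on ?g (homs Q R (insert j U) Z)"
  proof (rule inj_onI)
    fix \<tau> \<tau>' assume h: "\<tau> \<in> homs Q R (insert j U) Z" "\<tau>' \<in> homs Q R (insert j U) Z" "?g \<tau> = ?g \<tau>'"
    show "\<tau> = \<tau>'"
    proof (rule PiE_ext[where k="insert j U" and s="\<lambda>_. Z"])
      show "\<tau> \<in> insert j U \<rightarrow>\<^sub>E Z" "\<tau>' \<in> insert j U \<rightarrow>\<^sub>E Z" using h by (auto simp: homs_def)
      fix x assume "x \<in> insert j U"
      then show "\<tau> x = \<tau>' x" using h(3) by (auto simp: restrict_def fun_eq_iff) metis
    qed
  qed
  moreover have "?g ` homs Q R (insert j U) Z \<subseteq> ?S"
    using ij by (auto simp: homs_def PiE_iff extensional_def)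
  moreover have "finite ?S" using finite_homs[OF fin] fin by auto
  ultimately have "card (homs Q R (insert j U) Z) \<le> card ?S"
    using card_inj_on_le by blast
  also have "\<dots> = (\<Sum>\<tau>\<in>homs Q R U Z. card {w\<in>Z. R (\<tau> i) w})"
    using finite_homs[OF fin] fin by (subst card_SigmaI) auto
  also have "\<dots> \<le> (\<Sum>\<tau>\<in>homs Q R U Z. \<Delta>)"
    using ij by (intro sum_mono deg) (auto simp: homs_def)
  finally show ?thesis by simp
qed

lemma card_homs:
  assumes fin: "finite D" "finite Z" and deg: "\<And>z. z \<in> Z \<Longrightarrow> card {w\<in>Z. R z w} \<le> \<Delta>"
    and D: "conn Q D" and \<Delta>: "\<Delta> \<ge> 1"
  shows "card (homs Q R D Z) \<le> card Z * \<Delta> ^ card D"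
proof -
  \<comment> \<open>Some subset of each size is enough: it grows along an edge leaving it, which
    connectivity provides. The exponent lags one behind the size since the first vertex costs
    \<open>card Z\<close> instead of \<Delta>.\<close>
  have ex: "\<exists>U\<subseteq>D. card U = Suc k \<and> card (homs Q R U Z) \<le> card Z * \<Delta> ^ k" if "Suc k \<le> card D" for k
    using that
  proof (induction k)
    case 0
    obtain d where d: "d \<in> D" using D by (auto simp: conn_def)
    have "card (homs Q R {d} Z) \<le> card ({d} \<rightarrow>\<^sub>E Z)"
      by (intro card_mono) (auto simp: homs_def finite_PiE fin)
    also have "\<dots> = card Z" by (simp add: card_PiE)
    finally show ?case using d by (intro exI[of _ "{d}"]) auto
  next
    case (Suc k)
    then obtain U where U: "U \<subseteq> D" "card U = Suc k" "card (homs Q R U Z) \<le> card Z * \<Delta> ^ k"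
      by auto
    have fU: "finite U" using U fin finite_subset by blast
    have "U \<subset> D" using U Suc.prems fin by (metis Suc_n_not_le_n psubsetI)
    moreover have "U \<noteq> {}" using U by auto
    ultimately obtain i j where ij: "i \<in> U" "j \<in> D - U" "Q i j"
      using D unfolding conn_def by meson
    have "card (homs Q R (insert j U) Z) \<le> card (homs Q R U Z) * \<Delta>"
      using card_homs_insert[OF fU fin(2), of R \<Delta> i j Q] deg ij by blast
    also have "\<dots> \<le> card Z * \<Delta> ^ k * \<Delta>" using U by simp
    finally have "card (homs Q R (insert j U) Z) \<le> card Z * \<Delta> ^ Suc k" by (simp add: ac_simps)
    moreover have "card (insert j U) = Suc (Suc k)" using ij fU U by simp
    ultimately show ?case using ij U by (intro exI[of _ "insert j U"]) auto
  qed
  have "D \<noteq> {}" using D by (auto simp: conn_def)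
  then obtain k where k: "card D = Suc k" using fin by (metis card_0_eq not0_implies_Suc)
  then obtain U where U: "U \<subseteq> D" "card U = Suc k" "card (homs Q R U Z) \<le> card Z * \<Delta> ^ k"
    using ex[of k] by auto
  then have "U = D" using k fin by (simp add: card_subset_eq)
  moreover have "card Z * \<Delta> ^ k \<le> card Z * \<Delta> ^ Suc k" using \<Delta> by simp
  ultimately show ?thesis using U k by (metis le_trans)
qed

text \<open>Every bijection from \<open>n\<close> labels onto a member of \<open>W\<close> pulls
  back a labelled graph; these are the fibres of that map.\<close>

definition emb_fibre :: "('a \<Rightarrow> 'a \<Rightarrow> bool) \<Rightarrow> 'a set \<Rightarrow> 'a set set \<Rightarrow> nat \<Rightarrow> (nat \<times> nat) set \<Rightarrow> (nat \<Rightarrow> 'a) set" where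
  "emb_fibre R A W n \<Gamma> = {\<sigma> \<in> {1..n} \<rightarrow>\<^sub>E A. inj_on \<sigma> {1..n} \<and> \<sigma> ` {1..n} \<in> W \<and>
      \<Gamma> = {(i, j). i \<in> {1..n} \<and> j \<in> {1..n} \<and> R (\<sigma> i) (\<sigma> j)}}"

text \<open>
  This is the only form in which smallness is used: \<open>W\<close> is a family of \<open>n\<close>-sets of vertices of one
  member of the class, and \<open>M\<close> bounds the number of embeddings of a labelled graph onto members of \<open>W\<close>.
\<close>

definition counting :: "nat \<Rightarrow> 'a set \<Rightarrow> ('a \<Rightarrow> 'a \<Rightarrow> bool) \<Rightarrow> bool" where
  "counting c A R \<longleftrightarrow> (\<forall>n W M. (\<forall>w\<in>W. w \<subseteq> A \<and> card w = n) \<longrightarrow>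
      (\<forall>\<Gamma>. card (emb_fibre R A W n \<Gamma>) \<le> M) \<longrightarrow> card W \<le> c ^ n * M)"

lemma card_bijections:
  assumes "finite B" "card B = n"
  shows "card {\<sigma> \<in> {1..n} \<rightarrow>\<^sub>E B. inj_on \<sigma> {1..n}} = fact n"
proof -
  have "card {\<sigma> \<in> {1..n} \<rightarrow>\<^sub>E B. inj_on \<sigma> {1..n}} = prod ((-) n) {0..<n}"
    unfolding card_inj_on_subset_funcset[OF finite_atLeastAtMost assms(1) order_refl]
    by (simp add: assms(2))
  also have "\<dots> = fact n"
    unfolding fact_prod_rev[of n, where ?'a = nat] by simp
  finally show ?thesis .
qed

text \<open>An embedding is recovered from the set of labels sent into \<open>Y\<close> (at most
  \<open>2 ^ n\<close> choices), its values there (a homomorphism from a connected graph), and its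
  values elsewhere. For the last, compare with one reference embedding that has the same first two
  data: passing from one to the other is an isomorphism fixing \<open>Y\<close>, so
  \<open>det\<close> leaves at most \<open>k\<close> values per label.\<close>

lemma emb_fibre_bound:
  assumes sym: "symp R" and finA: "finite A"
    and Y: "conn R Y" and Z: "Y \<subseteq> Z" "Z \<subseteq> A" and W: "\<And>w. w \<in> W \<Longrightarrow> Y \<subseteq> w \<and> w \<subseteq> Z"
    and deg: "\<And>z. z \<in> Z \<Longrightarrow> card {w\<in>Z. R z w} \<le> \<Delta>" and \<Delta>: "\<Delta> \<ge> 1"
    and det: "\<And>w1 w2 \<phi> z. w1 \<in> W \<Longrightarrow> w2 \<in> W \<Longrightarrow> bij_betw \<phi> w1 w2 \<Longrightarrow>
        (\<And>x y. x \<in> w1 \<Longrightarrow> y \<in> w1 \<Longrightarrow> R (\<phi> x) (\<phi> y) \<longleftrightarrow> R x y) \<Longrightarrow>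
        (\<And>y. y \<in> Y \<Longrightarrow> \<phi> y = y) \<Longrightarrow> z \<in> w1 \<Longrightarrow> z \<notin> Y \<Longrightarrow> \<phi> z \<in> C z"
    and C: "\<And>z. z \<in> Z \<Longrightarrow> finite (C z) \<and> card (C z) \<le> k" and k: "k \<ge> 1"
  shows "card (emb_fibre R A W n \<Gamma>) \<le> 2 ^ n * (card Z * \<Delta> ^ card Y) * k ^ n"
proof -
  let ?N = "{1..n}" let ?F = "emb_fibre R A W n \<Gamma>"
  let ?Q = "\<lambda>i j. (i, j) \<in> \<Gamma>"
  define Dm where "Dm = (\<lambda>\<sigma>::nat \<Rightarrow> 'a. {i\<in>?N. \<sigma> i \<in> Y})"
  have finZ: "finite Z" using Z finA finite_subset by blast
  have finF: "finite ?F"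
    unfolding emb_fibre_def by (rule finite_subset[of _ "?N \<rightarrow>\<^sub>E A"]) (auto simp: finite_PiE finA)
  have FD: "inj_on \<sigma> ?N" "\<sigma> ` ?N \<in> W" "\<And>i j. i \<in> ?N \<Longrightarrow> j \<in> ?N \<Longrightarrow> (i,j) \<in> \<Gamma> \<longleftrightarrow> R (\<sigma> i) (\<sigma> j)"
      "\<sigma> \<in> ?N \<rightarrow>\<^sub>E A" if "\<sigma> \<in> ?F" for \<sigma>
    using that by (auto simp: emb_fibre_def)
  have bD: "bij_betw \<sigma> (Dm \<sigma>) Y" if "\<sigma> \<in> ?F" for \<sigma>
  proof -
    have "Y \<subseteq> \<sigma> ` ?N" using FD(2)[OF that] W by blast
    then have "\<sigma> ` Dm \<sigma> = Y" unfolding Dm_def by blast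
    moreover have "inj_on \<sigma> (Dm \<sigma>)"
      by (rule inj_on_subset[OF FD(1)[OF that]]) (auto simp: Dm_def)
    ultimately show ?thesis by (simp add: bij_betw_def)
  qed
  define T where "T = (\<lambda>D. (\<lambda>\<sigma>. restrict \<sigma> D) ` {\<sigma>\<in>?F. Dm \<sigma> = D})"
  have fin_T: "finite (T D)" for D unfolding T_def using finF by auto
  have card_T: "card (T D) \<le> card Z * \<Delta> ^ card Y" for D
  proof (cases "{\<sigma>\<in>?F. Dm \<sigma> = D} = {}")
    case False
    then obtain \<sigma>0 where s0: "\<sigma>0 \<in> ?F" "Dm \<sigma>0 = D" by auto
    have DN: "D \<subseteq> ?N" using s0 by (auto simp: Dm_def)
    have finD: "finite D" using DN finite_subset by blast
    have cD: "conn ?Q D"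
      using conn_iso[OF bD[OF s0(1)] Y, of ?Q] FD(3)[OF s0(1)] s0 DN by blast
    have "card D = card Y" using bD[OF s0(1)] s0(2) by (auto dest: bij_betw_same_card)
    moreover have "T D \<subseteq> homs ?Q R D Z"
    proof
      fix \<tau> assume "\<tau> \<in> T D"
      then obtain \<sigma> where s: "\<sigma> \<in> ?F" "Dm \<sigma> = D" "\<tau> = restrict \<sigma> D" by (auto simp: T_def)
      have "\<sigma> i \<in> Z" if "i \<in> D" for i using that s(2) Z by (auto simp: Dm_def)
      moreover have "R (\<sigma> i) (\<sigma> j)" if "i \<in> D" "j \<in> D" "(i,j) \<in> \<Gamma>" for i j
        using FD(3)[OF s(1)] that DN by blast
      ultimately show "\<tau> \<in> homs ?Q R D Z" unfolding s(3) homs_def by auto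
    qed
    then have "card (T D) \<le> card (homs ?Q R D Z)"
      by (rule card_mono[OF finite_homs[OF finD finZ]])
    moreover have "card (homs ?Q R D Z) \<le> card Z * \<Delta> ^ card D"
      by (rule card_homs[OF finD finZ _ cD \<Delta>]) (rule deg)
    ultimately show ?thesis by simp
  next
    case True
    have "T D = {}" unfolding T_def True by simp
    then show ?thesis by simp
  qed
  have card_ext: "card {\<sigma>\<in>?F. Dm \<sigma> = D \<and> restrict \<sigma> D = \<tau>} \<le> k ^ n" for D \<tau>
  proof (cases "{\<sigma>\<in>?F. Dm \<sigma> = D \<and> restrict \<sigma> D = \<tau>} = {}")
    case False
    then obtain \<sigma>0 where s0: "\<sigma>0 \<in> ?F" "Dm \<sigma>0 = D" "restrict \<sigma>0 D = \<tau>" by auto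
    define C' where "C' = (\<lambda>i. if i \<in> D then {\<sigma>0 i} else C (\<sigma>0 i))"
    have s0Z: "\<sigma>0 i \<in> Z" if "i \<in> ?N" for i using FD(2)[OF s0(1)] W that by blast
    have "{\<sigma>\<in>?F. Dm \<sigma> = D \<and> restrict \<sigma> D = \<tau>} \<subseteq> (\<Pi>\<^sub>E i\<in>?N. C' i)"
    proof
      fix \<sigma> assume "\<sigma> \<in> {\<sigma>\<in>?F. Dm \<sigma> = D \<and> restrict \<sigma> D = \<tau>}"
      then have s: "\<sigma> \<in> ?F" "Dm \<sigma> = D" "restrict \<sigma> D = \<tau>" by auto
      have eqD: "\<sigma> i = \<sigma>0 i" if "i \<in> D" for i
        using that s(3) s0(3) by (metis restrict_apply')
      \<comment> \<open>Carries the image of \<open>\<sigma>0\<close> to that of \<sigma> label by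
        label. It preserves and reflects \<open>R\<close> because both embeddings pull back
        \<Gamma>, and it fixes \<open>Y\<close> because they agree on \<open>D\<close>.\<close>
      define \<phi> where "\<phi> = \<sigma> \<circ> the_inv_into ?N \<sigma>0"
      have b0: "bij_betw \<sigma>0 ?N (\<sigma>0 ` ?N)" and b: "bij_betw \<sigma> ?N (\<sigma> ` ?N)"
        using FD(1) s0(1) s(1) by (auto simp: bij_betw_def)
      have \<phi>: "\<phi> (\<sigma>0 i) = \<sigma> i" if "i \<in> ?N" for i
        unfolding \<phi>_def using FD(1)[OF s0(1)] that by (simp add: the_inv_into_f_f)
      have bij: "bij_betw \<phi> (\<sigma>0 ` ?N) (\<sigma> ` ?N)"
        unfolding \<phi>_def by (rule bij_betw_trans[OF bij_betw_the_inv_into[OF b0] b])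
      have "\<sigma> i \<in> C' i" if i: "i \<in> ?N" for i
      proof (cases "i \<in> D")
        case True then show ?thesis using eqD by (simp add: C'_def)
      next
        case False
        have "\<phi> (\<sigma>0 i) \<in> C (\<sigma>0 i)"
        proof (rule det[OF FD(2)[OF s0(1)] FD(2)[OF s(1)] bij])
          fix x y assume "x \<in> \<sigma>0 ` ?N" "y \<in> \<sigma>0 ` ?N"
          then show "R (\<phi> x) (\<phi> y) \<longleftrightarrow> R x y"
            using \<phi> FD(3)[OF s0(1)] FD(3)[OF s(1)] by auto
        next
          fix y assume "y \<in> Y"
          then obtain j where "j \<in> D" "y = \<sigma>0 j" using bD[OF s0(1)] s0(2) by (auto simp: bij_betw_def)
          moreover have "D \<subseteq> ?N" using s0(2) by (auto simp: Dm_def)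
          ultimately show "\<phi> y = y" using \<phi> eqD by auto
        next
          show "\<sigma>0 i \<in> \<sigma>0 ` ?N" using i by blast
          show "\<sigma>0 i \<notin> Y" using False i s0(2) by (auto simp: Dm_def)
        qed
        then show ?thesis using \<phi>[OF i] False by (simp add: C'_def)
      qed
      then show "\<sigma> \<in> (\<Pi>\<^sub>E i\<in>?N. C' i)" using FD(4)[OF s(1)] by (auto simp: PiE_iff)
    qed
    moreover have "finite (\<Pi>\<^sub>E i\<in>?N. C' i)"
      using C s0Z by (intro finite_PiE) (auto simp: C'_def)
    ultimately have "card {\<sigma>\<in>?F. Dm \<sigma> = D \<and> restrict \<sigma> D = \<tau>} \<le> card (\<Pi>\<^sub>E i\<in>?N. C' i)"
      by (rule card_mono[rotated])
    also have "\<dots> = (\<Prod>i\<in>?N. card (C' i))" by (simp add: card_PiE)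
    also have "\<dots> \<le> (\<Prod>i\<in>?N. k)"
      using C s0Z k by (intro prod_mono) (auto simp: C'_def)
    finally show ?thesis by simp
  next
    case True then show ?thesis by (metis card.empty le0)
  qed
  have "?F \<subseteq> (\<Union>D\<in>Pow ?N. \<Union>\<tau>\<in>T D. {\<sigma>\<in>?F. Dm \<sigma> = D \<and> restrict \<sigma> D = \<tau>})"
    by (auto simp: T_def Dm_def)
  then have "card ?F \<le> card (\<Union>D\<in>Pow ?N. \<Union>\<tau>\<in>T D. {\<sigma>\<in>?F. Dm \<sigma> = D \<and> restrict \<sigma> D = \<tau>})"
    by (rule card_mono[rotated]) (use finF fin_T in auto)
  also have "\<dots> \<le> (\<Sum>D\<in>Pow ?N. card (\<Union>\<tau>\<in>T D. {\<sigma>\<in>?F. Dm \<sigma> = D \<and> restrict \<sigma> D = \<tau>}))"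
    by (rule card_UN_le) auto
  also have "\<dots> \<le> (\<Sum>D\<in>Pow ?N. (card Z * \<Delta> ^ card Y) * k ^ n)"
  proof (rule sum_mono)
    fix D
    have "card (\<Union>\<tau>\<in>T D. {\<sigma>\<in>?F. Dm \<sigma> = D \<and> restrict \<sigma> D = \<tau>}) \<le>
        (\<Sum>\<tau>\<in>T D. card {\<sigma>\<in>?F. Dm \<sigma> = D \<and> restrict \<sigma> D = \<tau>})"
      by (rule card_UN_le[OF fin_T])
    also have "\<dots> \<le> (\<Sum>\<tau>\<in>T D. k ^ n)" by (rule sum_mono[OF card_ext])
    also have "\<dots> = card (T D) * k ^ n" by simp
    also have "\<dots> \<le> (card Z * \<Delta> ^ card Y) * k ^ n" using card_T by (rule mult_right_mono) simp
    finally show "card (\<Union>\<tau>\<in>T D. {\<sigma>\<in>?F. Dm \<sigma> = D \<and> restrict \<sigma> D = \<tau>}) \<le> (card Z * \<Delta> ^ card Y) * k ^ n" .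
  qed
  also have "\<dots> = 2 ^ n * (card Z * \<Delta> ^ card Y) * k ^ n" by (simp add: card_Pow)
  finally show ?thesis .
qed

subsection \<open>Systems of attached items\<close>

text \<open>For \<open>m \<ge> 2\<close> one has \<open>m \<le> 2 * (m - 1)\<close>, so
  \<open>B ^ m \<le> (B\<^sup>2) ^ (m - 1)\<close>. The extra factor \<open>s\<close> on the left
  stands for \<open>card Z\<close>, which is linear in \<open>s\<close>.\<close>

lemma exponential_gap:
  fixes s B m :: nat
  assumes "s > B\<^sup>2" "m \<ge> 2" "B \<ge> 1"
  shows "B ^ m * s < s ^ m"
proof -
  have "B ^ m \<le> (B\<^sup>2) ^ (m - 1)"
    unfolding power_mult[symmetric] using assms by (intro power_increasing) auto
  also have "\<dots> < s ^ (m - 1)"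
    using assms by (intro power_strict_mono) auto
  finally have "B ^ m * s < s ^ (m - 1) * s" using assms by simp
  also have "\<dots> = s ^ m" using assms by (metis One_nat_def Suc_le_D Suc_diff_le Suc_1 diff_Suc_1 mult.commute power_Suc)
  finally show ?thesis .
qed

text \<open>An item whose attachment set crosses the cut between the vertices reached so far and the
  rest brings in all its attachments, hence at least one new vertex. So fewer items than vertices
  suffice.\<close>

lemma spanning_items:
  fixes R :: "'a \<Rightarrow> 'a \<Rightarrow> bool" and I :: "'j \<Rightarrow> 'a set" and S :: "'j \<Rightarrow> 'a set"
  assumes sym: "symp R" and V: "finite V" "V \<noteq> {}"
    and I: "\<And>j. j \<in> J \<Longrightarrow> conn R (I j)"
    and S: "\<And>j. j \<in> J \<Longrightarrow> S j \<subseteq> V" "\<And>j v. j \<in> J \<Longrightarrow> v \<in> S j \<Longrightarrow> \<exists>x\<in>I j. R x v"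
    and cut: "\<And>U. U \<subset> V \<Longrightarrow> U \<noteq> {} \<Longrightarrow> \<exists>j\<in>J. S j \<inter> U \<noteq> {} \<and> S j \<inter> (V - U) \<noteq> {}"
  shows "\<exists>J0\<subseteq>J. finite J0 \<and> card J0 \<le> card V \<and> conn R (V \<union> (\<Union>j\<in>J0. I j))"
proof -
  \<comment> \<open>\<open>U\<close> is joined by fewer items than it has vertices; a largest such
    \<open>U\<close> turns out to be \<open>V\<close>.\<close>
  define P where "P = (\<lambda>U. U \<subseteq> V \<and> U \<noteq> {} \<and>
      (\<exists>J0\<subseteq>J. finite J0 \<and> card J0 + 1 \<le> card U \<and> conn R (U \<union> (\<Union>j\<in>J0. I j))))"
  obtain v where v: "v \<in> V" using V by blast
  have P0: "P {v}" unfolding P_def using v conn_singleton[of R v] by (auto intro!: exI[of _ "{}"])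
  have bd: "\<forall>U. P U \<longrightarrow> card U \<le> card V" unfolding P_def using V by (auto intro: card_mono)
  obtain U where U: "P U" and max: "\<And>U'. P U' \<Longrightarrow> card U' \<le> card U"
    using ex_has_greatest_nat[where P=P and k="{v}" and f=card and b="Suc (card V)"] P0 bd
    by (auto simp: less_Suc_eq_le)
  obtain J0 where J0: "J0 \<subseteq> J" "finite J0" "card J0 + 1 \<le> card U" "conn R (U \<union> (\<Union>j\<in>J0. I j))"
    and UV: "U \<subseteq> V" "U \<noteq> {}" using U unfolding P_def by blast
  have finU: "finite U" using UV V finite_subset by blast
  have "U = V"
  proof (rule ccontr)
    assume "U \<noteq> V"
    then obtain j where j: "j \<in> J" "S j \<inter> U \<noteq> {}" "S j \<inter> (V - U) \<noteq> {}" using cut UV by blast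
    have finS: "finite (S j)" using S(1)[OF j(1)] V finite_subset by blast
    let ?C = "U \<union> (\<Union>j\<in>J0. I j)"
    obtain u where u: "u \<in> S j" "u \<in> U" using j by blast
    obtain x where x: "x \<in> I j" "R x u" using S(2)[OF j(1) u(1)] by blast
    have "conn R (I j \<union> ?C)" using conn_Un[OF sym I[OF j(1)] J0(4) x(1) _ x(2)] u by blast
    then have "conn R ((I j \<union> ?C) \<union> S j)"
      using conn_attach[OF sym _ finS, of "I j \<union> ?C"] S(2)[OF j(1)] by blast
    moreover have "(I j \<union> ?C) \<union> S j = (U \<union> S j) \<union> (\<Union>j\<in>insert j J0. I j)" by auto
    ultimately have c: "conn R ((U \<union> S j) \<union> (\<Union>j\<in>insert j J0. I j))" by simp
    have lt: "card U < card (U \<union> S j)" using j finU finS by (intro psubset_card_mono) auto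
    have "card (insert j J0) + 1 \<le> card (U \<union> S j)"
      using lt J0 card_insert_le_m1[of _ J0 j] by (auto simp: card_insert_if)
    then have "P (U \<union> S j)" unfolding P_def using c UV S(1)[OF j(1)] J0 j(1)
      by (intro conjI exI[of _ "insert j J0"]) auto
    then show False using max lt by fastforce
  qed
  then show ?thesis using J0 by (intro exI[of _ J0]) auto
qed

text \<open>Among the vertex sets that contain the attachments of at least \<open>x\<close> items
  per vertex, take a smallest. If no item crossed some cut of it, one of the two sides would keep
  the density.\<close>

lemma dense_hyperconnected_part:
  fixes S :: "'j \<Rightarrow> 'a set"
  assumes V: "finite V" "V \<noteq> {}" and J: "finite J" and S: "\<And>j. j \<in> J \<Longrightarrow> S j \<subseteq> V \<and> S j \<noteq> {}"
    and dens: "x * card V \<le> card J"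
  obtains U where "U \<subseteq> V" "U \<noteq> {}" "x * card U \<le> card {j\<in>J. S j \<subseteq> U}"
    "\<And>U'. U' \<subset> U \<Longrightarrow> U' \<noteq> {} \<Longrightarrow> \<exists>j\<in>{j\<in>J. S j \<subseteq> U}. S j \<inter> U' \<noteq> {} \<and> S j \<inter> (U - U') \<noteq> {}"
proof -
  define P where "P = (\<lambda>U. U \<subseteq> V \<and> U \<noteq> {} \<and> x * card U \<le> card {j\<in>J. S j \<subseteq> U})"
  have "{j\<in>J. S j \<subseteq> V} = J" using S by auto
  then have "P V" using V dens by (simp add: P_def)
  then obtain U where U: "P U" and min: "\<And>U'. P U' \<Longrightarrow> card U \<le> card U'"
    using ex_has_least_nat[of P V card] by blast
  have finU: "finite U" using U V finite_subset by (auto simp: P_def)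
  show ?thesis
  proof (rule that[of U])
    fix U' assume U': "U' \<subset> U" "U' \<noteq> {}"
    show "\<exists>j\<in>{j\<in>J. S j \<subseteq> U}. S j \<inter> U' \<noteq> {} \<and> S j \<inter> (U - U') \<noteq> {}"
    proof (rule ccontr)
      assume "\<not> ?thesis"
      then have sub: "{j\<in>J. S j \<subseteq> U} \<subseteq> {j\<in>J. S j \<subseteq> U'} \<union> {j\<in>J. S j \<subseteq> U - U'}" by blast
      have "x * card U = x * card U' + x * card (U - U')"
        using U' finU by (metis add_mult_distrib2 card_Diff_subset finite_subset le_add_diff_inverse
            card_mono psubset_imp_subset)
      moreover have "\<not> x * card U' \<le> card {j\<in>J. S j \<subseteq> U'}"
        using min[of U'] U' U finU psubset_card_mono[OF finU U'(1)] by (auto simp: P_def)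
      moreover have "\<not> x * card (U - U') \<le> card {j\<in>J. S j \<subseteq> U - U'}"
      proof -
        have "U - U' \<subset> U" using U' by blast
        then have "card (U - U') < card U" by (rule psubset_card_mono[OF finU])
        then show ?thesis using min[of "U - U'"] U' U by (auto simp: P_def)
      qed
      moreover have "card {j\<in>J. S j \<subseteq> U} \<le> card {j\<in>J. S j \<subseteq> U'} + card {j\<in>J. S j \<subseteq> U - U'}"
        using card_mono[OF _ sub] card_Un_le[of "{j\<in>J. S j \<subseteq> U'}" "{j\<in>J. S j \<subseteq> U - U'}"] J
        by fastforce
      ultimately show False using U by (simp add: P_def)
    qed
  qed (use U in \<open>auto simp: P_def\<close>)
qed

text \<open>The core \<open>Y\<close> is a dense part \<open>U\<close> that no cut separates, with
  at most \<open>card U\<close> items connecting it. Adding any \<open>m\<close> of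
  \<open>s * m\<close> further items gives at least \<open>s ^ m\<close> sets.
  \<open>counting\<close> and \<open>emb_fibre_bound\<close> allow only an exponential in
  \<open>m\<close> with base free of \<open>s\<close>, times one factor \<open>s\<close> from
  \<open>card Z\<close>.\<close>

lemma item_system_bound:
  fixes R :: "'a \<Rightarrow> 'a \<Rightarrow> bool" and I :: "'j \<Rightarrow> 'a set" and c k l \<mu> s \<Delta> :: nat
  defines "S \<equiv> \<lambda>V j. {v\<in>V. \<exists>x\<in>I j. R x v}"
  assumes sym: "symp R" and finA: "finite A" and cnt: "counting c A R" and c: "c \<ge> 1"
    and V: "V \<subseteq> A" "V \<noteq> {}" and J: "finite J"
    and I: "\<And>j. j \<in> J \<Longrightarrow> I j \<subseteq> A - V \<and> card (I j) = l \<and> conn R (I j)"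
    and disj: "\<And>i j. i \<in> J \<Longrightarrow> j \<in> J \<Longrightarrow> i \<noteq> j \<Longrightarrow> I i \<inter> I j = {}"
    and S: "\<And>j. j \<in> J \<Longrightarrow> S V j \<noteq> {}"
    and deg: "\<And>z. z \<in> V \<union> (\<Union>j\<in>J. I j) \<Longrightarrow> card {w \<in> V \<union> (\<Union>j\<in>J. I j). R z w} \<le> \<Delta>"
    and det: "\<And>U J1 J2 \<phi> j z. U \<subseteq> V \<Longrightarrow> J1 \<subseteq> J \<Longrightarrow> J2 \<subseteq> J \<Longrightarrow>
        (\<And>j. j \<in> J1 \<union> J2 \<Longrightarrow> S V j \<subseteq> U) \<Longrightarrow>
        bij_betw \<phi> (U \<union> (\<Union>j\<in>J1. I j)) (U \<union> (\<Union>j\<in>J2. I j)) \<Longrightarrow>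
        (\<And>x y. x \<in> U \<union> (\<Union>j\<in>J1. I j) \<Longrightarrow> y \<in> U \<union> (\<Union>j\<in>J1. I j) \<Longrightarrow> R (\<phi> x) (\<phi> y) \<longleftrightarrow> R x y) \<Longrightarrow>
        (\<And>u. u \<in> U \<Longrightarrow> \<phi> u = u) \<Longrightarrow> j \<in> J1 \<Longrightarrow> z \<in> I j \<Longrightarrow> \<phi> z \<in> C z"
    and C: "\<And>z. finite (C z)" "\<And>z. z \<in> (\<Union>j\<in>J. I j) \<Longrightarrow> card (C z) \<le> k" and k: "k \<ge> 1"
    and \<Delta>: "\<Delta> \<ge> 2" "\<Delta> ^ (l + 1) \<le> 2 ^ \<mu>" and \<mu>: "\<mu> \<ge> 2"
    and s: "s > (4 * (l + 1) * (2 * c * k) ^ (l + 1))\<^sup>2"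
    and dens: "card J \<ge> (1 + s * \<mu>) * card V"
  shows False
proof -
  have finV: "finite V" using V finA finite_subset by blast
  have finI: "finite (I j)" if "j \<in> J" for j using I[OF that] finA by (meson finite_Diff finite_subset)
  obtain U where U: "U \<subseteq> V" "U \<noteq> {}" "(1 + s * \<mu>) * card U \<le> card {j\<in>J. S V j \<subseteq> U}"
    and cut: "\<And>U'. U' \<subset> U \<Longrightarrow> U' \<noteq> {} \<Longrightarrow>
        \<exists>j\<in>{j\<in>J. S V j \<subseteq> U}. S V j \<inter> U' \<noteq> {} \<and> S V j \<inter> (U - U') \<noteq> {}"
  proof (rule dense_hyperconnected_part[of V J "S V" "1 + s * \<mu>"])
    show "S V j \<subseteq> V \<and> S V j \<noteq> {}" if "j \<in> J" for j using S[OF that] by (auto simp: S_def)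
  qed (use finV V J dens in auto)
  define J' where "J' = {j\<in>J. S V j \<subseteq> U}"
  have finU: "finite U" using U finV finite_subset by blast
  have J'J: "J' \<subseteq> J" by (auto simp: J'_def)
  have "\<exists>J0\<subseteq>J'. finite J0 \<and> card J0 \<le> card U \<and> conn R (U \<union> (\<Union>j\<in>J0. I j))"
  proof (rule spanning_items[OF sym finU U(2), of J' I "S V"])
    show "conn R (I j)" if "j \<in> J'" for j using that I J'J by blast
    show "S V j \<subseteq> U" if "j \<in> J'" for j using that by (simp add: J'_def)
    show "\<exists>x\<in>I j. R x v" if "v \<in> S V j" for j v using that by (simp add: S_def)
    show "\<exists>j\<in>J'. S V j \<inter> U' \<noteq> {} \<and> S V j \<inter> (U - U') \<noteq> {}" if "U' \<subset> U" "U' \<noteq> {}" for U'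
      unfolding J'_def by (rule cut[OF that])
  qed
  then obtain J0 where J0: "J0 \<subseteq> J'" "finite J0" "card J0 \<le> card U" "conn R (U \<union> (\<Union>j\<in>J0. I j))"
    by blast
  define Y where "Y = U \<union> (\<Union>j\<in>J0. I j)"
  \<comment> \<open>Enough extra items to pay for the core:
    \<open>card Y \<le> (l + 1) * card U\<close> gives
    \<open>\<Delta> ^ card Y \<le> 2 ^ m\<close>.\<close>
  define m where "m = \<mu> * card U"
  have cU: "card U \<ge> 1" using U finU by (simp add: Suc_leI card_gt_0_iff)
  have m2: "m \<ge> 2" unfolding m_def using mult_le_mono[OF \<mu> cU] by simp
  \<comment> \<open>The summand 1 in the density covers \<open>J0\<close>, at most one item per
    vertex of \<open>U\<close>; \<open>s * \<mu>\<close> items per vertex remain.\<close>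
  have "s * m \<le> card (J' - J0)"
  proof -
    have "card (J' - J0) = card J' - card J0" using J0 by (simp add: card_Diff_subset)
    moreover have "(1 + s * \<mu>) * card U \<le> card J'" using U by (simp add: J'_def)
    ultimately show ?thesis using J0(3) by (simp add: m_def algebra_simps)
  qed
  then obtain J3 where J3: "J3 \<subseteq> J' - J0" "card J3 = s * m" "finite J3"
    by (metis obtain_subset_with_card_n)
  define Z where "Z = Y \<union> (\<Union>j\<in>J3. I j)"
  define F where "F = (\<lambda>J4. Y \<union> (\<Union>j\<in>J4. I j))"
  define W where "W = F ` {J4. J4 \<subseteq> J3 \<and> card J4 = m}"
  define n where "n = card Y + l * m"
  have YV: "Y = U \<union> (\<Union>j\<in>J0. I j)" "J0 \<subseteq> J" using J0 J'J by (auto simp: Y_def)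
  have finY: "finite Y" unfolding Y_def using finU J0 finI J'J by auto
  have J3J: "J3 \<subseteq> J" "J3 \<subseteq> J'" using J3 J'J by auto
  have YI: "Y \<inter> I j = {}" if "j \<in> J3" for j
  proof -
    have "j \<in> J" "j \<notin> J0" using that J3 J'J by auto
    then have "\<And>i. i \<in> J0 \<Longrightarrow> I i \<inter> I j = {}" using disj YV by blast
    then show ?thesis using I[OF \<open>j \<in> J\<close>] U by (auto simp: Y_def)
  qed
  have ZA: "Z \<subseteq> V \<union> (\<Union>j\<in>J. I j)" unfolding Z_def using YV U J3J by auto
  then have ZA': "Z \<subseteq> A" using V I by blast
  have cUN: "card (\<Union>j\<in>K. I j) = l * card K" if "K \<subseteq> J" for K
  proof -
    have "finite K" using that J finite_subset by blast
    then have "card (\<Union>j\<in>K. I j) = (\<Sum>j\<in>K. card (I j))"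
      using that finI by (intro card_UN_disjoint ballI impI disj) auto
    also have "\<dots> = (\<Sum>j\<in>K. l)" using that I by (intro sum.cong) auto
    finally show ?thesis by simp
  qed
  have cW: "w \<subseteq> A \<and> card w = n" if "w \<in> W" for w
  proof -
    obtain K where K: "K \<subseteq> J3" "card K = m" "w = F K" using \<open>w \<in> W\<close> by (auto simp: W_def)
    have KJ: "K \<subseteq> J" using K J3J by auto
    have "w \<subseteq> Z" using K by (auto simp: F_def Z_def)
    moreover have "card w = card Y + card (\<Union>j\<in>K. I j)"
      unfolding K(3) F_def
    proof (intro card_Un_disjoint finY)
      show "finite (\<Union>j\<in>K. I j)" using KJ K J3(3) finI finite_subset[OF K(1)] by auto
      show "Y \<inter> (\<Union>j\<in>K. I j) = {}" using YI K(1) by blast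
    qed
    ultimately show ?thesis using cUN[OF KJ] K ZA' by (auto simp: n_def)
  qed
  have injF: "inj_on F {J4. J4 \<subseteq> J3 \<and> card J4 = m}"
  proof -
    have key: "K1 \<subseteq> K2" if K: "K1 \<subseteq> J3" "K2 \<subseteq> J3" "F K1 = F K2" for K1 K2
    proof
      fix j assume j: "j \<in> K1"
      then have jJ: "j \<in> J" "j \<in> J3" using K J3J by auto
      then obtain x where x: "x \<in> I j" using I[OF jJ(1)] by (auto simp: conn_def)
      have "x \<in> F K2" using x j K(3) by (auto simp: F_def)
      then obtain i where i: "i \<in> K2" "x \<in> I i" using YI[OF jJ(2)] x unfolding F_def by blast
      have "i \<in> J" using i(1) K(2) J3J by blast
      then have "i = j" using disj[of i j] jJ x i by blast
      then show "j \<in> K2" using i by simp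
    qed
    show ?thesis by (rule inj_onI) (use key in blast)
  qed
  have card_W: "card W = (s * m) choose m"
    unfolding W_def using card_image[OF injF] n_subsets[OF J3(3), of m] J3(2) by simp
  \<comment> \<open>The bound on \<open>card (C z)\<close> is known only for vertices of items, so
    \<open>C\<close> gets the default \<open>{}\<close> on \<open>Y\<close>, where candidates are
    not asked for.\<close>
  have fib: "card (emb_fibre R A W n \<Gamma>) \<le> 2 ^ n * (card Z * \<Delta> ^ card Y) * k ^ n" for \<Gamma>
  proof (rule emb_fibre_bound[OF sym finA, where C = "\<lambda>z. if z \<in> Y then {} else C z"])
    show "conn R Y" using J0 by (simp add: Y_def)
    show "Y \<subseteq> Z" "Z \<subseteq> A" using ZA' by (auto simp: Z_def)
    show "Y \<subseteq> w \<and> w \<subseteq> Z" if "w \<in> W" for w using that by (auto simp: W_def F_def Z_def)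
    show "card {w \<in> Z. R z w} \<le> \<Delta>" if "z \<in> Z" for z
    proof -
      have fin: "finite (V \<union> (\<Union>j\<in>J. I j))" using finV J finI by auto
      have "card {w \<in> Z. R z w} \<le> card {w \<in> V \<union> (\<Union>j\<in>J. I j). R z w}"
      proof (rule card_mono)
        show "finite {w \<in> V \<union> (\<Union>j\<in>J. I j). R z w}"
          by (rule finite_subset[OF _ fin]) auto
      qed (use ZA in auto)
      also have "\<dots> \<le> \<Delta>" using that ZA by (intro deg) blast
      finally show ?thesis .
    qed
    show "\<Delta> \<ge> 1" using \<Delta> by simp
    show "finite (if z \<in> Y then {} else C z) \<and> card (if z \<in> Y then {} else C z) \<le> k" if "z \<in> Z" for z
    proof (cases "z \<in> Y")
      case False
      then have "z \<in> (\<Union>j\<in>J. I j)" using that J3J by (auto simp: Z_def)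
      then show ?thesis using C False by simp
    qed simp
    show "k \<ge> 1" by (rule k)
    fix w1 w2 \<phi> z
    assume h: "w1 \<in> W" "w2 \<in> W" "bij_betw \<phi> w1 w2"
      "\<And>x y. x \<in> w1 \<Longrightarrow> y \<in> w1 \<Longrightarrow> R (\<phi> x) (\<phi> y) \<longleftrightarrow> R x y"
      "\<And>y. y \<in> Y \<Longrightarrow> \<phi> y = y" "z \<in> w1" "z \<notin> Y"
    obtain K1 where K1: "K1 \<subseteq> J3" "w1 = F K1" using h by (auto simp: W_def)
    obtain K2 where K2: "K2 \<subseteq> J3" "w2 = F K2" using h by (auto simp: W_def)
    have e1: "w1 = U \<union> (\<Union>j\<in>J0 \<union> K1. I j)" and e2: "w2 = U \<union> (\<Union>j\<in>J0 \<union> K2. I j)"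
      using K1 K2 by (auto simp: F_def Y_def)
    obtain j where j: "j \<in> K1" "z \<in> I j" using h(6,7) K1 by (auto simp: F_def)
    have "\<phi> z \<in> C z"
    proof (rule det[of U "J0 \<union> K1" "J0 \<union> K2" \<phi> j])
      show "S V j \<subseteq> U" if "j \<in> J0 \<union> K1 \<union> (J0 \<union> K2)" for j
      proof -
        have "j \<in> J'" using that J0(1) K1(1) K2(1) J3J(2) by blast
        then show ?thesis by (simp add: J'_def)
      qed
      show "bij_betw \<phi> (U \<union> (\<Union>j\<in>J0 \<union> K1. I j)) (U \<union> (\<Union>j\<in>J0 \<union> K2. I j))"
        using h(3) e1 e2 by simp
      show "U \<subseteq> V" by (rule U(1))
      show "J0 \<union> K1 \<subseteq> J" "J0 \<union> K2 \<subseteq> J" using YV(2) K1(1) K2(1) J3J(1) by blast+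
      show "R (\<phi> x) (\<phi> y) \<longleftrightarrow> R x y"
        if "x \<in> U \<union> (\<Union>j\<in>J0 \<union> K1. I j)" "y \<in> U \<union> (\<Union>j\<in>J0 \<union> K1. I j)" for x y
        using h(4) that unfolding e1 by blast
      show "\<phi> u = u" if "u \<in> U" for u using h(5)[of u] that by (simp add: Y_def)
      show "j \<in> J0 \<union> K1" "z \<in> I j" using j by auto
    qed
    then show "\<phi> z \<in> (if z \<in> Y then {} else C z)" using h by simp
  qed
  have main: "(s * m) choose m \<le> c ^ n * (2 ^ n * (card Z * \<Delta> ^ card Y) * k ^ n)"
  proof -
    have "card W \<le> c ^ n * (2 ^ n * (card Z * \<Delta> ^ card Y) * k ^ n)"
      using cnt[unfolded counting_def, rule_format, of W n] cW fib by simp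
    then show ?thesis by (simp only: card_W)
  qed
  have s1: "s \<ge> 1" using s by simp
  have "s ^ m \<le> (s * m) choose m"
    using binomial_ge_n_over_k_pow_k[of m "s * m", where ?'a = real] m2 s1
    by (simp flip: of_nat_power)
  then have 1: "s ^ m \<le> (2 * c * k) ^ n * (card Z * \<Delta> ^ card Y)"
    using main by (simp add: power_mult_distrib algebra_simps)
  have cYU: "card Y \<le> (l + 1) * card U"
  proof -
    have "card Y \<le> card U + card (\<Union>j\<in>J0. I j)" unfolding Y_def by (rule card_Un_le)
    moreover have "l * card J0 \<le> l * card U" by (rule mult_le_mono2[OF J0(3)])
    ultimately show ?thesis unfolding cUN[OF YV(2)] add_mult_distrib by linarith
  qed
  have "\<Delta> ^ card Y \<le> \<Delta> ^ ((l + 1) * card U)" using cYU \<Delta> by (intro power_increasing) auto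
  also have "\<dots> \<le> (2 ^ \<mu>) ^ card U" unfolding power_mult using \<Delta> by (intro power_mono) auto
  also have "\<dots> = 2 ^ m" by (simp add: m_def power_mult)
  finally have 2: "\<Delta> ^ card Y \<le> 2 ^ m" .
  \<comment> \<open>As \<Delta> is at least 2, the bound \<open>2 ^ m\<close> on its power also
    bounds \<open>card Y\<close> by \<open>m\<close>.\<close>
  have "(2::nat) ^ card Y \<le> \<Delta> ^ card Y" using \<Delta> by (intro power_mono) auto
  then have "(2::nat) ^ card Y \<le> 2 ^ m" using 2 by linarith
  then have Ym: "card Y \<le> m" by (simp add: power_increasing_iff)
  then have nm: "n \<le> (l + 1) * m" by (simp add: n_def)
  have "card Z \<le> card Y + card (\<Union>j\<in>J3. I j)" unfolding Z_def by (rule card_Un_le)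
  also have "\<dots> \<le> m + l * (s * m)" using Ym cUN[OF J3J(1)] J3(2) by simp
  also have "\<dots> \<le> s * m + l * (s * m)" using s1 by simp
  also have "\<dots> = (l + 1) * (m * s)" by (simp add: algebra_simps)
  also have "\<dots> \<le> (l + 1) ^ m * (2 ^ m * s)"
  proof (intro mult_mono)
    show "l + 1 \<le> (l + 1) ^ m" using m2 by (intro self_le_power) auto
    show "m \<le> 2 ^ m" using less_exp[of m] by simp
  qed auto
  finally have 3: "card Z \<le> (l + 1) ^ m * (2 ^ m * s)" .
  have 4: "(2 * c * k) ^ n \<le> (2 * c * k) ^ ((l + 1) * m)"
    using nm c k by (intro power_increasing) (auto simp: Suc_le_eq)
  have "s ^ m \<le> (2 * c * k) ^ ((l + 1) * m) * (((l + 1) ^ m * (2 ^ m * s)) * 2 ^ m)"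
    using 1 mult_mono[OF 4 mult_mono[OF 3 2]] by linarith
  also have "\<dots> = (4 * (l + 1) * (2 * c * k) ^ (l + 1)) ^ m * s"
  proof -
    have "(4::nat) ^ m = 2 ^ m * 2 ^ m" by (simp flip: power_mult_distrib)
    moreover have "(4 * (l + 1) * (2 * c * k) ^ (l + 1)) ^ m
        = 4 ^ m * (l + 1) ^ m * (2 * c * k) ^ ((l + 1) * m)"
      by (simp only: power_mult_distrib power_mult)
    ultimately show ?thesis by (simp only: ac_simps)
  qed
  also have "\<dots> < s ^ m"
    using s m2 c k by (intro exponential_gap) (auto simp: Suc_le_eq)
  finally show False by simp
qed

subsection \<open>Sparse graphs\<close>

text \<open>Auxiliary graphs are sets of two-element sets, because their edges also serve as indices
  of items; the host graph remains a relation on \<open>A\<close>.\<close>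

definition graph_on :: "'a set \<Rightarrow> 'a set set \<Rightarrow> bool" where
  "graph_on V E \<longleftrightarrow> finite V \<and> (\<forall>e\<in>E. e \<subseteq> V \<and> card e = 2)"

definition inside :: "'a set set \<Rightarrow> 'a set \<Rightarrow> 'a set set" where
  "inside E U = {e\<in>E. e \<subseteq> U}"

definition nb :: "'a set set \<Rightarrow> 'a set \<Rightarrow> 'a \<Rightarrow> 'a set" where
  "nb E U v = {u\<in>U. {u, v} \<in> E}"

lemma graph_on_finite: "graph_on V E \<Longrightarrow> finite E"
  by (rule finite_subset[of _ "Pow V"]) (auto simp: graph_on_def)

lemma graph_on_inside: "graph_on V E \<Longrightarrow> U \<subseteq> V \<Longrightarrow> graph_on U (inside E U)"
  by (auto simp: graph_on_def inside_def finite_subset)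

lemma handshake:
  assumes "graph_on V E"
  shows "(\<Sum>v\<in>V. card (nb E V v)) = 2 * card E"
proof -
  have "card (nb E V v) = card {e\<in>E. v \<in> e}" if "v \<in> V" for v
  proof -
    have "bij_betw (\<lambda>u. {u, v}) (nb E V v) {e\<in>E. v \<in> e}"
    proof (rule bij_betwI')
      fix e assume "e \<in> {e\<in>E. v \<in> e}"
      then have e: "e \<in> E" "v \<in> e" "card e = 2" "e \<subseteq> V" using assms by (auto simp: graph_on_def)
      then obtain a b where "e = {a, b}" by (auto simp: card_2_iff)
      then show "\<exists>u\<in>nb E V v. e = {u, v}" using e by (auto simp: nb_def insert_commute)
    qed (auto simp: nb_def doubleton_eq_iff)
    then show ?thesis by (rule bij_betw_same_card)
  qed
  then have "(\<Sum>v\<in>V. card (nb E V v)) = (\<Sum>v\<in>V. card {e\<in>E. v \<in> e})" by simp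
  also have "\<dots> = 2 * card E"
  proof (rule sum_multicount)
    show "\<forall>e\<in>E. card {v\<in>V. v \<in> e} = 2"
    proof
      fix e assume "e \<in> E"
      then have "{v\<in>V. v \<in> e} = e" "card e = 2" using assms by (auto simp: graph_on_def)
      then show "card {v\<in>V. v \<in> e} = 2" by simp
    qed
  qed (use assms graph_on_finite in \<open>auto simp: graph_on_def\<close>)
  finally show ?thesis .
qed

lemma card_cross:
  assumes "finite T" "finite B" "T \<inter> B = {}"
  shows "card {e\<in>E. \<exists>x\<in>T. \<exists>b\<in>B. e = {x, b}} = (\<Sum>b\<in>B. card (nb E T b))"
proof -
  have "bij_betw (\<lambda>(b, x). {x, b}) (SIGMA b:B. nb E T b) {e\<in>E. \<exists>x\<in>T. \<exists>b\<in>B. e = {x, b}}"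
    unfolding bij_betw_def
  proof
    show "inj_on (\<lambda>(b, x). {x, b}) (SIGMA b:B. nb E T b)"
      using assms(3) by (fastforce simp: inj_on_def nb_def doubleton_eq_iff)
    show "(\<lambda>(b, x). {x, b}) ` (SIGMA b:B. nb E T b) = {e\<in>E. \<exists>x\<in>T. \<exists>b\<in>B. e = {x, b}}"
      by (force simp: nb_def)
  qed
  then have "card {e\<in>E. \<exists>x\<in>T. \<exists>b\<in>B. e = {x, b}} = card (SIGMA b:B. nb E T b)"
    by (simp add: bij_betw_same_card)
  also have "\<dots> = (\<Sum>b\<in>B. card (nb E T b))"
    using assms by (subst card_SigmaI) (auto simp: nb_def)
  finally show ?thesis .
qed

lemma low_degree_vertex:
  assumes "graph_on V E" "card (inside E U) \<le> a * card U" "U \<subseteq> V" "U \<noteq> {}"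
  shows "\<exists>v\<in>U. card (nb E U v) \<le> 2 * a"
proof (rule ccontr)
  assume h: "\<not> ?thesis"
  have fU: "finite U" using assms by (auto simp: graph_on_def finite_subset)
  have "(\<Sum>v\<in>U. 2 * a) < (\<Sum>v\<in>U. card (nb E U v))"
    using h fU assms(4) by (intro sum_strict_mono) (auto simp: not_le)
  also have "\<dots> = (\<Sum>v\<in>U. card (nb (inside E U) U v))"
    by (intro sum.cong arg_cong[where f=card]) (auto simp: nb_def inside_def)
  also have "\<dots> = 2 * card (inside E U)"
    by (rule handshake[OF graph_on_inside[OF assms(1,3)]])
  finally show False using assms(2) by (simp add: mult.commute)
qed

text \<open>Greedy: keep a vertex with at most \<open>q\<close> neighbours among those left and
  discard these neighbours. Each vertex kept accounts for at most \<open>q + 1\<close>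
  vertices.\<close>

lemma independent_subset:
  assumes "finite V" "\<And>U. U \<subseteq> V \<Longrightarrow> U \<noteq> {} \<Longrightarrow> \<exists>v\<in>U. card (nb E U v) \<le> q"
  shows "\<exists>I\<subseteq>V. (\<forall>u\<in>I. \<forall>v\<in>I. u \<noteq> v \<longrightarrow> {u, v} \<notin> E) \<and> card V \<le> (q + 1) * card I"
  using assms
proof (induction V rule: finite_psubset_induct)
  case (psubset V)
  show ?case
  proof (cases "V = {}")
    case False
    then obtain v where v: "v \<in> V" "card (nb E V v) \<le> q" using psubset.prems by blast
    let ?V = "V - insert v (nb E V v)"
    have "?V \<subset> V" using v by blast
    then have "\<exists>I\<subseteq>?V. (\<forall>u\<in>I. \<forall>v\<in>I. u \<noteq> v \<longrightarrow> {u, v} \<notin> E) \<and> card ?V \<le> (q + 1) * card I"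
      by (rule psubset.IH) (use psubset.prems in blast)
    then obtain I where I: "I \<subseteq> ?V" "\<forall>u\<in>I. \<forall>v\<in>I. u \<noteq> v \<longrightarrow> {u, v} \<notin> E" "card ?V \<le> (q + 1) * card I"
      by blast
    have finI: "finite I" using I psubset.hyps by (meson finite_Diff finite_subset)
    have "card (insert v (nb E V v)) \<le> q + 1" using v(2) card_insert_le_m1[of "q+1" "nb E V v" v] by simp
    moreover have "card V - card (insert v (nb E V v)) \<le> card ?V"
      by (rule diff_card_le_card_Diff) (use psubset.hyps in \<open>auto simp: nb_def\<close>)
    moreover have "card (insert v I) = Suc (card I)" using finI I by (subst card_insert_disjoint) auto
    ultimately have "card V \<le> (q + 1) * card (insert v I)" using I(3) by (simp add: algebra_simps)
    moreover have "\<forall>u\<in>insert v I. \<forall>w\<in>insert v I. u \<noteq> w \<longrightarrow> {u, w} \<notin> E"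
    proof -
      have "{u, v} \<notin> E" if "u \<in> I" for u using that I(1) by (auto simp: nb_def)
      then show ?thesis using I(2) by (auto simp: insert_commute)
    qed
    ultimately show ?thesis using I v by (intro exI[of _ "insert v I"]) auto
  qed auto
qed

text \<open>Peel off vertices that have at most \<open>q\<close> neighbours left; each edge is
  recorded at the endpoint removed first.\<close>

lemma bounded_orientation:
  assumes "finite V" "\<And>U. U \<subseteq> V \<Longrightarrow> U \<noteq> {} \<Longrightarrow> \<exists>v\<in>U. card (nb E U v) \<le> q"
  shows "\<exists>out. (\<forall>v\<in>V. out v \<subseteq> V \<and> card (out v) \<le> q) \<and>
    (\<forall>u\<in>V. \<forall>v\<in>V. {u, v} \<in> E \<and> u \<noteq> v \<longrightarrow> u \<in> out v \<or> v \<in> out u)"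
  using assms
proof (induction V rule: finite_psubset_induct)
  case (psubset V)
  show ?case
  proof (cases "V = {}")
    case False
    then obtain v where v: "v \<in> V" "card (nb E V v) \<le> q" using psubset.prems by blast
    let ?V = "V - {v}"
    have "?V \<subset> V" using v by blast
    then have "\<exists>out. (\<forall>v\<in>?V. out v \<subseteq> ?V \<and> card (out v) \<le> q) \<and>
        (\<forall>u\<in>?V. \<forall>v\<in>?V. {u, v} \<in> E \<and> u \<noteq> v \<longrightarrow> u \<in> out v \<or> v \<in> out u)"
      by (rule psubset.IH) (use psubset.prems in blast)
    then obtain out where out: "\<forall>v\<in>?V. out v \<subseteq> ?V \<and> card (out v) \<le> q"
        "\<forall>u\<in>?V. \<forall>v\<in>?V. {u, v} \<in> E \<and> u \<noteq> v \<longrightarrow> u \<in> out v \<or> v \<in> out u"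
      by blast
    show ?thesis
    proof (intro exI[of _ "out(v := nb E V v)"] conjI ballI impI)
      fix u assume "u \<in> V"
      then show "(out(v := nb E V v)) u \<subseteq> V" using out(1) by (auto simp: nb_def)
      show "card ((out(v := nb E V v)) u) \<le> q" using out(1) v \<open>u \<in> V\<close> by auto
    next
      fix u w assume "u \<in> V" "w \<in> V" "{u, w} \<in> E \<and> u \<noteq> w"
      then show "u \<in> (out(v := nb E V v)) w \<or> w \<in> (out(v := nb E V v)) u"
        using out(2) by (auto simp: nb_def insert_commute)
    qed
  qed auto
qed

text \<open>Greedy: a vertex \<open>b\<close> fails only if all pairs in \<open>N b\<close> are
  taken, and they stay taken. So \<open>N b\<close> is then a clique in the graph of the assigned
  pairs.\<close>

lemma distinct_pair_assignment:
  assumes "finite B"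
  shows "\<exists>B'\<subseteq>B. \<exists>p. inj_on p B' \<and> (\<forall>b\<in>B'. p b \<subseteq> N b \<and> card (p b) = 2) \<and>
    (\<forall>b\<in>B - B'. \<forall>e. e \<subseteq> N b \<and> card e = 2 \<longrightarrow> e \<in> p ` B')"
  using assms
proof (induction B rule: finite_induct)
  case empty then show ?case by auto
next
  case (insert b B)
  then obtain B' p where B': "B' \<subseteq> B" "inj_on p B'" "\<forall>b\<in>B'. p b \<subseteq> N b \<and> card (p b) = 2"
      "\<forall>b\<in>B - B'. \<forall>e. e \<subseteq> N b \<and> card e = 2 \<longrightarrow> e \<in> p ` B'" by auto
  have bB: "b \<notin> B'" using B' insert by auto
  show ?case
  proof (cases "\<exists>e. e \<subseteq> N b \<and> card e = 2 \<and> e \<notin> p ` B'")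
    case True
    then obtain e where e: "e \<subseteq> N b" "card e = 2" "e \<notin> p ` B'" by blast
    define g where "g = p(b := e)"
    have g: "g b = e" "\<And>x. x \<in> B' \<Longrightarrow> g x = p x" using bB by (auto simp: g_def)
    then have im: "g ` B' = p ` B'" by simp
    have "inj_on g B'" using B'(2) g(2) by (simp add: inj_on_def)
    then have "inj_on g (insert b B')" using e(3) im g(1) bB by (simp add: insert_absorb)
    moreover have "g ` insert b B' = insert e (p ` B')" using im g by simp
    moreover have "\<forall>b\<in>insert b B'. g b \<subseteq> N b \<and> card (g b) = 2" using B'(3) g e by auto
    ultimately show ?thesis using B'(1,4) by (intro exI[of _ "insert b B'"] exI[of _ g] conjI) auto
  next
    case False
    then show ?thesis using B' by (intro exI[of _ B'] exI[of _ p] conjI) auto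
  qed
qed

text \<open>Remove from \<open>T\<close> a vertex \<open>v\<close> with at most \<open>q\<close>
  neighbours. An \<open>N b\<close> that thereby falls below \<open>t\<close> elements of
  \<open>T\<close> consists there of \<open>v\<close> and \<open>t - 1\<close> neighbours of
  \<open>v\<close>, being a clique. There are at most \<open>q ^ (t - 1)\<close> such
  \<open>t\<close>-sets, and each lies in at most \<open>t\<close> of the sets
  \<open>N b\<close>.\<close>

lemma clique_incidence_bound:
  assumes "finite T" and finB: "finite B" and loopfree: "\<And>v. {v} \<notin> E"
    and low: "\<And>U. U \<subseteq> T \<Longrightarrow> U \<noteq> {} \<Longrightarrow> \<exists>v\<in>U. card (nb E U v) \<le> q"
    and clique: "\<And>b e. b \<in> B \<Longrightarrow> e \<subseteq> N b \<Longrightarrow> card e = 2 \<Longrightarrow> e \<in> E"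
    and codeg: "\<And>S. card S = t \<Longrightarrow> card {b\<in>B. S \<subseteq> N b} \<le> t" and t: "t \<ge> 1"
  shows "card {b\<in>B. t \<le> card (N b \<inter> T)} \<le> card T * (t * q ^ (t - 1))"
  using assms(1) low
proof (induction T rule: finite_psubset_induct)
  case (psubset T)
  show ?case
  proof (cases "T = {}")
    case True
    then show ?thesis using t by (auto simp: card_eq_0_iff)
  next
    case False
    then obtain v where v: "v \<in> T" "card (nb E T v) \<le> q" using psubset.prems by blast
    let ?T = "T - {v}"
    let ?K = "{S. S \<subseteq> nb E T v \<and> card S = t - 1}"
    have fnb: "finite (nb E T v)" using psubset.hyps by (auto simp: nb_def)
    have fK: "finite ?K" using fnb by auto
    have IH: "card {b\<in>B. t \<le> card (N b \<inter> ?T)} \<le> card ?T * (t * q ^ (t - 1))"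
    proof (rule psubset.IH)
      show "?T \<subset> T" using v by blast
      show "\<exists>v\<in>U. card (nb E U v) \<le> q" if "U \<subseteq> ?T" "U \<noteq> {}" for U
        using psubset.prems that by blast
    qed
    have "card ?K \<le> q ^ (t - 1)"
    proof -
      have "card ?K = card (nb E T v) choose (t - 1)" by (rule n_subsets[OF fnb])
      also have "\<dots> \<le> card (nb E T v) ^ (t - 1)"
        by (cases "t - 1 \<le> card (nb E T v)") (auto intro: binomial_le_pow simp: not_le binomial_eq_0)
      also have "\<dots> \<le> q ^ (t - 1)" using v(2) by (rule power_mono) simp
      finally show ?thesis .
    qed
    have sub: "{b\<in>B. t \<le> card (N b \<inter> T)} \<subseteq> {b\<in>B. t \<le> card (N b \<inter> ?T)} \<union> (\<Union>S\<in>?K. {b\<in>B. insert v S \<subseteq> N b})"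
    proof
      fix b assume b: "b \<in> {b\<in>B. t \<le> card (N b \<inter> T)}"
      show "b \<in> {b\<in>B. t \<le> card (N b \<inter> ?T)} \<union> (\<Union>S\<in>?K. {b\<in>B. insert v S \<subseteq> N b})"
      proof (cases "t \<le> card (N b \<inter> ?T)")
        case False
        have fin: "finite (N b \<inter> ?T)" using psubset.hyps by auto
        have vN: "v \<in> N b"
        proof (rule ccontr)
          assume "v \<notin> N b"
          then have "N b \<inter> ?T = N b \<inter> T" by auto
          then show False using False b by auto
        qed
        then have "N b \<inter> T = insert v (N b \<inter> ?T)" using v by auto
        then have "card (N b \<inter> T) = Suc (card (N b \<inter> ?T))" using fin by simp
        then have "card (N b \<inter> ?T) = t - 1" using False b by auto
        moreover have "N b \<inter> ?T \<subseteq> nb E T v"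
        proof
          fix u assume u: "u \<in> N b \<inter> ?T"
          then have "{u, v} \<subseteq> N b" "card {u, v} = 2" using vN by auto
          then have "{u, v} \<in> E" using clique b by blast
          then show "u \<in> nb E T v" using u by (auto simp: nb_def)
        qed
        ultimately have "N b \<inter> ?T \<in> ?K" by simp
        then show ?thesis using b vN by blast
      qed (use b in auto)
    qed
    have "card {b\<in>B. insert v S \<subseteq> N b} \<le> t" if S: "S \<in> ?K" for S
    proof (cases "v \<in> S")
      case True
      then have "v \<in> nb E T v" using S by auto
      then show ?thesis using loopfree[of v] by (simp add: nb_def)
    next
      case False
      then have "card (insert v S) = t" using S t fnb by (auto simp: finite_subset)
      then show ?thesis by (rule codeg)
    qed
    then have "card (\<Union>S\<in>?K. {b\<in>B. insert v S \<subseteq> N b}) \<le> card ?K * t"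
      using card_UN_le[OF fK, of "\<lambda>S. {b\<in>B. insert v S \<subseteq> N b}"]
        sum_bounded_above[of ?K "\<lambda>S. card {b\<in>B. insert v S \<subseteq> N b}" t] by simp
    also have "\<dots> \<le> t * q ^ (t - 1)" using \<open>card ?K \<le> q ^ (t - 1)\<close> by (simp add: mult.commute)
    finally have "card (\<Union>S\<in>?K. {b\<in>B. insert v S \<subseteq> N b}) \<le> t * q ^ (t - 1)" .
    then have "card {b\<in>B. t \<le> card (N b \<inter> T)} \<le> card ?T * (t * q ^ (t - 1)) + t * q ^ (t - 1)"
      using card_mono[OF _ sub] IH finB fK card_Un_le[of "{b\<in>B. t \<le> card (N b \<inter> ?T)}" "\<Union>S\<in>?K. {b\<in>B. insert v S \<subseteq> N b}"]
      by fastforce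
    also have "\<dots> = card T * (t * q ^ (t - 1))"
      using v psubset.hyps card_Suc_Diff1[OF psubset.hyps(1) v(1)] by (metis add.commute mult_Suc)
    finally show ?thesis .
  qed
qed

text \<open>Handshaking makes \<open>T\<close> at most one fiftieth of \<open>V\<close>, so few
  edges lie inside \<open>T\<close>. Vertices with fewer than \<open>D / 8\<close> neighbours in
  \<open>T\<close> send at most \<open>D * card V / 8\<close> edges there, and the other cross edges
  lie inside \<open>T \<union> B\<close>, where sparsity bounds them by
  \<open>card T + card B\<close>. So if fewer than half of the required edges avoid
  \<open>T\<close>, then \<open>B\<close> must be a constant fraction of \<open>V\<close>.\<close>

lemma degree_dichotomy:
  assumes G: "graph_on V E" and V: "V \<noteq> {}" and E: "D * card V \<le> card E"
    and sparse: "\<And>U. U \<subseteq> V \<Longrightarrow> card (inside E U) \<le> (D + 1) * card U"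
    and D: "D \<ge> 100" and \<Delta>: "\<Delta> \<ge> 100 * (D + 1)"
  defines "T \<equiv> {v\<in>V. card (nb E V v) > \<Delta>}"
  shows "D * card V \<le> 2 * card (inside E (V - T)) \<or>
    (\<exists>B\<subseteq>V - T. B \<noteq> {} \<and> (\<forall>b\<in>B. D \<le> 8 * card (nb E T b)) \<and> card V \<le> 4 * card B \<and>
      \<Delta> * card T \<le> 8 * (D + 1) * card B)"
proof (cases "D * card V \<le> 2 * card (inside E (V - T))")
  case False
  have finV: "finite V" using G by (simp add: graph_on_def)
  have finE: "finite E" using G graph_on_finite by blast
  have TV: "T \<subseteq> V" by (auto simp: T_def)
  have finT: "finite T" using TV finV finite_subset by blast
  define B where "B = {b\<in>V - T. D \<le> 8 * card (nb E T b)}"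
  have finB: "finite B" using finV by (auto simp: B_def)
  have "\<Delta> * card T = (\<Sum>v\<in>T. \<Delta>)" by simp
  also have "\<dots> \<le> (\<Sum>v\<in>T. card (nb E V v))" by (intro sum_mono) (auto simp: T_def)
  also have "\<dots> \<le> (\<Sum>v\<in>V. card (nb E V v))" by (rule sum_mono2[OF finV TV]) auto
  also have "\<dots> = 2 * card E" by (rule handshake[OF G])
  finally have T1: "\<Delta> * card T \<le> 2 * card E" .
  have "inside E V = E" using G by (auto simp: inside_def graph_on_def)
  then have E2: "card E \<le> (D + 1) * card V" using sparse[of V] by simp
  have "100 * (D + 1) * card T \<le> \<Delta> * card T" using \<Delta> by (rule mult_right_mono) simp
  then have "50 * ((D + 1) * card T) \<le> (D + 1) * card V"
    using T1 E2 unfolding mult.assoc by linarith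
  then have "(D + 1) * (50 * card T) \<le> (D + 1) * card V" by (simp only: mult.left_commute)
  then have T2: "50 * card T \<le> card V" by (simp only: mult_le_cancel1)
  let ?Cr = "{e\<in>E. \<exists>x\<in>T. \<exists>b\<in>V - T. e = {x, b}}"
  have "E \<subseteq> inside E (V - T) \<union> inside E T \<union> ?Cr"
  proof
    fix e assume e: "e \<in> E"
    then have "card e = 2" "e \<subseteq> V" using G by (auto simp: graph_on_def)
    then obtain a b where ab: "e = {a, b}" "a \<in> V" "b \<in> V" by (auto simp: card_2_iff)
    then show "e \<in> inside E (V - T) \<union> inside E T \<union> ?Cr"
      using e unfolding inside_def by (cases "a \<in> T"; cases "b \<in> T") (auto simp: insert_commute)
  qed
  then have "card E \<le> card (inside E (V - T) \<union> inside E T \<union> ?Cr)"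
    by (rule card_mono[rotated]) (use finE in \<open>auto simp: inside_def\<close>)
  also have "\<dots> \<le> card (inside E (V - T)) + card (inside E T) + card ?Cr"
    by (meson add_le_mono1 card_Un_le order_trans)
  finally have S1: "card E \<le> card (inside E (V - T)) + card (inside E T) + card ?Cr" .
  have "card ?Cr = (\<Sum>b\<in>V - T. card (nb E T b))"
    using finT finV by (intro card_cross) auto
  also have "\<dots> = (\<Sum>b\<in>B. card (nb E T b)) + (\<Sum>b\<in>V - T - B. card (nb E T b))"
    using finV by (subst sum.subset_diff[of B]) (auto simp: B_def)
  also have "(\<Sum>b\<in>B. card (nb E T b)) = card {e\<in>E. \<exists>x\<in>T. \<exists>b\<in>B. e = {x, b}}"
    using finT finB by (subst card_cross) (auto simp: B_def)
  also have "\<dots> \<le> card (inside E (T \<union> B))"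
    using finE by (intro card_mono) (auto simp: inside_def)
  also have "\<dots> \<le> (D + 1) * card (T \<union> B)" using TV by (intro sparse) (auto simp: B_def)
  also have "\<dots> \<le> (D + 1) * (card T + card B)" by (intro mult_left_mono card_Un_le) simp
  finally have S2: "card ?Cr \<le> (D + 1) * (card T + card B) + (\<Sum>b\<in>V - T - B. card (nb E T b))"
    by simp
  have "8 * (\<Sum>b\<in>V - T - B. card (nb E T b)) \<le> (\<Sum>b\<in>V - T - B. D)"
    unfolding sum_distrib_left by (intro sum_mono) (auto simp: B_def)
  also have "\<dots> \<le> card V * D" using finV by (auto intro!: card_mono)
  finally have S3: "8 * (\<Sum>b\<in>V - T - B. card (nb E T b)) \<le> D * card V" by (simp add: mult.commute)
  have S4: "card (inside E T) \<le> (D + 1) * card T" by (rule sparse[OF TV])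
  have "8 * (D * card V) \<le> 4 * (D * card V) + 8 * ((D + 1) * card T) + 8 * ((D + 1) * (card T + card B)) + D * card V"
    using False E S1 S2 S3 S4 by linarith
  then have S5: "3 * (D * card V) \<le> 16 * ((D + 1) * card T) + 8 * ((D + 1) * card B)"
    by (simp add: algebra_simps)
  have S6: "50 * ((D + 1) * card T) \<le> (D + 1) * card V"
    using mult_left_mono[OF T2, of "D + 1"] by (simp add: algebra_simps)
  \<comment> \<open>Lets \<open>D\<close> and \<open>D + 1\<close> be exchanged at a loss of one
    percent, so that \<open>S5\<close> and \<open>S6\<close> become comparable.\<close>
  have S7: "100 * ((D + 1) * card V) \<le> 101 * (D * card V)"
  proof -
    have "100 * card V \<le> D * card V" using D by (rule mult_right_mono) simp
    then show ?thesis by (simp add: algebra_simps)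
  qed
  have "(D + 1) * card V \<le> (D + 1) * (4 * card B)"
    using S5 S6 S7 unfolding mult.left_commute[of "D + 1" 4] by linarith
  then have VB: "card V \<le> 4 * card B" by (simp only: mult_le_cancel1)
  have "\<Delta> * card T \<le> 2 * ((D + 1) * card V)" using T1 E2 by linarith
  also have "\<dots> \<le> 2 * ((D + 1) * (4 * card B))" using VB by (intro mult_left_mono) auto
  finally have "\<Delta> * card T \<le> 8 * (D + 1) * card B" by (simp add: algebra_simps)
  moreover have "B \<noteq> {}" using VB V finV by auto
  ultimately show ?thesis using VB by (intro disjI2 exI[of _ B]) (auto simp: B_def)
qed simp

text \<open>An integer form of \<open>10 * L * log w \<le> w / (16 * h ^ 4)\<close>: for
  \<open>q\<close> the integer seventh root of \<open>w\<close>,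
  \<open>w \<le> (q + 1) ^ 7 \<le> 2 ^ (7 * q)\<close>, while
  \<open>70 * q * L * 16 * h ^ 4 \<le> 1120 * q ^ 6 \<le> q ^ 7\<close> since \<open>L\<close> and
  \<open>h\<close> are at most \<open>q\<close>.\<close>

lemma power_le_exp_div:
  fixes h w L :: nat
  assumes h: "h \<ge> 5000" and w: "w \<ge> h ^ 7" and L: "L \<le> h"
  shows "w ^ (10 * L) \<le> 2 ^ (w div (16 * h ^ 4))"
proof -
  define q where "q = (GREATEST q. q ^ 7 \<le> w)"
  have bd: "\<And>q. q ^ 7 \<le> w \<Longrightarrow> q \<le> w" 
  proof -
    fix q :: nat assume "q ^ 7 \<le> w"
    moreover have "q \<le> q ^ 7" by (cases "q = 0") (auto intro: self_le_power)
    ultimately show "q \<le> w" by simp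
  qed
  have q7: "q ^ 7 \<le> w" unfolding q_def by (rule GreatestI_nat[of _ h w]) (use w bd in auto)
  have hq: "h \<le> q" unfolding q_def by (rule Greatest_le_nat[of _ _ w]) (use w bd in auto)
  have "\<not> (Suc q) ^ 7 \<le> w"
  proof
    assume "(Suc q) ^ 7 \<le> w"
    then have "Suc q \<le> q" unfolding q_def by (intro Greatest_le_nat[of _ _ w]) (use bd in auto)
    then show False by simp
  qed
  then have wq: "w \<le> (Suc q) ^ 7" by simp
  also have "\<dots> \<le> (2 ^ q) ^ 7" by (intro power_mono) (use Suc_leI[OF less_exp[of q]] in auto)
  finally have "w ^ (10 * L) \<le> ((2 ^ q) ^ 7) ^ (10 * L)" by (rule power_mono) simp
  also have "\<dots> = 2 ^ (70 * q * L)" by (simp add: power_mult[symmetric] ac_simps)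
  also have "\<dots> \<le> 2 ^ (w div (16 * h ^ 4))"
  proof (rule power_increasing)
    have "70 * q * L * (16 * h ^ 4) \<le> 70 * q * q * (16 * q ^ 4)"
      using L hq by (intro mult_mono power_mono) auto
    also have "\<dots> = 1120 * (q * q * q ^ 4)" by simp
    also have "\<dots> = 1120 * q ^ 6"
      by (simp only: power_add[symmetric] power2_eq_square[symmetric]) simp
    also have "\<dots> \<le> q * q ^ 6" using h hq by (intro mult_right_mono) auto
    also have "\<dots> \<le> w" using q7 power_Suc[of q 6] by simp
    finally show "70 * q * L \<le> w div (16 * h ^ 4)" using h by (subst less_eq_div_iff_mult_less_eq) auto
  qed simp
  finally show ?thesis .
qed

subsection \<open>Induced subdivisions\<close>

text \<open>
  An induced \<open>l\<close>-subdivision of the graph \<open>(V, E)\<close>, except that the \<open>l\<close> internal vertices \<open>I e\<close> of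
  the path replacing \<open>e\<close> need only form a connected set: the path structure is irrelevant for counting.
\<close>

definition model :: "'a set \<Rightarrow> ('a \<Rightarrow> 'a \<Rightarrow> bool) \<Rightarrow> nat \<Rightarrow> 'a set \<Rightarrow> 'a set set \<Rightarrow> ('a set \<Rightarrow> 'a set) \<Rightarrow> bool" where
  "model A R l V E I \<longleftrightarrow> graph_on V E \<and> V \<subseteq> A \<and> (\<forall>u\<in>V. \<forall>v\<in>V. \<not> R u v) \<and>
    (\<forall>e\<in>E. I e \<subseteq> A - V \<and> card (I e) = l \<and> conn R (I e)) \<and>
    (\<forall>e\<in>E. \<forall>f\<in>E. e \<noteq> f \<longrightarrow> I e \<inter> I f = {} \<and> (\<forall>x\<in>I e. \<forall>y\<in>I f. \<not> R x y)) \<and>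
    (\<forall>e\<in>E. \<forall>v\<in>V. (\<exists>x\<in>I e. R x v) \<longleftrightarrow> v \<in> e)"

lemma modelD:
  assumes "model A R l V E I"
  shows "graph_on V E" "V \<subseteq> A" "\<And>u v. u \<in> V \<Longrightarrow> v \<in> V \<Longrightarrow> \<not> R u v"
    "\<And>e. e \<in> E \<Longrightarrow> I e \<subseteq> A - V" "\<And>e. e \<in> E \<Longrightarrow> card (I e) = l" "\<And>e. e \<in> E \<Longrightarrow> conn R (I e)"
    "\<And>e f. e \<in> E \<Longrightarrow> f \<in> E \<Longrightarrow> e \<noteq> f \<Longrightarrow> I e \<inter> I f = {}"
    "\<And>e f x y. e \<in> E \<Longrightarrow> f \<in> E \<Longrightarrow> e \<noteq> f \<Longrightarrow> x \<in> I e \<Longrightarrow> y \<in> I f \<Longrightarrow> \<not> R x y"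
    "\<And>e v. e \<in> E \<Longrightarrow> v \<in> V \<Longrightarrow> (\<exists>x\<in>I e. R x v) \<longleftrightarrow> v \<in> e"
    "\<And>e. e \<in> E \<Longrightarrow> e \<subseteq> V"
proof -
  note m = assms[unfolded model_def]
  show G: "graph_on V E" by (rule conjunct1[OF m])
  note m = conjunct2[OF m]
  show "V \<subseteq> A" by (rule conjunct1[OF m])
  note m = conjunct2[OF m]
  show "\<not> R u v" if "u \<in> V" "v \<in> V" for u v by (rule conjunct1[OF m, rule_format, OF that])
  note m = conjunct2[OF m]
  note n = conjunct1[OF m, rule_format]
  show "I e \<subseteq> A - V" "card (I e) = l" "conn R (I e)" if "e \<in> E" for e using n[OF that] by auto
  note m = conjunct2[OF m]
  note n = conjunct1[OF m, rule_format]
  show "I e \<inter> I f = {}" if "e \<in> E" "f \<in> E" "e \<noteq> f" for e f using n[OF that] by (rule conjunct1)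
  show "\<not> R x y" if "e \<in> E" "f \<in> E" "e \<noteq> f" "x \<in> I e" "y \<in> I f" for e f x y
    using conjunct2[OF n[OF that(1-3)]] that(4,5) by blast
  show "(\<exists>x\<in>I e. R x v) \<longleftrightarrow> v \<in> e" if "e \<in> E" "v \<in> V" for e v
    by (rule conjunct2[OF m, rule_format, OF that])
  show "e \<subseteq> V" if "e \<in> E" for e using G that by (simp add: graph_on_def)
qed

lemma model_subset:
  assumes "model A R l V E I" "U \<subseteq> V" "F \<subseteq> inside E U"
  shows "model A R l U F I"
proof -
  note M = modelD[OF assms(1)]
  have FE: "e \<in> E" if "e \<in> F" for e using assms(3) that by (auto simp: inside_def)
  have UV: "v \<in> V" if "v \<in> U" for v using assms(2) that by blast
  show ?thesis unfolding model_def
  proof (intro conjI ballI impI)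
    show "graph_on U F" using assms by (auto simp: model_def graph_on_def inside_def finite_subset)
    show "U \<subseteq> A" using M(2) assms(2) by blast
    show "\<not> R u v" if "u \<in> U" "v \<in> U" for u v by (rule M(3)[OF UV[OF that(1)] UV[OF that(2)]])
    show "I e \<subseteq> A - U" if "e \<in> F" for e using M(4)[OF FE[OF that]] assms(2) by blast
    show "card (I e) = l" "conn R (I e)" if "e \<in> F" for e using M(5,6)[OF FE[OF that]] .
    show "I e \<inter> I f = {}" if "e \<in> F" "f \<in> F" "e \<noteq> f" for e f
      by (rule M(7)[OF FE[OF that(1)] FE[OF that(2)] that(3)])
    show "\<not> R x y" if "e \<in> F" "f \<in> F" "e \<noteq> f" "x \<in> I e" "y \<in> I f" for e f x y
      by (rule M(8)[OF FE[OF that(1)] FE[OF that(2)] that(3-5)])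
    show "(\<exists>x\<in>I e. R x v) \<longleftrightarrow> v \<in> e" if "e \<in> F" "v \<in> U" for e v
      by (rule M(9)[OF FE[OF that(1)] UV[OF that(2)]])
  qed
qed

text \<open>An isomorphism that fixes \<open>U\<close> sends the connected set \<open>I e\<close>
  outside \<open>U\<close>, hence into one single \<open>I f\<close>, as distinct items are not
  adjacent. Attachments to \<open>U\<close> are preserved, so \<open>e \<subseteq> f\<close> and
  thus \<open>e = f\<close>: at most \<open>l\<close> candidates per vertex. A branch vertex has at
  most \<open>l * d\<close> neighbours in the system, an inner vertex at most \<open>l + 2\<close>;
  \<open>l * (d + 3)\<close> covers both.\<close>

lemma model_low_degree:
  assumes sym: "symp R" and finA: "finite A" and cnt: "counting c A R" and c: "c \<ge> 1"
    and m: "model A R l V E I" and V: "V \<noteq> {}" and l: "l \<ge> 1"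
    and deg: "\<And>v. v \<in> V \<Longrightarrow> card (nb E V v) \<le> d"
    and \<mu>: "(l * (d + 3)) ^ (l + 1) \<le> 2 ^ \<mu>" "\<mu> \<ge> 2"
    and s: "s > (4 * (l + 1) * (2 * c * l) ^ (l + 1))\<^sup>2"
    and dens: "(1 + s * \<mu>) * card V \<le> card E"
  shows False
proof -
  note M = modelD[OF m]
  have finV: "finite V" using M(1) by (simp add: graph_on_def)
  have finE: "finite E" by (rule graph_on_finite[OF M(1)])
  have finI: "finite (I e)" if "e \<in> E" for e using M(4)[OF that] finA finite_subset by blast
  have ne: "e \<noteq> {}" "card e = 2" if "e \<in> E" for e using M(1) that by (auto simp: graph_on_def)
  \<comment> \<open>The union has one term, the item containing \<open>z\<close>, by
    disjointness.\<close>
  define C where "C = (\<lambda>z. \<Union>e\<in>{e\<in>E. z \<in> I e}. I e)"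
  have CI: "C z = I e" if "e \<in> E" "z \<in> I e" for e z
    using that M(7) unfolding C_def by blast
  let ?S = "\<lambda>e. {v\<in>V. \<exists>x\<in>I e. R x v}"
  have S: "?S e = e" if "e \<in> E" for e using M(9)[OF that] M(10)[OF that] by blast
  let ?Z = "V \<union> (\<Union>e\<in>E. I e)"
  show False
  proof (rule item_system_bound[OF sym finA cnt c M(2) V finE, where C = C and k = l and l = l
        and I = I and \<Delta> = "l * (d + 3)" and \<mu> = \<mu> and s = s])
    show "I e \<subseteq> A - V \<and> card (I e) = l \<and> conn R (I e)" if "e \<in> E" for e using M(4,5,6)[OF that] by simp
    show "I e \<inter> I f = {}" if "e \<in> E" "f \<in> E" "e \<noteq> f" for e f by (rule M(7)[OF that])
    show "?S e \<noteq> {}" if "e \<in> E" for e using S[OF that] ne(1)[OF that] by simp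
    show "finite (C z)" for z unfolding C_def using finE finI by auto
    show "card (C z) \<le> l" if "z \<in> (\<Union>e\<in>E. I e)" for z
      using that CI M(5) by auto
    show "l \<ge> 1" "\<mu> \<ge> 2" by (fact l \<mu>)+
    show "2 \<le> l * (d + 3)" using mult_le_mono[OF l, of 2 "d + 3"] by simp
    show "(l * (d + 3)) ^ (l + 1) \<le> 2 ^ \<mu>" by (rule \<mu>(1))
    show "s > (4 * (l + 1) * (2 * c * l) ^ (l + 1))\<^sup>2" by (rule s)
    show "(1 + s * \<mu>) * card V \<le> card E" by (rule dens)
  next
    fix z assume z: "z \<in> ?Z"
    show "card {w \<in> ?Z. R z w} \<le> l * (d + 3)"
    proof (cases "z \<in> V")
      case True
      let ?F = "(\<lambda>u. {u, z}) ` nb E V z"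
      have FE: "?F \<subseteq> E" by (auto simp: nb_def)
      have "{w \<in> ?Z. R z w} \<subseteq> (\<Union>e\<in>?F. I e)"
      proof
        fix w assume w: "w \<in> {w \<in> ?Z. R z w}"
        then have "w \<notin> V" using M(3)[OF True] by blast
        then obtain e where e: "e \<in> E" "w \<in> I e" using w by blast
        have "R w z" using w sym by (auto dest: sympD)
        then have "z \<in> e" using M(9)[OF e(1) True] e by blast
        then obtain u where "e = {u, z}" using ne(2)[OF e(1)] by (auto simp: card_2_iff)
        moreover have "u \<in> V" using M(10)[OF e(1)] calculation by auto
        ultimately show "w \<in> (\<Union>e\<in>?F. I e)" using e by (auto simp: nb_def)
      qed
      then have "card {w \<in> ?Z. R z w} \<le> card (\<Union>e\<in>?F. I e)"
        by (rule card_mono[rotated]) (use finV finI FE in \<open>auto simp: nb_def\<close>)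
      also have "\<dots> \<le> (\<Sum>e\<in>?F. card (I e))"
        by (rule card_UN_le) (use finV in \<open>auto simp: nb_def\<close>)
      also have "\<dots> = (\<Sum>e\<in>?F. l)" using FE M(5) by (intro sum.cong) auto
      also have "\<dots> = card ?F * l" by simp
      also have "\<dots> \<le> d * l"
        using card_image_le[of "nb E V z" "\<lambda>u. {u, z}"] deg[OF True] finV
        by (intro mult_right_mono) (auto simp: nb_def)
      finally show ?thesis by (simp add: algebra_simps)
    next
      case False
      then obtain e where e: "e \<in> E" "z \<in> I e" using z by blast
      have "{w \<in> ?Z. R z w} \<subseteq> I e \<union> e"
      proof
        fix w assume w: "w \<in> {w \<in> ?Z. R z w}"
        show "w \<in> I e \<union> e"
        proof (cases "w \<in> V")
          case True then show ?thesis using w e M(9)[OF e(1) True] by blast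
        next
          case False
          then obtain f where "f \<in> E" "w \<in> I f" using w by blast
          then show ?thesis using M(8)[OF e(1), of f z w] e w by blast
        qed
      qed
      then have "card {w \<in> ?Z. R z w} \<le> card (I e \<union> e)"
        by (rule card_mono[rotated]) (use finI[OF e(1)] ne(2)[OF e(1)] card.infinite in fastforce)
      also have "\<dots> \<le> l + 2" using card_Un_le[of "I e" e] M(5)[OF e(1)] ne(2)[OF e(1)] by simp
      also have "\<dots> \<le> l * (d + 3)" using l by (simp add: algebra_simps)
      finally show ?thesis .
    qed
  next
    fix U J1 J2 \<phi> e z
    assume U: "U \<subseteq> V" and J: "J1 \<subseteq> E" "J2 \<subseteq> E"
      and SU: "\<And>j. j \<in> J1 \<union> J2 \<Longrightarrow> ?S j \<subseteq> U"
      and bij: "bij_betw \<phi> (U \<union> (\<Union>j\<in>J1. I j)) (U \<union> (\<Union>j\<in>J2. I j))"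
      and iso: "\<And>x y. x \<in> U \<union> (\<Union>j\<in>J1. I j) \<Longrightarrow> y \<in> U \<union> (\<Union>j\<in>J1. I j) \<Longrightarrow> R (\<phi> x) (\<phi> y) \<longleftrightarrow> R x y"
      and fx: "\<And>u. u \<in> U \<Longrightarrow> \<phi> u = u" and e: "e \<in> J1" and z: "z \<in> I e"
    have eE: "e \<in> E" using e J by auto
    have eU: "e \<subseteq> U" using SU[of e] e unfolding S[OF eE] by simp
    let ?W = "U \<union> (\<Union>j\<in>J1. I j)"
    have inj: "inj_on \<phi> ?W" using bij by (simp add: bij_betw_def)
    have out: "\<exists>f\<in>J2. \<phi> x \<in> I f" if "x \<in> I e" for x
    proof -
      have xW: "x \<in> ?W" using that e by blast
      have "\<phi> x \<notin> U"
      proof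
        assume "\<phi> x \<in> U"
        then have "\<phi> (\<phi> x) = \<phi> x" "\<phi> x \<in> ?W" using fx by auto
        then have "\<phi> x = x" using inj xW by (auto simp: inj_on_def)
        then show False using \<open>\<phi> x \<in> U\<close> that M(4)[OF eE] U by auto
      qed
      moreover have "\<phi> x \<in> U \<union> (\<Union>j\<in>J2. I j)" using bij xW by (auto simp: bij_betw_def)
      ultimately show ?thesis by blast
    qed
    obtain f where f: "f \<in> J2" "\<phi> z \<in> I f" using out[OF z] by blast
    have fE: "f \<in> E" using f J by auto
    \<comment> \<open>If part of \<open>I e\<close> went to \<open>I f\<close> and the rest
      elsewhere, connectivity would give an edge between the parts, and its image would join two
      distinct items.\<close>
    have all: "\<phi> x \<in> I f" if "x \<in> I e" for x
    proof (rule ccontr)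
      assume x: "\<phi> x \<notin> I f"
      let ?P = "{y\<in>I e. \<phi> y \<in> I f}"
      have "?P \<subset> I e" "?P \<noteq> {}" using that x z f by auto
      then obtain a b where ab: "a \<in> ?P" "b \<in> I e - ?P" "R a b"
        using M(6)[OF eE] unfolding conn_def by meson
      then have "R (\<phi> a) (\<phi> b)" using iso[of a b] e by blast
      moreover obtain g where "g \<in> J2" "\<phi> b \<in> I g" using out[of b] ab by blast
      ultimately show False using M(8)[OF fE, of g "\<phi> a" "\<phi> b"] ab J by blast
    qed
    have "e \<subseteq> f"
    proof
      fix u assume u: "u \<in> e"
      then have uU: "u \<in> U" "u \<in> V" using eU U by auto
      then obtain x where x: "x \<in> I e" "R x u" using M(9)[OF eE, of u] u by blast
      then have "R (\<phi> x) (\<phi> u)" using iso[of x u] e uU by blast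
      then have "R (\<phi> x) u" using fx[OF uU(1)] by simp
      then show "u \<in> f" using M(9)[OF fE uU(2)] all[OF x(1)] by blast
    qed
    then have "e = f" using ne(2)[OF eE] ne(2)[OF fE] by (metis card_subset_eq card.infinite zero_neq_numeral)
    then show "\<phi> z \<in> C z" using f CI[OF eE z] by simp
  qed
qed

text \<open>Each \<open>b\<close> becomes an inner vertex: \<open>K b\<close> is \<open>b\<close>
  with the items of the edges to the two vertices of \<open>p b\<close>, which makes
  \<open>2 * l + 1\<close> vertices. The other items at \<open>b\<close> are dropped, so
  \<open>K b\<close> touches only \<open>p b\<close> in \<open>T\<close>.\<close>

lemma model_resubdivide:
  assumes sym: "symp R" and finA: "finite A" and m: "model A R l V E I" and T: "T \<subseteq> V" and B: "B \<subseteq> V - T"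
    and p: "inj_on p B" "\<And>b. b \<in> B \<Longrightarrow> p b \<subseteq> nb E T b \<and> card (p b) = 2"
  shows "\<exists>I'. model A R (2 * l + 1) T (p ` B) I'"
proof -
  note M = modelD[OF m]
  define q where "q = the_inv_into B p"
  define K where "K = (\<lambda>b. insert b (\<Union>x\<in>p b. I {x, b}))"
  have finI: "finite (I e)" if "e \<in> E" for e using M(4)[OF that] finA finite_subset by blast
  have pT: "p b \<subseteq> T" if "b \<in> B" for b using p(2)[OF that] by (auto simp: nb_def)
  have pE: "{x, b} \<in> E" if "b \<in> B" "x \<in> p b" for b x using p(2)[OF that(1)] that by (auto simp: nb_def)
  have q: "q (p b) = b" if "b \<in> B" for b using p(1) that by (simp add: q_def the_inv_into_f_f)
  have symR: "R y x" if "R x y" for x y using sym that by (auto dest: sympD)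
  have BV: "b \<in> V" "b \<notin> T" if "b \<in> B" for b using B that by auto
  have KA: "K b \<subseteq> A - T \<and> card (K b) = 2 * l + 1 \<and> conn R (K b)" if b: "b \<in> B" for b
  proof -
    obtain x y where xy: "p b = {x, y}" "x \<noteq> y" using p(2)[OF b] by (auto simp: card_2_iff)
    have e: "{x, b} \<in> E" "{y, b} \<in> E" using pE[OF b] xy by auto
    have bT: "b \<in> V" "b \<notin> T" using B b by auto
    have ne: "{x, b} \<noteq> {y, b}" using xy(2) by (auto simp: doubleton_eq_iff)
    have K: "K b = insert b (I {x, b}) \<union> I {y, b}" unfolding K_def xy by auto
    have b1: "b \<notin> I {x, b}" "b \<notin> I {y, b}" using M(4)[OF e(1)] M(4)[OF e(2)] bT by auto
    have "card (K b) = card (insert b (I {x, b})) + card (I {y, b})"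
      unfolding K using M(7)[OF e ne] b1 finI e by (intro card_Un_disjoint) auto
    then have card: "card (K b) = 2 * l + 1" using b1 finI[OF e(1)] M(5)[OF e(1)] M(5)[OF e(2)] by simp
    obtain u where u: "u \<in> I {x, b}" "R u b" using M(9)[OF e(1) bT(1)] by auto
    obtain v where v: "v \<in> I {y, b}" "R v b" using M(9)[OF e(2) bT(1)] by auto
    have "conn R (insert b (I {x, b}))" by (rule conn_insert[OF sym M(6)[OF e(1)] u])
    then have "conn R (K b)" unfolding K
      using conn_Un[OF sym _ M(6)[OF e(2)] _ v(1) symR[OF v(2)]] by blast
    moreover have "K b \<subseteq> A - T" using M(4)[OF e(1)] M(4)[OF e(2)] bT M(2) T unfolding K by blast
    ultimately show ?thesis using card by simp
  qed
  have sep: "K b \<inter> K b' = {} \<and> (\<forall>x\<in>K b. \<forall>y\<in>K b'. \<not> R x y)" if b: "b \<in> B" "b' \<in> B" "b \<noteq> b'" for b b'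
  proof -
    have ne: "{x, b} \<noteq> {x', b'}" if "x \<in> p b" "x' \<in> p b'" for x x'
      using that b pT BV by (auto simp: doubleton_eq_iff)
    have b1: "b' \<notin> I {x, b} \<and> (\<forall>z\<in>I {x, b}. \<not> R z b')" if "x \<in> p b" for x
      using M(4)[OF pE[OF b(1) that]] M(9)[OF pE[OF b(1) that] BV(1)[OF b(2)]] BV b that pT by blast
    have b2: "b \<notin> I {x, b'} \<and> (\<forall>z\<in>I {x, b'}. \<not> R z b)" if "x \<in> p b'" for x
      using M(4)[OF pE[OF b(2) that]] M(9)[OF pE[OF b(2) that] BV(1)[OF b(1)]] BV b that pT by blast
    have b3: "\<not> R b b'" by (rule M(3)[OF BV(1)[OF b(1)] BV(1)[OF b(2)]])
    have b4: "I {x, b} \<inter> I {x', b'} = {} \<and> (\<forall>y\<in>I {x, b}. \<forall>y'\<in>I {x', b'}. \<not> R y y')"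
      if "x \<in> p b" "x' \<in> p b'" for x x'
      using M(7,8)[OF pE[OF b(1) that(1)] pE[OF b(2) that(2)] ne[OF that]] by blast
    have "K b \<inter> K b' = {}" unfolding K_def using b1 b2 b4 b(3) by blast
    moreover have "\<not> R x y" if "x \<in> K b" "y \<in> K b'" for x y
      using that b1 b2 b3 b4 symR unfolding K_def by blast
    ultimately show ?thesis by blast
  qed
  have att: "(\<exists>x\<in>K b. R x v) \<longleftrightarrow> v \<in> p b" if b: "b \<in> B" and v: "v \<in> T" for b v
  proof
    have vV: "v \<in> V" using v T by auto
    assume "\<exists>x\<in>K b. R x v"
    then obtain x where x: "x \<in> K b" "R x v" by blast
    then have "x \<noteq> b" using M(3)[OF BV(1)[OF b] vV] by auto
    then obtain y where y: "y \<in> p b" "x \<in> I {y, b}" using x by (auto simp: K_def)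
    then have "v \<in> {y, b}" using M(9)[OF pE[OF b y(1)] vV] x by blast
    then show "v \<in> p b" using v BV(2)[OF b] y by auto
  next
    assume vp: "v \<in> p b"
    then obtain x where "x \<in> I {v, b}" "R x v"
      using M(9)[OF pE[OF b vp], of v] v T by auto
    then show "\<exists>x\<in>K b. R x v" using vp by (auto simp: K_def)
  qed
  have "model A R (2 * l + 1) T (p ` B) (K \<circ> q)"
    unfolding model_def
  proof (intro conjI ballI impI)
    show "graph_on T (p ` B)" using p(2) pT T M(1) by (auto simp: graph_on_def finite_subset)
    show "T \<subseteq> A" using T M(2) by auto
    show "\<not> R u v" if "u \<in> T" "v \<in> T" for u v using that T M(3) by blast
  next
    fix e assume "e \<in> p ` B"
    then obtain b where b: "b \<in> B" "e = p b" by blast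
    have e: "(K \<circ> q) e = K b" using b q by simp
    show "(K \<circ> q) e \<subseteq> A - T" "card ((K \<circ> q) e) = 2 * l + 1" "conn R ((K \<circ> q) e)"
      unfolding e using KA[OF b(1)] by auto
    show "(\<exists>x\<in>(K \<circ> q) e. R x v) \<longleftrightarrow> v \<in> e" if "v \<in> T" for v
      unfolding e unfolding b(2) by (rule att[OF b(1) that])
    fix f assume "f \<in> p ` B" and ef: "e \<noteq> f"
    then obtain b' where b': "b' \<in> B" "f = p b'" by blast
    have f: "(K \<circ> q) f = K b'" using b' q by simp
    have bb: "b \<noteq> b'" using ef b b' by auto
    show "(K \<circ> q) e \<inter> (K \<circ> q) f = {}" unfolding e f using sep[OF b(1) b'(1) bb] by blast
    show "\<not> R x y" if "x \<in> (K \<circ> q) e" "y \<in> (K \<circ> q) f" for x y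
      using sep[OF b(1) b'(1) bb] that unfolding e f by blast
  qed
  then show ?thesis by blast
qed

text \<open>
  With \<open>L = l + 1\<close>, this exceeds the constant needed in \<open>item_system_bound\<close> for items of size \<open>l\<close> and
  grows only polynomially when \<open>L\<close> is doubled, which is the effect of resubdividing.
\<close>

definition thr :: "nat \<Rightarrow> nat \<Rightarrow> nat" where
  "thr c L = ((100 * c)\<^sup>2) ^ (L\<^sup>2)"

text \<open>The square in the exponent turns doubling into a fourth power. Resubdividing doubles
  \<open>L\<close> exactly, since \<open>(2 * l + 1) + 1 = 2 * (l + 1)\<close>.\<close>

lemma thr_double: "thr c (2 * L) = thr c L ^ 4"
  by (simp add: thr_def power_mult[symmetric] power_mult_distrib mult.commute)

lemma thr_ge:
  assumes "c \<ge> 1" "L \<ge> 1"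
  shows "thr c L \<ge> 10000" "L \<le> thr c L"
proof -
  have b: "10000 \<le> (100 * c)\<^sup>2" using power_mono[of 100 "100 * c" 2] assms by simp
  have "(100 * c)\<^sup>2 ^ 1 \<le> ((100 * c)\<^sup>2) ^ (L\<^sup>2)" using assms b by (intro power_increasing) auto
  then show "thr c L \<ge> 10000" using b by (simp add: thr_def)
  have "L \<le> 2 ^ L" using less_exp[of L] by simp
  also have "\<dots> \<le> 2 ^ (L\<^sup>2)" by (intro power_increasing) (auto simp: power2_eq_square)
  also have "\<dots> \<le> ((100 * c)\<^sup>2) ^ (L\<^sup>2)" using b by (intro power_mono) auto
  finally show "L \<le> thr c L" by (simp add: thr_def)
qed

text \<open>With \<open>L = l + 1\<close>, the estimates \<open>4 * L \<le> 4 ^ L\<close> and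
  \<open>l \<le> 2 ^ L\<close> bring everything to the exponent \<open>L\<^sup>2\<close>, where the
  base \<open>4 * (2 * c) * 2 = 16 * c\<close> is below \<open>100 * c\<close>.\<close>

lemma thr_gt:
  assumes "c \<ge> 1" "l \<ge> 1"
  shows "(4 * (l + 1) * (2 * c * l) ^ (l + 1))\<^sup>2 < thr c (l + 1)"
proof -
  let ?L = "l + 1"
  have LL: "?L \<le> ?L\<^sup>2" by (simp add: power2_eq_square)
  have "4 * ?L \<le> 4 ^ ?L"
  proof -
    have "l + 1 \<le> 2 ^ l" using Suc_leI[OF less_exp[of l]] by simp
    also have "\<dots> \<le> 4 ^ l" by (rule power_mono) auto
    finally have "l + 1 \<le> 4 ^ l" .
    then show ?thesis by simp
  qed
  also have "\<dots> \<le> (4::nat) ^ (?L\<^sup>2)" by (rule power_increasing[OF LL]) simp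
  finally have 1: "4 * ?L \<le> 4 ^ (?L\<^sup>2)" .
  have "l \<le> 2 ^ ?L" using less_exp[of ?L] by simp
  then have "(2 * c * l) ^ ?L \<le> (2 * c * 2 ^ ?L) ^ ?L" by (intro power_mono mult_left_mono) auto
  also have "\<dots> = (2 * c) ^ ?L * 2 ^ (?L\<^sup>2)" by (simp only: power_mult_distrib power_mult[symmetric] power2_eq_square)
  also have "\<dots> \<le> (2 * c) ^ (?L\<^sup>2) * 2 ^ (?L\<^sup>2)"
    using power_increasing[OF LL, of "2 * c"] assms by (intro mult_right_mono) auto
  finally have 2: "(2 * c * l) ^ ?L \<le> (2 * c) ^ (?L\<^sup>2) * 2 ^ (?L\<^sup>2)" .
  have "4 * ?L * (2 * c * l) ^ ?L \<le> 4 ^ (?L\<^sup>2) * ((2 * c) ^ (?L\<^sup>2) * 2 ^ (?L\<^sup>2))"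
    using 1 2 by (rule mult_mono) auto
  also have "\<dots> = (16 * c) ^ (?L\<^sup>2)"
    by (simp only: power_mult_distrib[symmetric] mult.assoc[symmetric]) (simp add: ac_simps)
  also have "\<dots> < (100 * c) ^ (?L\<^sup>2)" using assms by (intro power_strict_mono) auto
  finally have "(4 * ?L * (2 * c * l) ^ ?L)\<^sup>2 < ((100 * c) ^ (?L\<^sup>2))\<^sup>2"
    by (intro power_strict_mono) auto
  also have "\<dots> = thr c ?L" by (simp only: thr_def power_mult[symmetric] mult.commute)
  finally show ?thesis .
qed

section \<open>Excluding induced subdivisions of large cliques and of dense graphs\<close>

lemma div_bounds:
  fixes h w :: nat
  assumes "h \<ge> 5000" "w \<ge> h ^ 7"
  shows "w div (16 * h ^ 4) \<ge> 2" "16 * (h ^ 4 * (w div (16 * h ^ 4))) \<le> w" "w \<ge> 5000"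
proof -
  have "32 * h ^ 4 \<le> h ^ 3 * h ^ 4"
    using assms self_le_power[of h 3] by (intro mult_right_mono) auto
  also have "\<dots> = h ^ 7" by (simp flip: power_add)
  finally have "32 * h ^ 4 \<le> w" using assms by simp
  then have "2 * (16 * h ^ 4) \<le> w" by simp
  then show "w div (16 * h ^ 4) \<ge> 2" using assms by (subst less_eq_div_iff_mult_less_eq) auto
  show "16 * (h ^ 4 * (w div (16 * h ^ 4))) \<le> w"
    using times_div_less_eq_dividend[of "16 * h ^ 4" w] by (simp add: mult.assoc)
  show "w \<ge> 5000" using assms self_le_power[of h 7] by simp
qed

text \<open>A clique on \<open>w\<close> vertices has \<open>(w - 1) / 2\<close> edges per vertex
  and degrees below \<open>w\<close>, so a cost logarithmic in the degree is negligible. The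
  hypotheses with \<open>h ^ 4\<close> and \<open>2 * h\<close> fit the situation after one
  resubdivision.\<close>

lemma no_clique_model:
  assumes sym: "symp R" and finA: "finite A" and cnt: "counting c A R" and c: "c \<ge> 1"
    and m: "model A R l U F I" and F: "F = {e. e \<subseteq> U \<and> card e = 2}" and l: "l \<ge> 1"
    and s: "thr c (l + 1) \<le> h ^ 4" "l \<le> 2 * h" and h: "h \<ge> 5000" "card U \<ge> h ^ 7"
  shows False
proof -
  define w where "w = card U"
  define \<mu> where "\<mu> = w div (16 * h ^ 4)"
  have w: "w \<ge> h ^ 7" using h by (simp add: w_def)
  note dv = div_bounds[OF h(1) w, folded \<mu>_def]
  have finU: "finite U" using dv(3) by (metis w_def card.infinite not_numeral_le_zero)
  have hw: "h \<le> w" using w self_le_power[of h 7] h by simp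
  show False
  proof (rule model_low_degree[OF sym finA cnt c m _ l, where d = w and \<mu> = \<mu> and s = "h ^ 4"])
    show "U \<noteq> {}" using dv(3) by (auto simp: w_def)
    show "card (nb F U v) \<le> w" for v unfolding w_def using finU by (intro card_mono) (auto simp: nb_def)
    show "2 \<le> \<mu>" by (rule dv(1))
    show "(4 * (l + 1) * (2 * c * l) ^ (l + 1))\<^sup>2 < h ^ 4"
      using thr_gt[OF c l] s by simp
    have "l * (w + 3) \<le> w ^ 2 * w ^ 2"
    proof (rule mult_mono)
      have "2 * h \<le> w * w" using hw dv(3) by (intro mult_mono) auto
      then show "l \<le> w ^ 2" using s by (simp add: power2_eq_square)
      have "w + 3 \<le> 2 * w" using dv(3) by simp
      also have "\<dots> \<le> w * w" using dv(3) by (intro mult_right_mono) auto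
      finally show "w + 3 \<le> w ^ 2" by (simp add: power2_eq_square)
    qed auto
    then have "(l * (w + 3)) ^ (l + 1) \<le> (w ^ 2 * w ^ 2) ^ (l + 1)" by (rule power_mono) simp
    also have "\<dots> = w ^ (4 * (l + 1))" by (simp only: power_add[symmetric] power_mult[symmetric]) simp
    also have "\<dots> \<le> w ^ (10 * h)" using s h dv(3) by (intro power_increasing) auto
    also have "\<dots> \<le> 2 ^ \<mu>" unfolding \<mu>_def by (rule power_le_exp_div[OF h(1) w]) simp
    finally show "(l * (w + 3)) ^ (l + 1) \<le> 2 ^ \<mu>" .
    have "card F = w choose 2" unfolding F w_def by (rule n_subsets[OF finU])
    then have cF: "2 * card F = w * (w - 1)"
      by (cases w) (simp_all add: choose_two)
    have "2 * (1 + h ^ 4 * \<mu>) \<le> w - 1" using dv(2,3) by simp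
    then have "w * (2 * (1 + h ^ 4 * \<mu>)) \<le> w * (w - 1)" by (rule mult_left_mono) simp
    then show "(1 + h ^ 4 * \<mu>) * card U \<le> card F" unfolding cF[symmetric] w_def[symmetric]
      by (simp add: algebra_simps)
  qed
qed

text \<open>\<open>D\<close> is maximised over all \<open>l\<close> together, since resubdividing
  changes \<open>l\<close>; finiteness of \<open>A\<close> bounds it. For a fixed \<open>l\<close>
  maximality gives sparsity of all parts, and across different \<open>l\<close> it excludes the
  resubdivided graph. The eighth power ensures that a neighbourhood of size \<open>D / 8\<close>
  still has \<open>h ^ 7\<close> vertices.\<close>

lemma no_dense_model:
  assumes sym: "symp R" and finA: "finite A" and cnt: "counting c A R" and c: "c \<ge> 1"
    and m0: "model A R l0 V0 E0 I0" and l0: "l0 \<ge> 1" and V0: "V0 \<noteq> {}"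
    and D0: "D0 * card V0 \<le> card E0" "D0 \<ge> thr c (l0 + 1) ^ 8"
  shows False
proof -
  define P where "P = (\<lambda>D. \<exists>l V E I. model A R l V E I \<and> l \<ge> 1 \<and> V \<noteq> {} \<and>
      D * card V \<le> card E \<and> D \<ge> thr c (l + 1) ^ 8)"
  have bd: "D \<le> 2 ^ card A" if PD: "P D" for D
  proof -
    obtain l V E I where m: "model A R l V E I" "V \<noteq> {}" "D * card V \<le> card E"
      using PD unfolding P_def by blast
    have "E \<subseteq> Pow A" using modelD(2,10)[OF m(1)] by blast
    then have "card E \<le> 2 ^ card A" using card_mono[of "Pow A" E] finA by (simp add: card_Pow)
    moreover have "card V \<ge> 1"
      using m(2) finite_subset[OF modelD(2)[OF m(1)] finA] by (simp add: Suc_le_eq card_gt_0_iff)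
    ultimately show ?thesis using m(3) mult_le_mono2[of 1 "card V" D] by linarith
  qed
  have P0: "P D0" unfolding P_def using m0 l0 V0 D0 by blast
  define D where "D = (GREATEST D. P D)"
  have PD: "P D" unfolding D_def by (rule GreatestI_nat[of P D0 "2 ^ card A"]) (use P0 bd in auto)
  have max: "D' \<le> D" if "P D'" for D'
    unfolding D_def by (rule Greatest_le_nat[of P D' "2 ^ card A"]) (use that bd in auto)
  obtain l V E I where m: "model A R l V E I" and l: "l \<ge> 1" and V: "V \<noteq> {}"
    and E: "D * card V \<le> card E" and D: "D \<ge> thr c (l + 1) ^ 8" using PD unfolding P_def by blast
  define h where "h = thr c (l + 1)"
  have h: "h \<ge> 10000" "l + 1 \<le> h" using thr_ge[OF c, of "l + 1"] by (auto simp: h_def)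
  have D8: "D \<ge> h ^ 8" using D by (simp add: h_def)
  have "h ^ 7 \<le> h ^ 8" using h by (intro power_increasing) auto
  then have D7: "D \<ge> h ^ 7" using D8 by linarith
  have h5: "h \<ge> 5000" using h by simp
  note dv = div_bounds[OF h5 D7]
  have hD: "h \<le> D" using D7 self_le_power[of h 7] h by simp
  note G = modelD(1)[OF m]
  have finV: "finite V" using G by (simp add: graph_on_def)
  have sparse: "card (inside E U) \<le> (D + 1) * card U" if U: "U \<subseteq> V" for U
  proof (cases "U = {}")
    case True
    then have "inside E U = {}" using G by (force simp: inside_def graph_on_def)
    then show ?thesis by simp
  next
    case False
    show ?thesis
    proof (rule ccontr)
      assume "\<not> ?thesis"
      moreover have "model A R l U (inside E U) I" by (rule model_subset[OF m U order_refl])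
      ultimately have "P (D + 1)" unfolding P_def using False l D
        by (intro exI[of _ l] exI[of _ U] exI[of _ "inside E U"] exI[of _ I]) auto
      then show False using max by fastforce
    qed
  qed
  \<comment> \<open>Chosen so that \<open>\<Delta> * card T \<le> 8 * (D + 1) * card B\<close>
    becomes \<open>D ^ 5 * card T \<le> card B\<close>.\<close>
  define \<Delta> where "\<Delta> = 8 * (D + 1) * D ^ 5"
  have D5: "D ^ 5 \<ge> 5000" using dv(3) self_le_power[of D 5] by simp
  have "100 * (D + 1) \<le> D ^ 5 * (8 * (D + 1))" using D5 by (intro mult_mono) auto
  then have \<Delta>: "\<Delta> \<ge> 100 * (D + 1)" by (simp add: \<Delta>_def ac_simps)
  define T where "T = {v\<in>V. card (nb E V v) > \<Delta>}"
  consider "D * card V \<le> 2 * card (inside E (V - T))"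
    | B where "B \<subseteq> V - T" "B \<noteq> {}" "\<And>b. b \<in> B \<Longrightarrow> D \<le> 8 * card (nb E T b)"
      "\<Delta> * card T \<le> 8 * (D + 1) * card B"
    using degree_dichotomy[OF G V E sparse _ \<Delta>, folded T_def] dv(3) by auto
  then show False
  proof cases
    case 1
    define U where "U = V - T"
    define \<mu> where "\<mu> = D div (16 * h ^ 4)"
    have UV: "U \<subseteq> V" by (auto simp: U_def)
    have mU: "model A R l U (inside E U) I" by (rule model_subset[OF m UV order_refl])
    have cV: "card V \<ge> 1" using V finV by (simp add: Suc_le_eq card_gt_0_iff)
    show False
    proof (rule model_low_degree[OF sym finA cnt c mU _ l, where d = \<Delta> and \<mu> = \<mu> and s = h])
      show "U \<noteq> {}"
      proof
        assume "U = {}"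
        then have "inside E U = {}" using G by (force simp: inside_def graph_on_def)
        then show False using 1 cV dv(3) by (simp add: U_def)
      qed
      show "card (nb (inside E U) U v) \<le> \<Delta>" if "v \<in> U" for v
      proof -
        have "card (nb (inside E U) U v) \<le> card (nb E V v)"
          using finV UV by (intro card_mono) (auto simp: nb_def inside_def)
        then show ?thesis using that by (auto simp: U_def T_def)
      qed
      show "2 \<le> \<mu>" using dv(1) by (simp add: \<mu>_def)
      show "(4 * (l + 1) * (2 * c * l) ^ (l + 1))\<^sup>2 < h" unfolding h_def by (rule thr_gt[OF c l])
      have "\<Delta> + 3 \<le> D ^ 9"
      proof -
        have "8 * (D + 1) * D ^ 5 \<le> (16 * D) * D ^ 5" using dv(3) by (intro mult_right_mono) auto
        moreover have "3 \<le> D * D ^ 5" using D5 dv(3) mult_le_mono[of 1 D 3 "D ^ 5"] by simp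
        ultimately have "\<Delta> + 3 \<le> 17 * D * D ^ 5" unfolding \<Delta>_def mult.assoc by linarith
        also have "\<dots> \<le> D ^ 3 * D * D ^ 5"
          using dv(3) self_le_power[of D 3] by (intro mult_right_mono) auto
        also have "\<dots> = D ^ 9" by (simp only: power_Suc2[symmetric] power_add[symmetric]) simp
        finally show ?thesis .
      qed
      then have "l * (\<Delta> + 3) \<le> D * D ^ 9" using h(2) hD by (intro mult_mono) auto
      then have "(l * (\<Delta> + 3)) ^ (l + 1) \<le> (D ^ 10) ^ (l + 1)" by (intro power_mono) (auto simp flip: power_Suc)
      also have "\<dots> = D ^ (10 * (l + 1))" by (rule power_mult[symmetric])
      also have "\<dots> \<le> 2 ^ \<mu>" unfolding \<mu>_def by (rule power_le_exp_div[OF h5 D7 h(2)])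
      finally show "(l * (\<Delta> + 3)) ^ (l + 1) \<le> 2 ^ \<mu>" .
      have "h * \<mu> \<le> h ^ 4 * \<mu>" using h self_le_power[of h 4] by (intro mult_right_mono) auto
      moreover have "2 * (1 + y) \<le> D" if "y \<le> x" "16 * x \<le> D" for x y :: nat
      proof -
        have "8 * (2 * (1 + y)) \<le> 16 + 16 * x" using that by simp
        also have "\<dots> \<le> 8 * D" using that dv(3) by simp
        finally show ?thesis by simp
      qed
      ultimately have "2 * (1 + h * \<mu>) \<le> D" using dv(2) by (simp only: \<mu>_def)
      then have "2 * (1 + h * \<mu>) * card U \<le> D * card V"
        using finV UV by (intro mult_mono card_mono) auto
      then show "(1 + h * \<mu>) * card U \<le> card (inside E U)" using 1 unfolding U_def by linarith
    qed
  next
    case (2 B)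
    have finB: "finite B" using 2(1) finV finite_subset by blast
    obtain B' p where B': "B' \<subseteq> B" "inj_on p B'" "\<forall>b\<in>B'. p b \<subseteq> nb E T b \<and> card (p b) = 2"
      "\<forall>b\<in>B - B'. \<forall>e. e \<subseteq> nb E T b \<and> card e = 2 \<longrightarrow> e \<in> p ` B'"
      using distinct_pair_assignment[OF finB, of "nb E T"] by (elim exE conjE)
    have TV: "T \<subseteq> V" by (auto simp: T_def)
    have B'V: "B' \<subseteq> V - T" using B'(1) 2(1) by blast
    obtain I' where m': "model A R (2 * l + 1) T (p ` B') I'"
      using model_resubdivide[OF sym finA m TV B'V B'(2)] B'(3) by blast
    have thr2: "thr c (2 * l + 1 + 1) = h ^ 4" using thr_double[of c "l + 1"] by (simp add: h_def)
    show False
    proof (cases "B' = B")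
      case True
      obtain b where b: "b \<in> B" using 2(2) by blast
      have "T \<noteq> {}" using 2(3)[OF b] dv(3) by (auto simp: nb_def)
      moreover have "D ^ 5 * card T \<le> card (p ` B')"
      proof -
        have "8 * (D + 1) * (D ^ 5 * card T) \<le> 8 * (D + 1) * card B"
          using 2(4) by (simp only: \<Delta>_def mult.assoc)
        then have "D ^ 5 * card T \<le> card B" by (simp only: mult_le_cancel1) simp
        then show ?thesis using True card_image[OF B'(2)] by simp
      qed
      \<comment> \<open>The new threshold is \<open>h ^ 4\<close>, and
        \<open>(h ^ 4) ^ 8 = (h ^ 8) ^ 4 \<le> D ^ 4\<close>. So density \<open>D ^ 5\<close> is
        admissible for the new length and exceeds the maximal \<open>D\<close>.\<close>
      moreover have "thr c (2 * l + 1 + 1) ^ 8 \<le> D ^ 5"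
      proof -
        have "(h ^ 4) ^ 8 = (h ^ 8) ^ 4" by (simp flip: power_mult)
        also have "\<dots> \<le> D ^ 4" using D8 by (rule power_mono) simp
        also have "\<dots> \<le> D ^ 5" using dv(3) by (intro power_increasing) auto
        finally show ?thesis by (simp only: thr2)
      qed
      ultimately have "P (D ^ 5)" unfolding P_def using m'
        by (intro exI[of _ "2 * l + 1"] exI[of _ T] exI[of _ "p ` B'"] exI[of _ I']) auto
      then have "D ^ 5 \<le> D" by (rule max)
      moreover have "D ^ 1 < D ^ 5" using dv(3) by (intro power_strict_increasing) auto
      ultimately show False by simp
    next
      case False
      then obtain b where b: "b \<in> B - B'" using B'(1) by blast
      define U where "U = nb E T b"
      define F where "F = {e. e \<subseteq> U \<and> card e = 2}"
      have UT: "U \<subseteq> T" by (auto simp: U_def nb_def)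
      \<comment> \<open>All pairs of neighbours of the failed \<open>b\<close> are assigned, so the
        resubdivided graph contains a clique on \<open>U\<close>.\<close>
      have "F \<subseteq> inside (p ` B') U" using B'(4) b by (auto simp: F_def U_def inside_def)
      then have mF: "model A R (2 * l + 1) U F I'" by (rule model_subset[OF m' UT])
      have "D \<le> 8 * card U" unfolding U_def by (rule 2(3)) (use b in blast)
      moreover have "8 * h ^ 7 \<le> h ^ 8"
        using h mult_right_mono[of 8 h "h ^ 7"] power_Suc[of h 7] by simp
      ultimately have "h ^ 7 \<le> card U" using D8 by linarith
      then show False
        using no_clique_model[OF sym finA cnt c mF F_def _ _ _ h5] thr2 h(2) by simp
    qed
  qed
qed

subsection \<open>Extracting induced subdivisions from sparse graphs\<close>

text \<open>\<open>(1 - 1 / s) ^ k \<ge> 1 - k / s \<ge> 1 / 2\<close>: if each vertex is sampled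
  with probability \<open>1 / s\<close>, then \<open>k\<close> given vertices are all missed with
  probability at least one half.\<close>

lemma bernoulli_nat:
  fixes s k :: nat
  assumes "2 * k \<le> s" "s \<ge> 1"
  shows "s ^ k \<le> 2 * (s - 1) ^ k"
proof -
  have "1 + real k * (- (1 / real s)) \<le> (1 + (- (1 / real s))) ^ k"
    using assms by (intro Bernoulli_inequality) (simp add: field_simps)
  moreover have "1 / 2 \<le> 1 + real k * (- (1 / real s))"
    using assms by (simp add: field_simps)
  ultimately have "1 / 2 \<le> (1 - 1 / real s) ^ k" by simp
  then have "real s ^ k * (1 / 2) \<le> real s ^ k * (1 - 1 / real s) ^ k"
    by (intro mult_left_mono) auto
  also have "\<dots> = (real s - 1) ^ k"
    using assms by (simp add: power_mult_distrib[symmetric] right_diff_distrib)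
  also have "\<dots> = real ((s - 1) ^ k)" using assms by (simp add: of_nat_diff)
  finally have "real (s ^ k) \<le> real (2 * (s - 1) ^ k)" by simp
  then show ?thesis by (simp only: of_nat_le_iff)
qed

text \<open>Keep each vertex with probability \<open>1 / s\<close>. The expected size of
  \<open>U\<close> is \<open>card V / s\<close>, and an edge survives with probability at least
  \<open>1 / (2 * s\<^sup>2)\<close>: both ends kept, all of \<open>F e\<close> missed. Comparing
  the two expectations yields a good sample.\<close>

lemma random_vertex_sample:
  assumes G: "graph_on V E" and E: "E \<noteq> {}"
    and F: "\<And>e. e \<in> E \<Longrightarrow> F e \<subseteq> V - e \<and> 2 * card (F e) \<le> s" and s: "s \<ge> 1"
  shows "\<exists>U\<subseteq>V. U \<noteq> {} \<and> card E * card U \<le> 2 * s * card V * card {e\<in>E. e \<subseteq> U \<and> F e \<inter> U = {}}"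
proof (rule ccontr)
  assume neg: "\<not> ?thesis"
  \<comment> \<open>The uniform probability space: a vertex is kept when its value is 0, one of
    \<open>s\<close> values. Expectations appear as sums over \<Omega>.\<close>
  define \<Omega> where "\<Omega> = V \<rightarrow>\<^sub>E {0..<s}"
  define U where "U = (\<lambda>f::'a \<Rightarrow> nat. {v\<in>V. f v = 0})"
  define g where "g = (\<lambda>f. card {e\<in>E. e \<subseteq> U f \<and> F e \<inter> U f = {}})"
  have finV: "finite V" using G by (simp add: graph_on_def)
  have finE: "finite E" by (rule graph_on_finite[OF G])
  have fin\<Omega>: "finite \<Omega>" unfolding \<Omega>_def using finV by (simp add: finite_PiE)
  have e: "e \<subseteq> V" "card e = 2" "e \<noteq> {}" "finite e" if "e \<in> E" for e
    using G that by (auto simp: graph_on_def intro: finite_subset)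
  obtain e0 where e0: "e0 \<in> E" using E by blast
  have VN: "V \<noteq> {}" using e[OF e0] by auto
  have U: "s * (\<Sum>f\<in>\<Omega>. card (U f)) = card V * s ^ card V"
  proof -
    have "s * card {f\<in>\<Omega>. f v = 0} = s ^ card V" if v: "v \<in> V" for v
    proof -
      have "{f\<in>\<Omega>. f v = 0} = PiE V (\<lambda>x. if x = v then {0} else {0..<s})"
        using v s unfolding \<Omega>_def by (auto simp: PiE_iff extensional_def split: if_splits)
      then have "card {f\<in>\<Omega>. f v = 0} = (\<Prod>x\<in>V. if x = v then 1 else s)"
        using finV by (simp add: card_PiE if_distrib cong: if_cong)
      also have "\<dots> = (\<Prod>x\<in>V - {v}. s)"
        using finV v by (subst prod.remove[of V v]) (auto intro!: prod.cong)
      also have "\<dots> = s ^ (card V - 1)" using v by simp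
      finally show ?thesis using v finV VN
        by (metis One_nat_def Suc_pred card_gt_0_iff power_Suc)
    qed
    then have "(\<Sum>v\<in>V. s * card {f\<in>\<Omega>. f v = 0}) = card V * s ^ card V" by simp
    moreover have "(\<Sum>f\<in>\<Omega>. card (U f)) = (\<Sum>v\<in>V. card {f\<in>\<Omega>. f v = 0})"
    proof -
      have "(\<Sum>f\<in>\<Omega>. card (U f)) = (\<Sum>f\<in>\<Omega>. \<Sum>v\<in>V. if f v = 0 then 1 else 0)"
        unfolding U_def using finV by (simp add: sum.If_cases Int_def)
      also have "\<dots> = (\<Sum>v\<in>V. \<Sum>f\<in>\<Omega>. if f v = 0 then 1 else 0)" by (rule sum.swap)
      also have "\<dots> = (\<Sum>v\<in>V. card {f\<in>\<Omega>. f v = 0})"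
        using fin\<Omega> by (simp add: sum.If_cases Int_def)
      finally show ?thesis .
    qed
    ultimately show ?thesis by (simp add: sum_distrib_left)
  qed
  have ge: "s ^ card V \<le> 2 * s\<^sup>2 * card {f\<in>\<Omega>. e \<subseteq> U f \<and> F e \<inter> U f = {}}" if eE: "e \<in> E" for e
  proof -
    let ?c = "\<lambda>x. if x \<in> e then {0} else if x \<in> F e then {1..<s} else {0..<s}"
    let ?R = "V - e - F e"
    note ee = e[OF eE] and FF = F[OF eE]
    have finF: "finite (F e)" using FF finV finite_subset by blast
    have "{f\<in>\<Omega>. e \<subseteq> U f \<and> F e \<inter> U f = {}} = PiE V ?c"
    proof (intro set_eqI iffI)
      fix f assume f: "f \<in> {f\<in>\<Omega>. e \<subseteq> U f \<and> F e \<inter> U f = {}}"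
      have "f x \<in> ?c x" if "x \<in> V" for x
        using f that by (auto simp: \<Omega>_def U_def PiE_iff)
      then show "f \<in> PiE V ?c" using f by (auto simp: \<Omega>_def PiE_iff)
    next
      fix f assume f: "f \<in> PiE V ?c"
      have fx: "f x \<in> ?c x" if "x \<in> V" for x using PiE_mem[OF f that] .
      have lt: "f x < s" if "x \<in> V" for x using fx[OF that] s by (auto split: if_splits)
      have z: "f x = 0" if "x \<in> e" for x using fx[of x] that ee by auto
      have nz: "f x \<noteq> 0" if "x \<in> F e" for x using fx[of x] that FF by auto
      have "f \<in> \<Omega>" using f lt by (auto simp: \<Omega>_def PiE_iff)
      moreover have "e \<subseteq> U f" using z ee(1) by (auto simp: U_def)
      moreover have "F e \<inter> U f = {}" using nz by (fastforce simp: U_def)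
      ultimately show "f \<in> {f\<in>\<Omega>. e \<subseteq> U f \<and> F e \<inter> U f = {}}"
        by simp
    qed
    then have "card {f\<in>\<Omega>. e \<subseteq> U f \<and> F e \<inter> U f = {}} = (\<Prod>x\<in>V. card (?c x))"
      using finV by (simp add: card_PiE)
    also have "\<dots> = (\<Prod>x\<in>e. card (?c x)) * (\<Prod>x\<in>V - e. card (?c x))"
      using finV ee by (subst prod.subset_diff[of e]) (auto simp: mult.commute)
    also have "(\<Prod>x\<in>e. card (?c x)) = 1" by simp
    also have "(\<Prod>x\<in>V - e. card (?c x)) = (\<Prod>x\<in>F e. card (?c x)) * (\<Prod>x\<in>?R. card (?c x))"
      using finV FF by (subst prod.subset_diff[of "F e"]) (auto simp: mult.commute)
    also have "(\<Prod>x\<in>F e. card (?c x)) = (\<Prod>x\<in>F e. s - 1)" using FF by (intro prod.cong) auto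
    also have "(\<Prod>x\<in>?R. card (?c x)) = (\<Prod>x\<in>?R. s)" by (intro prod.cong) auto
    finally have c: "card {f\<in>\<Omega>. e \<subseteq> U f \<and> F e \<inter> U f = {}} = (s - 1) ^ card (F e) * s ^ card ?R"
      by simp
    have "card V = 2 + card (V - e)"
      using card_Diff_subset[OF ee(4,1)] card_mono[OF finV ee(1)] ee(2) by simp
    also have "card (V - e) = card (F e) + card ?R"
      using card_Diff_subset[OF finF, of "V - e"] card_mono[of "V - e" "F e"] finV FF by simp
    finally have "s ^ card V = s\<^sup>2 * (s ^ card (F e) * s ^ card ?R)" by (simp only: power_add)
    also have "\<dots> \<le> s\<^sup>2 * ((2 * (s - 1) ^ card (F e)) * s ^ card ?R)"
      using bernoulli_nat[OF _ s, of "card (F e)"] FF by (intro mult_left_mono mult_right_mono) auto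
    also have "\<dots> = 2 * s\<^sup>2 * ((s - 1) ^ card (F e) * s ^ card ?R)" by simp
    finally show ?thesis by (simp only: c)
  qed
  have gsum: "(\<Sum>f\<in>\<Omega>. g f) = (\<Sum>e\<in>E. card {f\<in>\<Omega>. e \<subseteq> U f \<and> F e \<inter> U f = {}})"
  proof -
    have "(\<Sum>f\<in>\<Omega>. g f) = (\<Sum>f\<in>\<Omega>. \<Sum>e\<in>E. if e \<subseteq> U f \<and> F e \<inter> U f = {} then 1 else 0)"
      unfolding g_def using finE by (simp add: sum.If_cases Int_def)
    also have "\<dots> = (\<Sum>e\<in>E. \<Sum>f\<in>\<Omega>. if e \<subseteq> U f \<and> F e \<inter> U f = {} then 1 else 0)" by (rule sum.swap)
    also have "\<dots> = (\<Sum>e\<in>E. card {f\<in>\<Omega>. e \<subseteq> U f \<and> F e \<inter> U f = {}})"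
      using fin\<Omega> by (simp add: sum.If_cases Int_def)
    finally show ?thesis .
  qed
  have "card E * s ^ card V = (\<Sum>e\<in>E. s ^ card V)" by simp
  also have "\<dots> \<le> (\<Sum>e\<in>E. 2 * s\<^sup>2 * card {f\<in>\<Omega>. e \<subseteq> U f \<and> F e \<inter> U f = {}})"
    by (intro sum_mono ge)
  also have "\<dots> = 2 * s\<^sup>2 * (\<Sum>f\<in>\<Omega>. g f)" unfolding gsum by (simp add: sum_distrib_left)
  finally have 1: "card E * s ^ card V \<le> 2 * s\<^sup>2 * (\<Sum>f\<in>\<Omega>. g f)" .
  have strict: "2 * s * card V * g f < card E * card (U f)" if "U f \<noteq> {}" for f
  proof (rule ccontr)
    assume "\<not> 2 * s * card V * g f < card E * card (U f)"
    then have "card E * card (U f) \<le> 2 * s * card V * g f" by (simp only: not_less)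
    moreover have "U f \<subseteq> V" by (auto simp: U_def)
    ultimately show False using neg that unfolding g_def by blast
  qed
  have "(\<Sum>f\<in>\<Omega>. 2 * s * card V * g f) < (\<Sum>f\<in>\<Omega>. card E * card (U f))"
  proof (rule sum_strict_mono_ex1[OF fin\<Omega>])
    show "\<forall>f\<in>\<Omega>. 2 * s * card V * g f \<le> card E * card (U f)"
    proof
      fix f show "2 * s * card V * g f \<le> card E * card (U f)"
      proof (cases "U f = {}")
        case True
        then have "\<not> e \<subseteq> U f" if "e \<in> E" for e using e(3)[OF that] by simp
        then have none: "{e\<in>E. e \<subseteq> U f \<and> F e \<inter> U f = {}} = {}" by blast
        show ?thesis unfolding g_def none by simp
      next
        case False
        show ?thesis by (rule less_imp_le[OF strict[OF False]])
      qed
    qed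
    \<comment> \<open>Empty samples give 0 on both sides; the sample keeping every vertex makes the
      inequality strict.\<close>
    have "restrict (\<lambda>_. 0) V \<in> \<Omega>" using s by (auto simp: \<Omega>_def)
    moreover have "U (restrict (\<lambda>_. 0) V) \<noteq> {}" using VN by (auto simp: U_def)
    ultimately show "\<exists>f\<in>\<Omega>. 2 * s * card V * g f < card E * card (U f)" using strict by blast
  qed
  then have 2: "2 * s * card V * (\<Sum>f\<in>\<Omega>. g f) < card E * (\<Sum>f\<in>\<Omega>. card (U f))"
    by (simp add: sum_distrib_left)
  have "s * (2 * s * card V * (\<Sum>f\<in>\<Omega>. g f)) < s * (card E * (\<Sum>f\<in>\<Omega>. card (U f)))"
    using 2 s by simp
  also have "\<dots> = card E * (s * (\<Sum>f\<in>\<Omega>. card (U f)))" by simp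
  also have "\<dots> = card V * (card E * s ^ card V)" by (simp only: U ac_simps)
  also have "\<dots> \<le> card V * (2 * s\<^sup>2 * (\<Sum>f\<in>\<Omega>. g f))" using 1 by (rule mult_left_mono) simp
  finally show False by (simp add: power2_eq_square ac_simps)
qed

definition uedges :: "'a set \<Rightarrow> ('a \<Rightarrow> 'a \<Rightarrow> bool) \<Rightarrow> 'a set set" where
  "uedges A R = {e. \<exists>u\<in>A. \<exists>v\<in>A. e = {u, v} \<and> R u v}"

lemma uedges_iff: "symp R \<Longrightarrow> {u, v} \<in> uedges A R \<longleftrightarrow> u \<in> A \<and> v \<in> A \<and> R u v"
  by (auto simp: uedges_def doubleton_eq_iff dest: sympD)

lemma graph_on_uedges: "finite A \<Longrightarrow> irreflp R \<Longrightarrow> graph_on A (uedges A R)"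
  by (auto simp: graph_on_def uedges_def card_2_iff irreflp_def) metis

text \<open>Four kinds of host edges spoil inducedness: between the ends of one subdivided edge,
  between two items, between an item and a foreign branch vertex, and between other branch vertices.
  Sparsity of the host limits each kind; the first two are removed deterministically, the last two
  by sampling.\<close>

lemma model_cleaning:
  assumes sym: "symp R" and irr: "irreflp R" and finA: "finite A" and a: "a \<ge> 1"
    and sparse: "\<And>U. U \<subseteq> A \<Longrightarrow> card (inside (uedges A R) U) \<le> a * card U"
    and G: "graph_on V E" and VA: "V \<subseteq> A" and VN: "V \<noteq> {}"
    and I: "\<And>e. e \<in> E \<Longrightarrow> I e \<subseteq> A - V \<and> card (I e) = r \<and> conn R (I e)"
    and disj: "\<And>e f. e \<in> E \<Longrightarrow> f \<in> E \<Longrightarrow> e \<noteq> f \<Longrightarrow> I e \<inter> I f = {}"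
    and att: "\<And>e v. e \<in> E \<Longrightarrow> v \<in> e \<Longrightarrow> \<exists>x\<in>I e. R x v"
    and dens: "(a + d * (16 * a * (r + 3) * (2 * a * r + 1))) * card V \<le> card E" and d: "d \<ge> 1"
  shows "\<exists>U F. model A R r U F I \<and> U \<noteq> {} \<and> d * card U \<le> card F"
proof -
  define Q where "Q = uedges A R"
  note Qiff = uedges_iff[OF sym, of _ _ A, folded Q_def]
  have GQ: "graph_on A Q" unfolding Q_def by (rule graph_on_uedges[OF finA irr])
  have finQ: "finite Q" by (rule graph_on_finite[OF GQ])
  have sp: "card (inside Q U) \<le> a * card U" if "U \<subseteq> A" for U using sparse[OF that] by (simp add: Q_def)
  have finI: "finite (I e)" if "e \<in> E" for e using I[OF that] finA by (meson finite_Diff finite_subset)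
  have finV: "finite V" and finE: "finite E" using G graph_on_finite by (auto simp: graph_on_def)
  have cV: "card V \<ge> 1" using VN finV by (simp add: Suc_le_eq card_gt_0_iff)
  have ee: "e \<subseteq> V" "card e = 2" if "e \<in> E" for e using G that by (auto simp: graph_on_def)
  have symR: "R y x" if "R x y" for x y using sym that by (auto dest: sympD)
  have cUN: "card (\<Union>e\<in>W. I e) = r * card W" if W: "W \<subseteq> E" for W
  proof -
    have "card (\<Union>e\<in>W. I e) = (\<Sum>e\<in>W. card (I e))"
    proof (rule card_UN_disjoint)
      show "finite W" using W finE finite_subset by blast
      show "\<forall>e\<in>W. finite (I e)" using W finI by blast
      show "\<forall>e\<in>W. \<forall>f\<in>W. e \<noteq> f \<longrightarrow> I e \<inter> I f = {}" using W disj by blast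
    qed
    also have "\<dots> = (\<Sum>e\<in>W. r)" using W I by (intro sum.cong) auto
    finally show ?thesis by simp
  qed
  have IA: "(\<Union>e\<in>W. I e) \<subseteq> A" if "W \<subseteq> E" for W using that I by blast
  \<comment> \<open>Edges of \<open>E\<close> that are host edges themselves are dropped, at most
    \<open>a * card V\<close> of them. This is the summand \<open>a\<close> in the density.\<close>
  define E1 where "E1 = E - Q"
  have E1E: "E1 \<subseteq> E" by (auto simp: E1_def)
  have finE1: "finite E1" using finE by (simp add: E1_def)
  define M where "M = 16 * a * (r + 3)"
  have cE1: "d * (M * (2 * a * r + 1)) * card V \<le> card E1"
  proof -
    have "E \<subseteq> E1 \<union> inside Q V" using ee by (auto simp: E1_def inside_def)
    then have "card E \<le> card (E1 \<union> inside Q V)"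
      by (rule card_mono[rotated]) (use finE1 finQ in \<open>auto simp: inside_def\<close>)
    also have "\<dots> \<le> card E1 + card (inside Q V)" by (rule card_Un_le)
    also have "\<dots> \<le> card E1 + a * card V" using sp[OF VA] by simp
    finally show ?thesis using dens by (simp add: M_def algebra_simps)
  qed
  \<comment> \<open>Conflict graph on the items. Each conflict is charged to a host edge inside a
    union of \<open>r\<close>-element items, so its density is at most \<open>a * r\<close>, and a
    conflict-free part of proportion \<open>1 / (2 * a * r + 1)\<close> exists.\<close>
  define CG where "CG = {c. \<exists>e\<in>E1. \<exists>f\<in>E1. c = {e, f} \<and> e \<noteq> f \<and> (\<exists>x\<in>I e. \<exists>y\<in>I f. R x y)}"
  have GCG: "graph_on E1 CG" using finE1 by (auto simp: graph_on_def CG_def card_2_iff)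
  have spCG: "card (inside CG W) \<le> (a * r) * card W" if W: "W \<subseteq> E1" for W
  proof -
    define \<psi> where "\<psi> = (\<lambda>s. {e\<in>E1. I e \<inter> s \<noteq> {}})"
    have "inside CG W \<subseteq> \<psi> ` inside Q (\<Union>e\<in>W. I e)"
    proof
      fix c assume c0: "c \<in> inside CG W"
      then have "c \<in> CG" and cW: "c \<subseteq> W" by (simp_all add: inside_def)
      then obtain e f where ef: "e \<in> E1" "f \<in> E1" "c = {e, f}" "e \<noteq> f" "\<exists>x\<in>I e. \<exists>y\<in>I f. R x y"
        unfolding CG_def mem_Collect_eq by metis
      obtain x y where xy: "x \<in> I e" "y \<in> I f" "R x y" using ef(5) by (elim bexE)
      note c = ef(1-4) xy cW
      have own: "g = h" if "g \<in> E1" "h \<in> E1" "z \<in> I g" "z \<in> I h" for g h z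
        using disj[of g h] that E1E by blast
      have "g \<in> \<psi> {x, y} \<longleftrightarrow> g = e \<or> g = f" for g
        using own[of g e x] own[of g f y] c(1,2,5,6) by (auto simp: \<psi>_def)
      then have "\<psi> {x, y} = {e, f}" by blast
      moreover have "{x, y} \<in> Q"
      proof -
        have "x \<in> A" "y \<in> A" using I[of e] I[of f] c(1,2,5,6) E1E by auto
        then show ?thesis using Qiff c(7) by simp
      qed
      moreover have "{x, y} \<subseteq> (\<Union>e\<in>W. I e)" using c(3,5,6,8) by auto
      ultimately show "c \<in> \<psi> ` inside Q (\<Union>e\<in>W. I e)"
        unfolding c(3) by (intro image_eqI[where x="{x, y}"]) (simp_all add: inside_def)
    qed
    moreover have "finite (inside Q (\<Union>e\<in>W. I e))" using finQ by (simp add: inside_def)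
    ultimately have "card (inside CG W) \<le> card (inside Q (\<Union>e\<in>W. I e))" by (rule surj_card_le[rotated])
    also have "\<dots> \<le> a * card (\<Union>e\<in>W. I e)" using W E1E by (intro sp IA) auto
    also have "\<dots> = a * (r * card W)" using W E1E by (subst cUN) auto
    finally show ?thesis by simp
  qed
  obtain E2 where E2: "E2 \<subseteq> E1" "\<forall>e\<in>E2. \<forall>f\<in>E2. e \<noteq> f \<longrightarrow> {e, f} \<notin> CG"
      "card E1 \<le> (2 * (a * r) + 1) * card E2"
    using independent_subset[OF finE1, of CG "2 * (a * r)"] low_degree_vertex[OF GCG spCG] by blast
  have E2E: "E2 \<subseteq> E" using E2(1) E1E by blast
  have finE2: "finite E2" using E2E finE finite_subset by blast
  have cE2: "d * M * card V \<le> card E2"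
  proof -
    have "(2 * (a * r) + 1) * (d * M * card V) \<le> (2 * (a * r) + 1) * card E2"
    proof -
      have "(2 * (a * r) + 1) * (d * M * card V) = d * (M * (2 * a * r + 1)) * card V"
        by (simp add: algebra_simps)
      then show ?thesis using cE1 E2(3) by linarith
    qed
    then show ?thesis by (simp only: mult_le_cancel1)
  qed
  have "1 \<le> d * M" using d a by (simp add: M_def Suc_le_eq)
  then have VE2: "card V \<le> card E2" 
    using le_trans[OF mult_le_mono1[of 1 "d * M" "card V"] cE2] by simp
  define F where "F = (\<lambda>e. {w\<in>V - e. \<exists>x\<in>I e. R x w})"
  have finF: "finite (F e)" for e using finV by (simp add: F_def)
  have sumF: "(\<Sum>e\<in>E2. card (F e)) \<le> a * (r + 1) * card E2"
  proof -
    define X where "X = V \<union> (\<Union>e\<in>E2. I e)"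
    define g where "g = (\<lambda>(e, w). {SOME x. x \<in> I e \<and> R x w, w})"
    have gx: "\<exists>x. x \<in> I e \<and> R x w \<and> g (e, w) = {x, w}" if "w \<in> F e" for e w
    proof -
      have "\<exists>x. x \<in> I e \<and> R x w" using that by (auto simp: F_def)
      then have "(SOME x. x \<in> I e \<and> R x w) \<in> I e \<and> R (SOME x. x \<in> I e \<and> R x w) w" by (rule someI_ex)
      then show ?thesis by (auto simp: g_def)
    qed
    have IAV: "x \<in> A" "x \<notin> V" if "e \<in> E2" "x \<in> I e" for e x
      using I[of e] that E2E by auto
    have "inj_on g (SIGMA e:E2. F e)"
    proof (rule inj_onI; clarify)
      fix e w e' w' assume h: "e \<in> E2" "w \<in> F e" "e' \<in> E2" "w' \<in> F e'" "g (e, w) = g (e', w')"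
      obtain x where x: "x \<in> I e" "g (e, w) = {x, w}" using gx[OF h(2)] by blast
      obtain x' where x': "x' \<in> I e'" "g (e', w') = {x', w'}" using gx[OF h(4)] by blast
      have "x \<notin> V" "x' \<notin> V" "w \<in> V" "w' \<in> V"
        using IAV(2)[OF h(1) x(1)] IAV(2)[OF h(3) x'(1)] h(2,4) by (simp_all add: F_def)
      moreover have "{x, w} = {x', w'}" using x(2) x'(2) h(5) by simp
      ultimately have xw: "x = x'" "w = w'" by (auto simp: doubleton_eq_iff)
      have "e = e'"
      proof (rule ccontr)
        assume "e \<noteq> e'"
        then have "I e \<inter> I e' = {}" using h(1,3) E2E by (intro disj) auto
        then show False using x(1) x'(1) xw by auto
      qed
      then show "e = e' \<and> w = w'" using xw by simp
    qed
    moreover have "g ` (SIGMA e:E2. F e) \<subseteq> inside Q X"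
    proof clarify
      fix e w assume h: "e \<in> E2" "w \<in> F e"
      obtain x where x: "x \<in> I e" "R x w" "g (e, w) = {x, w}" using gx[OF h(2)] by blast
      have "x \<in> A" "w \<in> A" "x \<in> X" "w \<in> X" using IAV(1)[OF h(1) x(1)] x h VA by (auto simp: F_def X_def)
      then show "g (e, w) \<in> inside Q X" using x Qiff by (simp add: inside_def)
    qed
    moreover have "finite (inside Q X)" using finQ by (simp add: inside_def)
    ultimately have "card (SIGMA e:E2. F e) \<le> card (inside Q X)" by (rule card_inj_on_le)
    also have "\<dots> \<le> a * card X" using VA IA[OF E2E] by (intro sp) (auto simp: X_def)
    also have "\<dots> \<le> a * (card V + r * card E2)"
      using card_Un_le[of V "\<Union>e\<in>E2. I e"] cUN[OF E2E] by (simp add: X_def)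
    also have "\<dots> \<le> a * (card E2 + r * card E2)" using VE2 by simp
    finally show ?thesis using finE2 finF by (simp add: card_SigmaI algebra_simps)
  qed
  \<comment> \<open>An item touches at most \<open>a * (r + 1)\<close> foreign branch vertices on
    average, so at least half of the items touch at most twice as many.\<close>
  define E3 where "E3 = {e\<in>E2. card (F e) \<le> 2 * a * (r + 1)}"
  have E3E: "E3 \<subseteq> E" and E32: "E3 \<subseteq> E2" using E2E by (auto simp: E3_def)
  have cE3: "card E2 \<le> 2 * card E3"
  proof -
    have "2 * (a * (r + 1)) * card (E2 - E3) = (\<Sum>e\<in>E2 - E3. 2 * a * (r + 1))" by simp
    also have "\<dots> \<le> (\<Sum>e\<in>E2 - E3. card (F e))" by (intro sum_mono) (auto simp: E3_def)
    also have "\<dots> \<le> (\<Sum>e\<in>E2. card (F e))" using finE2 by (intro sum_mono2) auto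
    also have "\<dots> \<le> a * (r + 1) * card E2" by (rule sumF)
    finally have le: "2 * (a * (r + 1)) * card (E2 - E3) \<le> a * (r + 1) * card E2" .
    have "x * 2 \<le> y" if "2 * q * x \<le> q * y" "q > 0" for q x y :: nat
    proof -
      have "q * (x * 2) \<le> q * y" using that(1) by (simp add: ac_simps)
      then show ?thesis using that(2) by simp
    qed
    from this[OF le] have "2 * card (E2 - E3) \<le> card E2" using a by simp
    moreover have "card (E2 - E3) = card E2 - card E3"
      using E32 finE2 finite_subset by (intro card_Diff_subset) auto
    ultimately show ?thesis by linarith
  qed
  have "\<exists>v\<in>U. card (nb Q U v) \<le> 2 * a" if "U \<subseteq> V" "U \<noteq> {}" for U
    using low_degree_vertex[OF GQ sp, of U] that VA by blast
  then obtain out where out: "\<forall>v\<in>V. out v \<subseteq> V \<and> card (out v) \<le> 2 * a"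
      "\<forall>u\<in>V. \<forall>v\<in>V. {u, v} \<in> Q \<and> u \<noteq> v \<longrightarrow> u \<in> out v \<or> v \<in> out u"
    using bounded_orientation[OF finV, of Q "2 * a"] by blast
  \<comment> \<open>Vertices that must not be sampled along with \<open>e\<close>. Taking
    out-neighbours instead of all host neighbours keeps the list short even at vertices of large
    degree.\<close>
  define F' where "F' = (\<lambda>e. (F e \<union> (\<Union>u\<in>e. out u)) - e)"
  \<comment> \<open>Twice the bound \<open>2 * a * (r + 1) + 4 * a\<close> on
    \<open>card (F' e)\<close>. \<open>M\<close> is \<open>4 * s\<close>: a factor 2 for passing to
    \<open>E3\<close> and \<open>2 * s\<close> for sampling.\<close>
  define s where "s = 4 * a * (r + 3)"
  have s1: "s \<ge> 1" using a by (simp add: s_def Suc_le_eq)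
  have F': "F' e \<subseteq> V - e \<and> 2 * card (F' e) \<le> s" if e: "e \<in> E3" for e
  proof
    have eE: "e \<in> E" using e E3E by blast
    have eV: "e \<subseteq> V" "card e = 2" using ee[OF eE] by auto
    then have fe: "finite e" using finV finite_subset by blast
    show "F' e \<subseteq> V - e" using out(1) eV by (auto simp: F'_def F_def)
    have "finite (F e \<union> (\<Union>u\<in>e. out u))" using finF fe out(1) eV finV by (auto intro: finite_subset)
    then have "card (F' e) \<le> card (F e \<union> (\<Union>u\<in>e. out u))" unfolding F'_def by (intro card_mono) auto
    also have "\<dots> \<le> card (F e) + card (\<Union>u\<in>e. out u)" by (rule card_Un_le)
    also have "card (\<Union>u\<in>e. out u) \<le> (\<Sum>u\<in>e. card (out u))" by (rule card_UN_le[OF fe])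
    also have "\<dots> \<le> (\<Sum>u\<in>e. 2 * a)" using out(1) eV by (intro sum_mono) auto
    also have "\<dots> = 4 * a" using eV by simp
    finally have "card (F' e) \<le> card (F e) + 4 * a" by simp
    then show "2 * card (F' e) \<le> s" using e by (simp add: E3_def s_def algebra_simps)
  qed
  have G3: "graph_on V E3" using G E3E by (auto simp: graph_on_def)
  have "E3 \<noteq> {}" using cE3 VE2 cV by auto
  then obtain U where U: "U \<subseteq> V" "U \<noteq> {}"
    "card E3 * card U \<le> 2 * s * card V * card {e\<in>E3. e \<subseteq> U \<and> F' e \<inter> U = {}}"
    using random_vertex_sample[OF G3 _ F' s1] by blast
  define E4 where "E4 = {e\<in>E3. e \<subseteq> U \<and> F' e \<inter> U = {}}"
  have finU: "finite U" using U finV finite_subset by blast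
  have cE4: "d * card U \<le> card E4"
  proof -
    have "d * M * card V = 2 * (d * (2 * s) * card V)" by (simp add: M_def s_def)
    then have "d * (2 * s) * card V \<le> card E3" using cE2 cE3 by linarith
    then have "d * (2 * s) * card V * card U \<le> card E3 * card U" by (rule mult_right_mono) simp
    also note U(3)[folded E4_def]
    also have "d * (2 * s) * card V * card U = (2 * s * card V) * (d * card U)" by simp
    finally have "(2 * s * card V) * (d * card U) \<le> (2 * s * card V) * card E4" .
    moreover have "0 < 2 * s * card V" using s1 cV by simp
    ultimately show ?thesis by (simp only: mult_le_cancel1)
  qed
  \<comment> \<open>Only vertices on a surviving edge are kept: that edge guarantees that their
    out-neighbours were not sampled, apart from its other end, which is nonadjacent by the choice of
    \<open>E1\<close>.\<close>
  define V' where "V' = \<Union>E4"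
  have V'U: "V' \<subseteq> U" by (auto simp: V'_def E4_def)
  have E4E: "E4 \<subseteq> E" "E4 \<subseteq> E2" "E4 \<subseteq> E1" using E3E E32 E2(1) by (auto simp: E4_def)
  have cU: "card U \<ge> 1" using U finU by (simp add: Suc_le_eq card_gt_0_iff)
  have "1 * 1 \<le> card E4" by (rule le_trans[OF mult_le_mono[OF d cU] cE4])
  then have E4N: "E4 \<noteq> {}" by auto
  have ind: False if x: "x \<in> V'" "y \<in> V'" "R x y" "y \<in> out x" for x y
  proof -
    obtain e where e: "e \<in> E4" "x \<in> e" using x by (auto simp: V'_def)
    have xy: "x \<noteq> y" using irr x by (auto simp: irreflp_def)
    show False
    proof (cases "y \<in> e")
      case True
      have "card e = 2" using e E4E ee by blast
      then have "e = {x, y}" using True e xy by (auto simp: card_2_iff)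
      moreover have "{x, y} \<in> Q" using Qiff x V'U U VA by blast
      ultimately show False using e E4E by (auto simp: E1_def)
    next
      case False
      then have "y \<in> F' e" using x e by (auto simp: F'_def)
      then show False using e x V'U by (auto simp: E4_def)
    qed
  qed
  have "model A R r V' E4 I" unfolding model_def
  proof (intro conjI ballI impI)
    show "graph_on V' E4" using ee E4E finU V'U by (auto simp: graph_on_def V'_def intro: finite_subset)
    show "V' \<subseteq> A" using V'U U VA by blast
    show "\<not> R x y" if xy: "x \<in> V'" "y \<in> V'" for x y
    proof
      assume R: "R x y"
      have "x \<noteq> y" using irr R by (auto simp: irreflp_def)
      moreover have "{x, y} \<in> Q" using Qiff xy R V'U U VA by blast
      ultimately have "x \<in> out y \<or> y \<in> out x" using out(2) xy V'U U by blast
      then show False using ind[OF xy R] ind[OF xy(2,1) symR[OF R]] by blast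
    qed
    show "card (I e) = r" "conn R (I e)" if "e \<in> E4" for e using I that E4E by blast+
    show "I e \<subseteq> A - V'" if "e \<in> E4" for e
    proof -
      have "I e \<subseteq> A - V" using I that E4E by blast
      then show ?thesis using V'U U by blast
    qed
    show "I e \<inter> I f = {}" if "e \<in> E4" "f \<in> E4" "e \<noteq> f" for e f
      using that E4E(1) by (intro disj) auto
    show "\<not> R x y" if "e \<in> E4" "f \<in> E4" "e \<noteq> f" "x \<in> I e" "y \<in> I f" for e f x y
    proof
      assume "R x y"
      then have "{e, f} \<in> CG" using that E4E unfolding CG_def by blast
      then show False using E2(2) that E4E by blast
    qed
    show "(\<exists>x\<in>I e. R x v) \<longleftrightarrow> v \<in> e" if e: "e \<in> E4" and v: "v \<in> V'" for e v
    proof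
      assume "v \<in> e" then show "\<exists>x\<in>I e. R x v" using att e E4E by blast
    next
      assume h: "\<exists>x\<in>I e. R x v"
      show "v \<in> e"
      proof (rule ccontr)
        assume "v \<notin> e"
        then have "v \<in> F' e" using h v V'U U by (auto simp: F'_def F_def)
        then show False using e v V'U by (auto simp: E4_def)
      qed
    qed
  qed
  moreover have "V' \<noteq> {}"
  proof -
    obtain e where "e \<in> E4" using E4N by blast
    moreover then have "e \<noteq> {}" using ee E4E by fastforce
    ultimately show ?thesis by (auto simp: V'_def)
  qed
  moreover have "d * card V' \<le> card E4"
    by (rule le_trans[OF mult_le_mono2[OF card_mono[OF finU V'U]] cE4])
  ultimately show ?thesis by blast
qed

subsection \<open>Biclique-free graphs of large density\<close>

lemma edges_avoiding:
  assumes G: "graph_on V E"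
  shows "card E \<le> card (inside E B) + (\<Sum>v\<in>V - B. card (nb E V v))"
proof -
  have finV: "finite V" and finE: "finite E" using G graph_on_finite by (auto simp: graph_on_def)
  have fnb: "finite (nb E V v)" for v using finV by (simp add: nb_def)
  have "E \<subseteq> inside E B \<union> (\<Union>v\<in>V - B. (\<lambda>u. {u, v}) ` nb E V v)"
  proof
    fix e assume e: "e \<in> E"
    show "e \<in> inside E B \<union> (\<Union>v\<in>V - B. (\<lambda>u. {u, v}) ` nb E V v)"
    proof (cases "e \<subseteq> B")
      case True then show ?thesis using e by (simp add: inside_def)
    next
      case False
      then obtain v where v: "v \<in> e" "v \<notin> B" by blast
      have eV: "e \<subseteq> V" "card e = 2" using G e by (auto simp: graph_on_def)
      then obtain u where u: "e = {u, v}" using v by (auto simp: card_2_iff)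
      then have "u \<in> nb E V v" using e eV by (simp add: nb_def)
      then show ?thesis using u v eV by blast
    qed
  qed
  then have "card E \<le> card (inside E B \<union> (\<Union>v\<in>V - B. (\<lambda>u. {u, v}) ` nb E V v))"
    by (rule card_mono[rotated]) (use finE finV fnb in \<open>auto simp: inside_def\<close>)
  also have "\<dots> \<le> card (inside E B) + card (\<Union>v\<in>V - B. (\<lambda>u. {u, v}) ` nb E V v)" by (rule card_Un_le)
  also have "card (\<Union>v\<in>V - B. (\<lambda>u. {u, v}) ` nb E V v) \<le> (\<Sum>v\<in>V - B. card ((\<lambda>u. {u, v}) ` nb E V v))"
    using finV by (intro card_UN_le) auto
  also have "\<dots> \<le> (\<Sum>v\<in>V - B. card (nb E V v))" by (intro sum_mono card_image_le fnb)
  finally show ?thesis by simp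
qed

text \<open>\<open>X\<close> maximizes the sum of \<open>min t (deg\<^sub>X v)\<close> over \<open>v \<in> B\<close> minus \<open>lam * card X\<close>.\<close>

lemma saturating_set:
  assumes finV: "finite V" and B: "B \<subseteq> V" and deg: "\<And>v. v \<in> B \<Longrightarrow> m + t \<le> card (nb Q V v)"
  shows "\<exists>X\<subseteq>V. lam * card X \<le> t * card B \<and> m * card {v\<in>B. card (nb Q X v) < t} \<le> lam * card V"
proof -
  define \<Phi> where "\<Phi> = (\<lambda>X. (\<Sum>v\<in>B. int (min t (card (nb Q X v)))) - int lam * int (card X))"
  have finB: "finite B" using B finV finite_subset by blast
  have "\<exists>X\<in>Pow V. \<Phi> X = Max (\<Phi> ` Pow V)"
    using Max_in[of "\<Phi> ` Pow V"] finV by fastforce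
  then obtain X where X: "X \<subseteq> V" and maxX: "\<Phi> X = Max (\<Phi> ` Pow V)" by blast
  have max: "\<Phi> Y \<le> \<Phi> X" if "Y \<subseteq> V" for Y
    unfolding maxX using that finV by (intro Max_ge) auto
  have finX: "finite X" using X finV finite_subset by blast
  have fnb: "finite (nb Q Y v)" if "finite Y" for Y v using that by (simp add: nb_def)
  define W where "W = {v\<in>B. card (nb Q X v) < t}"
  have finW: "finite W" using finB by (simp add: W_def)
  have "\<Phi> {} = 0" by (simp add: \<Phi>_def nb_def)
  then have "int lam * int (card X) \<le> (\<Sum>v\<in>B. int (min t (card (nb Q X v))))"
    using max[of "{}"] by (simp add: \<Phi>_def)
  also have "\<dots> \<le> (\<Sum>v\<in>B. int t)" by (intro sum_mono) auto
  also have "\<dots> = int (t * card B)" by simp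
  finally have 1: "lam * card X \<le> t * card B" by (simp flip: of_nat_mult)
  have gain: "card {v\<in>W. x \<in> nb Q V v} \<le> lam" if x: "x \<in> V - X" for x
  proof -
    have "\<Phi> (insert x X) \<le> \<Phi> X" using x X by (intro max) auto
    then have le: "(\<Sum>v\<in>B. int (min t (card (nb Q (insert x X) v)))) - (\<Sum>v\<in>B. int (min t (card (nb Q X v)))) \<le> int lam"
      using x finX by (simp add: \<Phi>_def algebra_simps)
    have "int (card {v\<in>W. x \<in> nb Q V v}) = (\<Sum>v\<in>B. if v \<in> W \<and> x \<in> nb Q V v then 1 else 0)"
      using finB by (simp add: sum.If_cases Int_def W_def)
    also have "\<dots> \<le> (\<Sum>v\<in>B. int (min t (card (nb Q (insert x X) v))) - int (min t (card (nb Q X v))))"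
    proof (rule sum_mono)
      fix v assume "v \<in> B"
      have sub: "nb Q X v \<subseteq> nb Q (insert x X) v" by (auto simp: nb_def)
      have "nb Q (insert x X) v = insert x (nb Q X v)" "x \<notin> nb Q X v" if "x \<in> nb Q V v"
        using that x by (auto simp: nb_def)
      then have "card (nb Q (insert x X) v) = Suc (card (nb Q X v))" if "x \<in> nb Q V v"
        using that fnb[OF finX] by simp
      moreover have "card (nb Q X v) \<le> card (nb Q (insert x X) v)"
        using sub finX by (intro card_mono fnb) auto
      ultimately show "(if v \<in> W \<and> x \<in> nb Q V v then 1 else 0)
          \<le> int (min t (card (nb Q (insert x X) v))) - int (min t (card (nb Q X v)))"
        by (auto simp: W_def)
    qed
    finally show ?thesis using le by (simp add: sum_subtractf)
  qed
  \<comment> \<open>Double counting of neighbours outside \<open>X\<close> of unsaturated vertices: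
    each such vertex has at least \<open>m\<close> of them, and \<open>gain\<close> allows each
    vertex outside \<open>X\<close> at most \<open>lam\<close>.\<close>
  have "m * card W = (\<Sum>v\<in>W. m)" by simp
  also have "\<dots> \<le> (\<Sum>v\<in>W. card {x\<in>V - X. x \<in> nb Q V v})"
  proof (rule sum_mono)
    fix v assume v: "v \<in> W"
    have "nb Q V v = nb Q X v \<union> {x\<in>V - X. x \<in> nb Q V v}" using X by (auto simp: nb_def)
    then have "card (nb Q V v) \<le> card (nb Q X v) + card {x\<in>V - X. x \<in> nb Q V v}"
      using card_Un_le[of "nb Q X v" "{x\<in>V - X. x \<in> nb Q V v}"] by simp
    then show "m \<le> card {x\<in>V - X. x \<in> nb Q V v}" using deg[of v] v by (auto simp: W_def)
  qed
  also have "\<dots> = (\<Sum>v\<in>W. \<Sum>x\<in>V - X. if x \<in> nb Q V v then 1 else 0)"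
    using finV by (simp add: sum.If_cases Int_def)
  also have "\<dots> = (\<Sum>x\<in>V - X. \<Sum>v\<in>W. if x \<in> nb Q V v then 1 else 0)" by (rule sum.swap)
  also have "\<dots> = (\<Sum>x\<in>V - X. card {v\<in>W. x \<in> nb Q V v})"
    using finW by (simp add: sum.If_cases Int_def)
  also have "\<dots> \<le> (\<Sum>x\<in>V - X. lam)" by (intro sum_mono gain) auto
  also have "\<dots> \<le> lam * card V" using finV by (auto simp: mult.commute intro!: mult_le_mono2 card_mono)
  finally show ?thesis using X 1 by (auto simp: W_def)
qed

definition biclique_free :: "nat \<Rightarrow> 'a set \<Rightarrow> ('a \<Rightarrow> 'a \<Rightarrow> bool) \<Rightarrow> bool" where
  "biclique_free t A R \<longleftrightarrow>
    (\<forall>S S'. S \<subseteq> A \<and> S' \<subseteq> A \<and> card S = t \<and> card S' = t \<longrightarrow> \<not> (\<forall>x\<in>S. \<forall>y\<in>S'. R x y))"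

lemma biclique_free_codegree:
  assumes free: "biclique_free t A R" and S: "S \<subseteq> A" "t \<le> card S"
    and X: "X \<subseteq> A" "\<And>b x. b \<in> X \<Longrightarrow> x \<in> S \<Longrightarrow> R x b"
  shows "card X \<le> t"
proof (rule ccontr)
  assume "\<not> ?thesis"
  then have "t \<le> card X" by simp
  then obtain X' where X': "X' \<subseteq> X" "card X' = t" by (meson obtain_subset_with_card_n)
  obtain S' where S': "S' \<subseteq> S" "card S' = t" using S(2) by (meson obtain_subset_with_card_n)
  have "R x b" if "b \<in> X'" "x \<in> S'" for b x using X(2)[of b x] that X' S' by blast
  moreover have "X' \<subseteq> A" "S' \<subseteq> A" using X' S' X(1) S(1) by auto
  ultimately show False using free X'(2) S'(2) unfolding biclique_free_def by metis
qed

text \<open>An isomorphism fixing the attachments of a vertex sends it to a vertex with the same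
  \<open>t\<close> or more neighbours in \<open>X\<close>; biclique-freeness leaves at most
  \<open>t\<close> of these. \<open>saturating_set\<close> makes \<open>X\<close> smaller than the
  set of items by a factor of order \<open>d / t\<close>, which outweighs
  \<open>s * \<mu>\<close>.\<close>

lemma bounded_degree_case:
  assumes sym: "symp R" and irr: "irreflp R" and finA: "finite A" and cnt: "counting c A R" and c: "c \<ge> 1"
    and free: "biclique_free t A R" and t: "t \<ge> 1"
    and sparse: "\<And>U. U \<subseteq> A \<Longrightarrow> card (inside (uedges A R) U) \<le> (d + 1) * card U"
    and U: "U \<subseteq> A" and N: "card U \<le> N" "N \<ge> 1" "d * N \<le> 2 * card (inside (uedges A R) U)"
    and deg: "\<And>v. v \<in> U \<Longrightarrow> card (nb (uedges A R) U v) \<le> \<Delta>"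
    and \<Delta>: "\<Delta> \<ge> 2" "\<Delta>\<^sup>2 \<le> 2 ^ \<mu>" and \<mu>: "\<mu> \<ge> 2"
    and s: "s > (8 * (2 * c * t)\<^sup>2)\<^sup>2" and d: "d \<ge> 5000 * t" "1000 * (t * (1 + s * \<mu>)) \<le> d"
  shows False
proof -
  define Q where "Q = uedges A R"
  note Qiff = uedges_iff[OF sym, of _ _ A, folded Q_def]
  have GQ: "graph_on A Q" unfolding Q_def by (rule graph_on_uedges[OF finA irr])
  have symR: "R y x" if "R x y" for x y using sym that by (auto dest: sympD)
  have finU: "finite U" using U finA finite_subset by blast
  have d5: "d \<ge> 5000" using mult_le_mono2[OF t, of 5000] d(1) by simp
  define E where "E = inside Q U"
  have GE: "graph_on U E" unfolding E_def by (rule graph_on_inside[OF GQ U])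
  have nbE: "nb E U v = nb Q U v" if "v \<in> U" for v using that by (auto simp: E_def nb_def inside_def)
  have nbR: "u \<in> nb Q X v \<longleftrightarrow> u \<in> X \<and> R u v" if "X \<subseteq> U" "v \<in> U" for u v X
    using that U Qiff by (auto simp: nb_def)
  \<comment> \<open>The remaining vertices meet at most \<open>d * N / 4\<close> edges, half of
    those available, so the other half lies inside \<open>B\<close>, and sparsity makes
    \<open>B\<close> large.\<close>
  define B where "B = {v\<in>U. d \<le> 4 * card (nb Q U v)}"
  have BU: "B \<subseteq> U" by (auto simp: B_def)
  have finB: "finite B" using BU finU finite_subset by blast
  have cB: "N \<le> 5 * card B"
  proof -
    have "4 * (\<Sum>v\<in>U - B. card (nb E U v)) \<le> (\<Sum>v\<in>U - B. d)"
      unfolding sum_distrib_left by (intro sum_mono) (auto simp: B_def nbE)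
    also have "\<dots> \<le> d * card U" using finU by (auto simp: mult.commute intro!: mult_le_mono2 card_mono)
    also have "\<dots> \<le> d * N" using N by simp
    finally have 1: "4 * (\<Sum>v\<in>U - B. card (nb E U v)) \<le> d * N" .
    have "inside E B = inside Q B" using BU by (auto simp: E_def inside_def)
    then have 2: "card (inside E B) \<le> (d + 1) * card B" using sparse[of B] BU U by (simp add: Q_def)
    have 3: "d * N \<le> 2 * card E" using N by (simp add: E_def Q_def)
    have "d * N \<le> 4 * ((d + 1) * card B)" using 1 2 3 edges_avoiding[OF GE, of B] by linarith
    also have "\<dots> \<le> d * (5 * card B)" using d5 by (simp add: algebra_simps)
    finally show ?thesis using d5 by simp
  qed
  \<comment> \<open>The price of a vertex of \<open>X\<close>: large enough that \<open>X\<close> is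
    small, yet at most \<open>m / 8\<close>, so that at most \<open>N / 8\<close> vertices stay
    unsaturated. \<open>m\<close> is below \<open>d / 4\<close> by enough to leave room for
    \<open>t\<close>.\<close>
  define lam where "lam = d div 40"
  define m where "m = d div 5"
  have lam_m: "8 * lam \<le> m" 
    unfolding m_def by (subst less_eq_div_iff_mult_less_eq) (simp_all add: lam_def)
  have lam_d: "d \<le> 50 * lam" 
    using d5 mult_div_mod_eq[of 40 d] mod_less_divisor[of 40 d] unfolding lam_def by linarith
  have deg_B: "m + t \<le> card (nb Q U v)" if "v \<in> B" for v
  proof -
    have "d \<le> 4 * card (nb Q U v)" using that by (simp add: B_def)
    moreover have "5 * m \<le> d" by (simp add: m_def)
    ultimately show ?thesis using d(1) d5 by linarith
  qed
  obtain X where X: "X \<subseteq> U" "lam * card X \<le> t * card B" "m * card {v\<in>B. card (nb Q X v) < t} \<le> lam * card U"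
    using saturating_set[OF finU BU deg_B, of lam] by blast
  define J where "J = {v\<in>B. t \<le> card (nb Q X v)} - X"
  have JU: "J \<subseteq> U" using BU by (auto simp: J_def)
  have finJ: "finite J" and finX: "finite X" using JU X(1) finU finite_subset by blast+
  \<comment> \<open>Of at least \<open>N / 5\<close> vertices of \<open>B\<close>, at most
    \<open>N / 8\<close> are unsaturated and at most \<open>N / 100\<close> lie in \<open>X\<close>;
    more than \<open>N / 20\<close> remain.\<close>
  have cJ: "N \<le> 20 * card J"
  proof -
    let ?W = "{v\<in>B. card (nb Q X v) < t}"
    have "B \<subseteq> J \<union> ?W \<union> X" by (auto simp: J_def)
    then have "card B \<le> card (J \<union> ?W \<union> X)"
      by (rule card_mono[rotated]) (use finJ finB finX in auto)
    also have "\<dots> \<le> card J + card ?W + card X" by (meson add_le_mono1 card_Un_le order_trans)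
    finally have 1: "card B \<le> card J + card ?W + card X" .
    have "8 * (lam * card ?W) \<le> m * card ?W"
      unfolding mult.assoc[symmetric] by (rule mult_right_mono[OF lam_m]) simp
    also have "\<dots> \<le> lam * card U" by (rule X(3))
    also have "\<dots> \<le> lam * N" using N by simp
    finally have "lam * (8 * card ?W) \<le> lam * N" by (simp add: ac_simps)
    moreover have "lam > 0" using d5 lam_d by (cases lam) auto
    ultimately have 2: "8 * card ?W \<le> N" by simp
    have "t * (100 * card X) \<le> lam * card X"
    proof -
      have "t * 100 \<le> lam" using d(1) lam_d by linarith
      then show ?thesis unfolding mult.assoc[symmetric] by (rule mult_right_mono) simp
    qed
    also have "\<dots> \<le> t * card U" using X(2) BU finU card_mono[of U B] by (meson le_trans mult_le_mono2)
    also have "\<dots> \<le> t * N" using N by simp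
    finally have 3: "100 * card X \<le> N" using t by simp
    show ?thesis using 1 2 3 cB by linarith
  qed
  have "J \<noteq> {}" using cJ N by auto
  then obtain j0 where "j0 \<in> J" by blast
  then have "t \<le> card (nb Q X j0)" by (simp add: J_def)
  then have XN: "X \<noteq> {}" using t by (auto simp: nb_def)
  \<comment> \<open>The possible images of \<open>z\<close>: common neighbours of the attachments of
    \<open>z\<close>.\<close>
  define C where "C = (\<lambda>z. {z'\<in>J. \<forall>v\<in>nb Q X z. R v z'})"
  let ?S = "\<lambda>j. {v\<in>X. \<exists>x\<in>{j}. R x v}"
  have Snb: "?S j = nb Q X j" if "j \<in> J" for j using nbR[OF X(1), of j] that JU symR by auto
  show False
  proof (rule item_system_bound[OF sym finA cnt c _ XN finJ, where C = C and k = t and l = 1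
        and I = "\<lambda>j. {j}" and \<Delta> = \<Delta> and \<mu> = \<mu> and s = s])
    show "X \<subseteq> A" using X U by blast
    show "{j} \<subseteq> A - X \<and> card {j} = 1 \<and> conn R {j}" if "j \<in> J" for j
      using that JU U conn_singleton[of R j] by (auto simp: J_def)
    show "{i} \<inter> {j} = {}" if "i \<noteq> j" for i j :: 'a using that by simp
    show "?S j \<noteq> {}" if "j \<in> J" for j
      unfolding Snb[OF that] using that t by (auto simp: J_def)
    show "finite (C z)" for z using finJ by (simp add: C_def)
    show "card (C z) \<le> t" if z: "z \<in> (\<Union>j\<in>J. {j})" for z
    proof (rule biclique_free_codegree[OF free, of "nb Q X z"])
      show "nb Q X z \<subseteq> A" using X U by (auto simp: nb_def)
      show "t \<le> card (nb Q X z)" using z by (simp add: J_def)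
      show "C z \<subseteq> A" using JU U by (auto simp: C_def)
      show "R x b" if "b \<in> C z" "x \<in> nb Q X z" for b x using that by (simp add: C_def)
    qed
    show "1 \<le> t" "2 \<le> \<Delta>" "2 \<le> \<mu>" by (fact t \<Delta> \<mu>)+
    show "\<Delta> ^ (1 + 1) \<le> 2 ^ \<mu>" using \<Delta> by (simp add: power2_eq_square)
    show "(4 * (1 + 1) * (2 * c * t) ^ (1 + 1))\<^sup>2 < s" using s by (simp add: power2_eq_square)
    show "(1 + s * \<mu>) * card X \<le> card J"
    proof -
      have "20 * (t * (1 + s * \<mu>)) \<le> lam" using d(2) lam_d by linarith
      then have "20 * (t * (1 + s * \<mu>)) * card X \<le> lam * card X" by (rule mult_right_mono) simp
      also have "\<dots> \<le> t * card B" by (rule X(2))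
      also have "\<dots> \<le> t * (20 * card J)" using cJ N card_mono[OF finU BU] by (intro mult_le_mono2) linarith
      finally have "(20 * t) * ((1 + s * \<mu>) * card X) \<le> (20 * t) * card J" by (simp only: ac_simps)
      then show ?thesis using t by (simp only: mult_le_cancel1)
    qed
  next
    fix z assume z: "z \<in> X \<union> (\<Union>j\<in>J. {j})"
    have sub: "X \<union> (\<Union>j\<in>J. {j}) \<subseteq> U" using X JU by auto
    have "{w \<in> X \<union> (\<Union>j\<in>J. {j}). R z w} \<subseteq> nb Q U z"
      using nbR[OF order_refl, of z] z sub symR by blast
    then have "card {w \<in> X \<union> (\<Union>j\<in>J. {j}). R z w} \<le> card (nb Q U z)"
      by (rule card_mono[rotated]) (use finU in \<open>simp add: nb_def\<close>)
    also have "\<dots> \<le> \<Delta>" using deg[of z] z sub by (auto simp: Q_def)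
    finally show "card {w \<in> X \<union> (\<Union>j\<in>J. {j}). R z w} \<le> \<Delta>" .
  next
    fix V J1 J2 \<phi> j z
    assume V: "V \<subseteq> X" and J: "J1 \<subseteq> J" "J2 \<subseteq> J"
      and SV: "\<And>j. j \<in> J1 \<union> J2 \<Longrightarrow> ?S j \<subseteq> V"
      and bij: "bij_betw \<phi> (V \<union> (\<Union>j\<in>J1. {j})) (V \<union> (\<Union>j\<in>J2. {j}))"
      and iso: "\<And>x y. x \<in> V \<union> (\<Union>j\<in>J1. {j}) \<Longrightarrow> y \<in> V \<union> (\<Union>j\<in>J1. {j}) \<Longrightarrow> R (\<phi> x) (\<phi> y) \<longleftrightarrow> R x y"
      and fx: "\<And>u. u \<in> V \<Longrightarrow> \<phi> u = u" and j: "j \<in> J1" and zj: "z \<in> {j}"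
    have z: "z \<in> J1" "z \<in> J" using zj j J by auto
    have zX: "z \<notin> X" using z by (simp add: J_def)
    have "\<phi> z \<notin> V"
    proof
      assume a: "\<phi> z \<in> V"
      then have "\<phi> (\<phi> z) = \<phi> z" by (rule fx)
      then have "\<phi> z = z" using bij a z unfolding bij_betw_def inj_on_def by blast
      then show False using a V zX by auto
    qed
    moreover have "\<phi> z \<in> V \<union> (\<Union>j\<in>J2. {j})" using bij z(1) unfolding bij_betw_def by blast
    ultimately have "\<phi> z \<in> J" using J by auto
    moreover have "R v (\<phi> z)" if v: "v \<in> nb Q X z" for v
    proof -
      have "v \<in> ?S z" unfolding Snb[OF z(2)] by (rule v)
      then have vV: "v \<in> V" and "R z v" using SV[of z] z(1) by auto
      then have "R (\<phi> z) (\<phi> v)" using iso[of z v] z(1) by simp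
      then show ?thesis using fx[OF vV] symR by simp
    qed
    ultimately show "\<phi> z \<in> C z" by (simp add: C_def)
  qed
qed

lemma dense_subset_maximal:
  fixes E :: "'a set set"
  assumes finA: "finite A" and finE: "finite E" and U0: "U0 \<subseteq> A" "U0 \<noteq> {}" "d0 * card U0 \<le> card (inside E U0)"
    and empty: "inside E {} = {}"
  obtains d U where "d \<ge> d0" "U \<subseteq> A" "U \<noteq> {}" "d * card U \<le> card (inside E U)"
    "\<And>W. W \<subseteq> A \<Longrightarrow> card (inside E W) \<le> (d + 1) * card W"
proof -
  define P where "P = (\<lambda>d. d \<ge> d0 \<and> (\<exists>U\<subseteq>A. U \<noteq> {} \<and> d * card U \<le> card (inside E U)))"
  have bd: "d \<le> card E" if "P d" for d
  proof -
    obtain U where U: "U \<subseteq> A" "U \<noteq> {}" "d * card U \<le> card (inside E U)" using \<open>P d\<close> by (auto simp: P_def)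
    have "card U \<ge> 1" using U finA finite_subset by (metis Suc_leI card_gt_0_iff One_nat_def)
    then have "d \<le> d * card U" by (simp add: Suc_le_eq)
    also have "\<dots> \<le> card (inside E U)" by (rule U(3))
    also have "\<dots> \<le> card E" using finE by (intro card_mono) (auto simp: inside_def)
    finally show ?thesis .
  qed
  have P0: "P d0" using U0 by (auto simp: P_def)
  define d where "d = (GREATEST d. P d)"
  have Pd: "P d" unfolding d_def by (rule GreatestI_nat[of P d0 "card E"]) (use P0 bd in auto)
  have max: "d' \<le> d" if "P d'" for d'
    unfolding d_def by (rule Greatest_le_nat[of P d' "card E"]) (use that bd in auto)
  obtain U where U: "d \<ge> d0" "U \<subseteq> A" "U \<noteq> {}" "d * card U \<le> card (inside E U)"
    using Pd by (auto simp: P_def)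
  show ?thesis
  proof (rule that[OF U])
    fix W assume W: "W \<subseteq> A"
    show "card (inside E W) \<le> (d + 1) * card W"
    proof (rule ccontr)
      assume h: "\<not> ?thesis"
      then have "W \<noteq> {}" using empty by auto
      then have "P (d + 1)" using h W U(1) by (auto simp: P_def not_le intro!: exI[of _ W])
      then show False using max by fastforce
    qed
  qed
qed

text \<open>The summand \<open>D1\<close> counts the vertices that received a pair, the other
  summand those that failed. The bound holds relative to the density \<open>a\<close> of the host,
  which need not be bounded absolutely.\<close>

lemma unbounded_degree_case:
  assumes sym: "symp R" and irr: "irreflp R" and finA: "finite A" and cnt: "counting c A R" and c: "c \<ge> 1"
    and free: "biclique_free t A R" and t: "t \<ge> 1"
    and sparse: "\<And>U. U \<subseteq> A \<Longrightarrow> card (inside (uedges A R) U) \<le> a * card U" and a: "a \<ge> 1"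
    and T: "T \<subseteq> A" and B: "B \<subseteq> A - T" "B \<noteq> {}" "\<And>b. b \<in> B \<Longrightarrow> t \<le> card (nb (uedges A R) T b)"
    and D1: "a + thr c 2 ^ 8 * (16 * a * 4 * (2 * a + 1)) \<le> D1"
  shows "T \<noteq> {}" "card B \<le> (D1 + t * (2 * D1) ^ (t - 1)) * card T"
proof -
  define Q where "Q = uedges A R"
  note Qiff = uedges_iff[OF sym, of _ _ A, folded Q_def]
  have finT: "finite T" using T finA finite_subset by blast
  have finB: "finite B" using B(1) finA finite_subset by blast
  have Bdeg: "t \<le> card (nb Q T b)" if "b \<in> B" for b using B(3)[OF that] by (simp add: Q_def)
  have symR: "R y x" if "R x y" for x y using sym that by (auto dest: sympD)
  obtain b0 where "b0 \<in> B" using B(2) by blast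
  then show TN: "T \<noteq> {}" using Bdeg[of b0] t by (auto simp: nb_def)
  obtain B' p where B': "B' \<subseteq> B" "inj_on p B'" "\<forall>b\<in>B'. p b \<subseteq> nb Q T b \<and> card (p b) = 2"
    "\<forall>b\<in>B - B'. \<forall>e. e \<subseteq> nb Q T b \<and> card e = 2 \<longrightarrow> e \<in> p ` B'"
    using distinct_pair_assignment[OF finB, of "nb Q T"] by (elim exE conjE)
  define E where "E = p ` B'"
  define q where "q = the_inv_into B' p"
  have q: "q (p b) = b" if "b \<in> B'" for b using B'(2) that by (simp add: q_def the_inv_into_f_f)
  have pT: "p b \<subseteq> T" if "b \<in> B'" for b using B'(3) that by (auto simp: nb_def)
  have GE: "graph_on T E" using finT pT B'(3) by (auto simp: graph_on_def E_def)
  \<comment> \<open>In a denser part the pairs are subdivided by their own vertices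
    \<open>q e\<close>; cleaning with \<open>r = 1\<close> would give an induced 1-subdivision at
    the threshold \<open>thr c 2 ^ 8\<close> of \<open>no_dense_model\<close>.\<close>
  have spE: "card (inside E W) \<le> D1 * card W" if W: "W \<subseteq> T" for W
  proof (rule ccontr)
    assume h: "\<not> ?thesis"
    then have WN: "W \<noteq> {}" using GE by (force simp: inside_def graph_on_def)
    define F where "F = inside E W"
    have FD: "\<exists>b\<in>B'. e = p b \<and> q e = b" if "e \<in> F" for e
      using that q by (auto simp: F_def inside_def E_def)
    have "\<exists>U F'. model A R 1 U F' (\<lambda>e. {q e}) \<and> U \<noteq> {} \<and> thr c 2 ^ 8 * card U \<le> card F'"
    proof (rule model_cleaning[OF sym irr finA a sparse])
      show "graph_on W F" unfolding F_def by (rule graph_on_inside[OF GE W])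
      show "W \<subseteq> A" "W \<noteq> {}" using W T WN by auto
      show "{q e} \<subseteq> A - W \<and> card {q e} = 1 \<and> conn R {q e}" if "e \<in> F" for e
        using FD[OF that] B'(1) B(1) W conn_singleton[of R "q e"] by auto
      show "{q e} \<inter> {q f} = {}" if "e \<in> F" "f \<in> F" "e \<noteq> f" for e f
        using FD[OF that(1)] FD[OF that(2)] that(3) by auto
      show "\<exists>x\<in>{q e}. R x v" if "e \<in> F" "v \<in> e" for e v
      proof -
        obtain b where b: "b \<in> B'" "e = p b" "q e = b" using FD[OF \<open>e \<in> F\<close>] by blast
        then have "v \<in> nb Q T b" using B'(3) that(2) by blast
        then show ?thesis using b Qiff symR by (auto simp: nb_def)
      qed
      have "(a + thr c 2 ^ 8 * (16 * a * (1 + 3) * (2 * a * 1 + 1))) * card W \<le> D1 * card W"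
        using D1 by (intro mult_right_mono) simp_all
      then show "(a + thr c 2 ^ 8 * (16 * a * (1 + 3) * (2 * a * 1 + 1))) * card W \<le> card F"
        using h unfolding F_def by linarith
      show "1 \<le> thr c 2 ^ 8" using thr_ge(1)[OF c, of 2] by simp
    qed
    then obtain U F' where m: "model A R 1 U F' (\<lambda>e. {q e})" "U \<noteq> {}" "thr c 2 ^ 8 * card U \<le> card F'"
      by blast
    then show False using no_dense_model[OF sym finA cnt c m(1) _ m(2,3)] by (simp add: numeral_2_eq_2)
  qed
  have low: "\<exists>v\<in>W. card (nb E W v) \<le> 2 * D1" if "W \<subseteq> T" "W \<noteq> {}" for W
    by (rule low_degree_vertex[OF GE spE[OF that(1)] that])
  have "inside E T = E" using GE by (auto simp: inside_def graph_on_def)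
  then have cB': "card B' \<le> D1 * card T" using spE[of T] card_image[OF B'(2)] by (simp add: E_def)
  \<comment> \<open>Failed vertices have clique neighbourhoods in the sparse graph \<open>E\<close>,
    and few of them can share \<open>t\<close> neighbours.\<close>
  have "card {b\<in>B - B'. t \<le> card (nb Q T b \<inter> T)} \<le> card T * (t * (2 * D1) ^ (t - 1))"
  proof (rule clique_incidence_bound[OF finT, of _ E])
    show "finite (B - B')" using finB by simp
    show "{v} \<notin> E" for v using GE by (force simp: graph_on_def)
    show "\<exists>v\<in>W. card (nb E W v) \<le> 2 * D1" if "W \<subseteq> T" "W \<noteq> {}" for W by (rule low[OF that])
    show "e \<in> E" if "b \<in> B - B'" "e \<subseteq> nb Q T b" "card e = 2" for b e
      using B'(4) that by (simp add: E_def)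
    show "1 \<le> t" by (rule t)
    show "card {b\<in>B - B'. S \<subseteq> nb Q T b} \<le> t" if S: "card S = t" for S
    proof (cases "{b\<in>B - B'. S \<subseteq> nb Q T b} = {}")
      case False
      then have ST: "S \<subseteq> T" by (auto simp: nb_def)
      show ?thesis
      proof (rule biclique_free_codegree[OF free, of S])
        show "S \<subseteq> A" using ST T by blast
        show "t \<le> card S" using S by simp
        show "{b\<in>B - B'. S \<subseteq> nb Q T b} \<subseteq> A" using B(1) by auto
        show "R x b" if "b \<in> {b\<in>B - B'. S \<subseteq> nb Q T b}" "x \<in> S" for b x
          using that Qiff by (auto simp: nb_def)
      qed
    next
      case True
      show ?thesis unfolding True by simp
    qed
  qed
  moreover have "{b\<in>B - B'. t \<le> card (nb Q T b \<inter> T)} = B - B'"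
  proof -
    have "nb Q T b \<inter> T = nb Q T b" for b by (auto simp: nb_def)
    then show ?thesis using Bdeg by auto
  qed
  ultimately have "card (B - B') \<le> card T * (t * (2 * D1) ^ (t - 1))" by simp
  moreover have "card B \<le> card B' + card (B - B')"
    using card_Un_le[of B' "B - B'"] B'(1) by (simp add: Un_absorb1)
  ultimately show "card B \<le> (D1 + t * (2 * D1) ^ (t - 1)) * card T"
    using cB' by (simp add: algebra_simps)
qed

text \<open>\<open>D1\<close> is quadratic in \<open>d\<close> apart from
  \<open>H \<le> d / 1000\<close>, so \<open>D1 \<le> d ^ 4\<close>. This is the origin of the
  degree bound \<open>d ^ (5 * t + 8)\<close>.\<close>

lemma degree_budget:
  fixes a d h t H D1 :: nat
  assumes d: "d \<ge> 5000" "t \<le> d" "1000 * H \<le> d" and a: "a = d + 1" and H: "H \<ge> 1"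
    and D1: "D1 = a + H * (16 * a * 4 * (2 * a + 1))"
  shows "8 * (d + 1) * (D1 + t * (2 * D1) ^ (t - 1)) < d ^ (5 * t + 8)"
proof -
  have d1: "d \<ge> 1" using d by simp
  have "D1 \<le> d ^ 4"
  proof -
    have "64 * a * (2 * a + 1) \<le> (65 * d) * (3 * d)" by (rule mult_le_mono) (use d a in auto)
    then have "16 * a * 4 * (2 * a + 1) \<le> 195 * d\<^sup>2" by (simp add: power2_eq_square)
    then have "H * (16 * a * 4 * (2 * a + 1)) \<le> H * (195 * d\<^sup>2)" by (rule mult_left_mono) simp
    moreover have "a \<le> H * d\<^sup>2"
    proof -
      have "a \<le> 2 * d" using d a by simp
      also have "\<dots> \<le> d * d" using d by (intro mult_right_mono) auto
      also have "\<dots> \<le> H * (d * d)" using mult_right_mono[OF H, of "d * d"] by simp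
      finally show ?thesis by (simp add: power2_eq_square)
    qed
    ultimately have "D1 \<le> H * (195 * d\<^sup>2) + H * d\<^sup>2" unfolding D1 by linarith
    then have "D1 \<le> 196 * (H * d\<^sup>2)" by simp
    also have "\<dots> \<le> 1000 * H * d\<^sup>2" by simp
    also have "\<dots> \<le> d * d\<^sup>2" using d by (intro mult_right_mono) auto
    also have "\<dots> = d ^ 3" by (simp add: power2_eq_square power3_eq_cube)
    also have "\<dots> \<le> d ^ 4" using d1 by (intro power_increasing) auto
    finally show ?thesis .
  qed
  then have "2 * D1 \<le> d * d ^ 4" using d by (intro mult_mono) auto
  then have D5: "2 * D1 \<le> d ^ 5" by (simp flip: power_Suc)
  have "(2 * D1) ^ (t - 1) \<le> (d ^ 5) ^ (t - 1)" by (rule power_mono[OF D5]) simp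
  also have "\<dots> \<le> d ^ (5 * t)" unfolding power_mult[symmetric] using d1 by (intro power_increasing) auto
  finally have "t * (2 * D1) ^ (t - 1) \<le> d * d ^ (5 * t)" using d by (intro mult_mono) auto
  then have 1: "t * (2 * D1) ^ (t - 1) \<le> d ^ (5 * t + 1)" by simp
  have "d ^ (5 * t + 1) \<le> d ^ (5 * t + 5)" using d1 by (intro power_increasing) auto
  moreover have "d ^ 5 \<le> d ^ (5 * t + 5)" using d1 by (intro power_increasing) auto
  ultimately have "D1 + t * (2 * D1) ^ (t - 1) \<le> 2 * d ^ (5 * t + 5)" using 1 D5 by linarith
  then have "8 * (d + 1) * (D1 + t * (2 * D1) ^ (t - 1)) \<le> 8 * (d + 1) * (2 * d ^ (5 * t + 5))"
    by (rule mult_left_mono) simp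
  also have "\<dots> = (16 * (d + 1)) * d ^ (5 * t + 5)" by simp
  also have "\<dots> \<le> d\<^sup>2 * d ^ (5 * t + 5)"
  proof (rule mult_right_mono)
    have "16 * (d + 1) \<le> 17 * d" using d by simp
    also have "\<dots> \<le> d * d" using d by (intro mult_right_mono) auto
    finally show "16 * (d + 1) \<le> d\<^sup>2" by (simp add: power2_eq_square)
  qed simp
  also have "\<dots> = d ^ (5 * t + 7)" by (simp flip: power_add add: add.commute)
  also have "\<dots> < d ^ (5 * t + 8)" using d by (intro power_strict_increasing) auto
  finally show ?thesis .
qed

text \<open>For the maximal density \<open>d\<close> of the given graph, \<open>d + 1\<close> bounds
  the density of all its parts, so cleaning can run before any absolute bound is known. The ratio of
  \<open>B\<close> to \<open>T\<close> is then polynomial in \<open>d\<close>, and \<Delta> is a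
  larger polynomial.\<close>

lemma bounded_density:
  assumes c: "c \<ge> 1" and t: "t \<ge> 1"
  obtains d0 where "d0 \<ge> 1" "\<And>A R U. symp R \<Longrightarrow> irreflp R \<Longrightarrow> finite A \<Longrightarrow> counting c A R \<Longrightarrow>
    biclique_free t A R \<Longrightarrow> U \<subseteq> A \<Longrightarrow> card (inside (uedges A R) U) \<le> d0 * card U"
proof -
  define H where "H = thr c 2 ^ 8"
  define s where "s = (8 * (2 * c * t)\<^sup>2)\<^sup>2 + 1"
  \<comment> \<open>One constant above all others, independent of the graph. It keeps
    \<open>\<Delta>\<^sup>2\<close> below \<open>d ^ (10 * h)\<close> and dominates
    \<open>t\<close>, \<open>s\<close> and \<open>1000 * H\<close>.\<close>
  define h where "h = 5000 + 10 * t + s + 1000 * H"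
  have h5: "h \<ge> 5000" "t \<le> h" "s \<le> h" "1000 * H \<le> h" by (auto simp: h_def)
  have H1: "H \<ge> 1" using thr_ge(1)[OF c, of 2] by (simp add: H_def)
  show ?thesis
  proof (rule that[of "h ^ 7"])
    show "1 \<le> h ^ 7" using h5 by simp
    fix A :: "'a set" and R U0
    assume sym: "symp R" and irr: "irreflp R" and finA: "finite A" and cnt: "counting c A R"
      and free: "biclique_free t A R" and U0: "U0 \<subseteq> A"
    define Q where "Q = uedges A R"
    have GQ: "graph_on A Q" unfolding Q_def by (rule graph_on_uedges[OF finA irr])
    have finQ: "finite Q" by (rule graph_on_finite[OF GQ])
    have Q0: "inside Q {} = {}" using GQ by (force simp: inside_def graph_on_def)
    show "card (inside (uedges A R) U0) \<le> h ^ 7 * card U0"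
    proof (rule ccontr)
      assume neg: "\<not> ?thesis"
      then have "U0 \<noteq> {}" using Q0 by (auto simp: Q_def)
      moreover have "h ^ 7 * card U0 \<le> card (inside Q U0)" using neg by (simp add: Q_def)
      ultimately obtain d U where d: "d \<ge> h ^ 7" and U: "U \<subseteq> A" "U \<noteq> {}" "d * card U \<le> card (inside Q U)"
        and sparse: "\<And>W. W \<subseteq> A \<Longrightarrow> card (inside Q W) \<le> (d + 1) * card W"
        using dense_subset_maximal[OF finA finQ U0 _ _ Q0] by blast
      define \<mu> where "\<mu> = d div (16 * h ^ 4)"
      note dv = div_bounds[OF h5(1) d, folded \<mu>_def]
      have hh: "h * h \<le> d"
      proof -
        have "h ^ 2 \<le> h ^ 7" using h5 by (intro power_increasing) auto
        then show ?thesis using d by (simp add: power2_eq_square)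
      qed
      have hd: "h \<le> d" using hh h5(1) mult_le_mono1[of 1 h h] by linarith
      have td: "5000 * t \<le> d" using mult_le_mono[OF h5(1,2)] hh by linarith
      define \<Delta> where "\<Delta> = d ^ (5 * t + 8)"
      define E where "E = inside Q U"
      have GE: "graph_on U E" unfolding E_def by (rule graph_on_inside[OF GQ U(1)])
      have finU: "finite U" using U(1) finA finite_subset by blast
      have EQ: "inside E W = inside Q W" if "W \<subseteq> U" for W using that by (auto simp: E_def inside_def)
      have nbEQ: "nb E X v = nb Q X v" if "X \<subseteq> U" "v \<in> U" for X v
        using that by (auto simp: E_def nb_def inside_def)
      define D1 where "D1 = (d + 1) + H * (16 * (d + 1) * 4 * (2 * (d + 1) + 1))"
      have bud: "8 * (d + 1) * (D1 + t * (2 * D1) ^ (t - 1)) < \<Delta>" unfolding \<Delta>_def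
        by (rule degree_budget[OF dv(3) _ _ refl H1 D1_def]) (use h5 hd in auto)
      have \<Delta>1: "\<Delta> \<ge> 100 * (d + 1)"
      proof -
        have "100 * (d + 1) \<le> 5000 * d" using dv(3) by simp
        also have "\<dots> \<le> d * d" by (rule mult_le_mono1[OF dv(3)])
        also have "\<dots> = d ^ 2" by (simp add: power2_eq_square)
        also have "\<dots> \<le> \<Delta>" unfolding \<Delta>_def using dv(3) by (intro power_increasing) auto
        finally show ?thesis .
      qed
      define T where "T = {v\<in>U. card (nb E U v) > \<Delta>}"
      have TU: "T \<subseteq> U" by (auto simp: T_def)
      consider "d * card U \<le> 2 * card (inside E (U - T))"
        | B where "B \<subseteq> U - T" "B \<noteq> {}" "\<And>b. b \<in> B \<Longrightarrow> d \<le> 8 * card (nb E T b)"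
          "\<Delta> * card T \<le> 8 * (d + 1) * card B"
      proof -
        have "d * card U \<le> card E" using U(3) by (simp add: E_def)
        moreover have "card (inside E W) \<le> (d + 1) * card W" if "W \<subseteq> U" for W
          unfolding EQ[OF that] using that U(1) by (intro sparse) auto
        ultimately have "d * card U \<le> 2 * card (inside E (U - T)) \<or>
          (\<exists>B\<subseteq>U - T. B \<noteq> {} \<and> (\<forall>b\<in>B. d \<le> 8 * card (nb E T b)) \<and> card U \<le> 4 * card B \<and>
            \<Delta> * card T \<le> 8 * (d + 1) * card B)"
          unfolding T_def using dv(3) \<Delta>1 by (intro degree_dichotomy[OF GE U(2)]) auto
        then show thesis using that by blast
      qed
      then show False
      proof cases
        case 1
        have UTA: "U - T \<subseteq> A" using U(1) by blast
        have "card U \<ge> 1" using U(2) finU by (simp add: Suc_le_eq card_gt_0_iff)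
        moreover have "d * card U \<le> 2 * card (inside (uedges A R) (U - T))"
          using 1 EQ[of "U - T"] by (simp add: Q_def)
        moreover have "card (nb (uedges A R) (U - T) v) \<le> \<Delta>" if "v \<in> U - T" for v
        proof -
          have "card (nb Q (U - T) v) \<le> card (nb Q U v)" using finU by (intro card_mono) (auto simp: nb_def)
          also have "\<dots> \<le> \<Delta>" using that nbEQ[of U v] by (auto simp: T_def)
          finally show ?thesis by (simp add: Q_def)
        qed
        moreover have "\<Delta>\<^sup>2 \<le> 2 ^ \<mu>"
        proof -
          have "\<Delta>\<^sup>2 = d ^ ((5 * t + 8) * 2)" by (simp only: \<Delta>_def power_mult)
          also have "\<dots> \<le> d ^ (10 * h)" using dv(3) by (intro power_increasing) (auto simp: h_def)
          also have "\<dots> \<le> 2 ^ \<mu>" unfolding \<mu>_def by (rule power_le_exp_div[OF h5(1) d order_refl])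
          finally show ?thesis .
        qed
        moreover have "1000 * (t * (1 + s * \<mu>)) \<le> d"
        proof -
          have "1000 * (t * (1 + s * \<mu>)) = 1000 * t + 1000 * (t * s * \<mu>)" by (simp add: algebra_simps)
          also have "2000 * (t * s * \<mu>) \<le> h ^ 4 * \<mu>"
          proof -
            have "2000 * (t * s) \<le> h * (h * h)" using h5 by (intro mult_mono) auto
            also have "\<dots> \<le> h * (h * (h * h))" using h5 by simp
            also have "\<dots> = h ^ 4" by (simp add: power4_eq_xxxx)
            finally have "2000 * (t * s) * \<mu> \<le> h ^ 4 * \<mu>" by (rule mult_right_mono) simp
            then show ?thesis by (simp only: mult.assoc)
          qed
          then have "1000 * t + 1000 * (t * s * \<mu>) \<le> d" using dv(2) td by linarith
          finally show ?thesis .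
        qed
        ultimately show False
          using bounded_degree_case[OF sym irr finA cnt c free t _ UTA, of d "card U" \<Delta> \<mu> s]
            sparse dv(1) td \<Delta>1 finU unfolding Q_def s_def by (simp add: card_mono)
      next
        case (2 B)
        have BA: "B \<subseteq> A - T" using 2(1) U(1) by blast
        have TA: "T \<subseteq> A" using TU U(1) by blast
        have Bt: "t \<le> card (nb (uedges A R) T b)" if b: "b \<in> B" for b
        proof -
          have "nb E T b = nb Q T b" using b 2(1) TU by (intro nbEQ) auto
          then show ?thesis using 2(3)[OF b] td by (simp add: Q_def)
        qed
        note res = unbounded_degree_case[OF sym irr finA cnt c free t sparse[unfolded Q_def] _ TA BA 2(2) Bt, of D1]
        have D1': "(d + 1) + thr c 2 ^ 8 * (16 * (d + 1) * 4 * (2 * (d + 1) + 1)) \<le> D1" by (simp add: D1_def H_def)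
        have TN: "T \<noteq> {}" and cB: "card B \<le> (D1 + t * (2 * D1) ^ (t - 1)) * card T"
          using res D1' by auto
        have "\<Delta> * card T \<le> 8 * (d + 1) * ((D1 + t * (2 * D1) ^ (t - 1)) * card T)"
          by (rule le_trans[OF 2(4) mult_le_mono2[OF cB]])
        also have "\<dots> = 8 * (d + 1) * (D1 + t * (2 * D1) ^ (t - 1)) * card T" by (simp only: mult.assoc)
        also have "\<dots> < \<Delta> * card T"
        proof (rule mult_strict_right_mono[OF bud])
          show "0 < card T" using TN TU finU finite_subset by (auto simp: card_gt_0_iff)
        qed
        finally show False by simp
      qed
    qed
  qed
qed

subsection \<open>Small weakly sparse classes\<close>

abbreviation adj :: "'a pair_pre_digraph \<Rightarrow> 'a \<Rightarrow> 'a \<Rightarrow> bool" where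
  "adj G \<equiv> \<lambda>u v. (u, v) \<in> parcs G"

lemma pair_graph_adj:
  assumes "pair_graph G"
  shows "symp (adj G)" "irreflp (adj G)" "finite (pverts G)" "finite (parcs G)"
    "\<And>u v. adj G u v \<Longrightarrow> u \<in> pverts G \<and> v \<in> pverts G" "wf_digraph (with_proj G)"
proof -
  interpret pair_graph G by fact
  have "sym (parcs G)" using pair_sym_arcs by (simp add: symmetric_def)
  then show "symp (adj G)" by (simp add: symp_sym_eq)
  show "irreflp (adj G)" using pair_no_loops by (force simp: irreflp_def)
  show "finite (pverts G)" by (rule pair_finite_verts)
  show "finite (parcs G)" by (rule pair_finite_arcs)
  show "u \<in> pverts G \<and> v \<in> pverts G" if "adj G u v" for u v
    using in_arcsD1[OF that] in_arcsD2[OF that] by simp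
  show "wf_digraph (with_proj G)" by unfold_locales
qed

text \<open>Heredity gives the subgraph induced on the image of \<sigma>, and closure under
  isomorphism allows it to be relabelled by \<open>N\<close>.\<close>

lemma induced_copy_in_class:
  assumes X: "graph_class X" "hereditary X" and G: "G \<in> X"
    and \<sigma>: "inj_on \<sigma> N" "\<sigma> ` N \<subseteq> pverts G"
  shows "\<lparr>pverts = N, parcs = {(i, j). i \<in> N \<and> j \<in> N \<and> adj G (\<sigma> i) (\<sigma> j)}\<rparr> \<in> X"
proof -
  have pg: "pair_graph G" using X G by (auto simp: graph_class_def)
  note PG = pair_graph_adj[OF pg]
  define w where "w = \<sigma> ` N"
  define H where "H = \<lparr>pverts = w, parcs = parcs G \<inter> w \<times> w\<rparr>"
  define K where "K = \<lparr>pverts = N, parcs = {(i, j). i \<in> N \<and> j \<in> N \<and> adj G (\<sigma> i) (\<sigma> j)}\<rparr>"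
  define g where "g = the_inv_into N \<sigma>"
  have g: "g (\<sigma> i) = i" if "i \<in> N" for i unfolding g_def using \<sigma>(1) that by (simp add: the_inv_into_f_f)
  have wfH: "wf_digraph (with_proj H)" by unfold_locales (auto simp: H_def)
  have "induced_subgraph (with_proj H) (with_proj G)"
    unfolding induced_subgraph_def subgraph_def compatible_def
    using wfH PG(6) \<sigma>(2) by (auto simp: H_def w_def)
  then have HX: "H \<in> X" using X(2) G by (auto simp: hereditary_def)
  define f where "f = \<lparr>iso_verts = g, iso_arcs = (\<lambda>(u, v). (g u, g v)), iso_head = snd, iso_tail = fst\<rparr>"
  have injg: "inj_on g w" using g by (auto simp: w_def inj_on_def)
  have "pre_digraph.digraph_isomorphism (with_proj H) f"
    unfolding pre_digraph.digraph_isomorphism_def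
    using wfH injg by (auto simp: f_def H_def inj_on_def)
  moreover have "with_proj K = app_iso f (with_proj H)"
  proof -
    have "g ` w = N" using g by (force simp: w_def)
    moreover have "{(i, j). i \<in> N \<and> j \<in> N \<and> adj G (\<sigma> i) (\<sigma> j)} = (\<lambda>(u, v). (g u, g v)) ` (parcs G \<inter> w \<times> w)"
    proof (intro set_eqI iffI; clarify)
      fix i j assume "i \<in> N" "j \<in> N" "adj G (\<sigma> i) (\<sigma> j)"
      then show "(i, j) \<in> (\<lambda>(u, v). (g u, g v)) ` (parcs G \<inter> w \<times> w)"
        using g by (intro image_eqI[where x="(\<sigma> i, \<sigma> j)"]) (auto simp: w_def)
    next
      fix u v assume "(u, v) \<in> parcs G" "u \<in> w" "v \<in> w"
      then show "g u \<in> N \<and> g v \<in> N \<and> adj G (\<sigma> (g u)) (\<sigma> (g v))"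
        using g by (auto simp: w_def)
    qed
    ultimately show ?thesis by (simp add: app_iso_def with_proj_def f_def H_def K_def)
  qed
  ultimately have "digraph_iso (with_proj H) (with_proj K)" unfolding digraph_iso_def by blast
  then have "K \<in> X" using X(1) HX by (auto simp: graph_class_def)
  then show ?thesis by (simp add: K_def)
qed

text \<open>An infinite set would have \<open>card\<close> 0; finiteness is what lets
  \<open>small\<close> bound the cardinality of subsets of \<open>labeled X n\<close>.\<close>

lemma finite_labeled:
  assumes "graph_class X"
  shows "finite (labeled X n)"
proof -
  have "labeled X n \<subseteq> (\<lambda>P. \<lparr>pverts = {1..n}, parcs = P\<rparr>) ` Pow ({1..n} \<times> {1..n})"
  proof
    fix G assume G: "G \<in> labeled X n"
    then have pg: "pair_graph G" and v: "pverts G = {1..n}" using assms by (auto simp: labeled_def graph_class_def)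
    have "parcs G \<in> Pow ({1..n} \<times> {1..n})" using pair_graph_adj(5)[OF pg] v by auto
    moreover have "G = \<lparr>pverts = {1..n}, parcs = parcs G\<rparr>" using v by simp
    ultimately show "G \<in> (\<lambda>P. \<lparr>pverts = {1..n}, parcs = P\<rparr>) ` Pow ({1..n} \<times> {1..n})" by blast
  qed
  then show ?thesis by (rule finite_subset) simp
qed

text \<open>Count the bijections from labels onto members of \<open>W\<close> twice: there are
  \<open>fact n\<close> for each member, and at most \<open>M\<close> for each of the labelled
  graphs pulled back, which all belong to \<open>labeled X n\<close>. The factorials cancel.\<close>

lemma small_counting:
  fixes c :: real
  assumes X: "graph_class X" "hereditary X" and G: "G \<in> X"
    and small: "\<And>n. real (card (labeled X n)) \<le> fact n * c ^ n"
  shows "counting (nat \<lceil>\<bar>c\<bar>\<rceil> + 1) (pverts G) (adj G)"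
  unfolding counting_def
proof (intro allI impI)
  fix n W M
  assume W: "\<forall>w\<in>W. w \<subseteq> pverts G \<and> card w = n" and M: "\<forall>\<Gamma>. card (emb_fibre (adj G) (pverts G) W n \<Gamma>) \<le> M"
  \<comment> \<open>The constant in \<open>small\<close> is an arbitrary real; a positive integer
    above its absolute value replaces it.\<close>
  define C where "C = nat \<lceil>\<bar>c\<bar>\<rceil> + 1"
  have pg: "pair_graph G" using X G by (auto simp: graph_class_def)
  note PG = pair_graph_adj[OF pg]
  let ?N = "{1..n}"
  define \<Sigma> where "\<Sigma> = {\<sigma> \<in> ?N \<rightarrow>\<^sub>E pverts G. inj_on \<sigma> ?N \<and> \<sigma> ` ?N \<in> W}"
  define \<gamma> where "\<gamma> = (\<lambda>\<sigma>. {(i, j). i \<in> ?N \<and> j \<in> ?N \<and> adj G (\<sigma> i) (\<sigma> j)})"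
  have fin\<Sigma>: "finite \<Sigma>" unfolding \<Sigma>_def
    by (rule finite_subset[of _ "?N \<rightarrow>\<^sub>E pverts G"]) (auto simp: finite_PiE PG(3))
  have "W \<subseteq> Pow (pverts G)" using W by auto
  then have finW: "finite W" using PG(3) by (meson finite_Pow_iff finite_subset)
  have "\<Sigma> = (\<Union>w\<in>W. {\<sigma> \<in> ?N \<rightarrow>\<^sub>E w. inj_on \<sigma> ?N})"
  proof (intro set_eqI iffI)
    fix \<sigma> assume "\<sigma> \<in> \<Sigma>"
    then show "\<sigma> \<in> (\<Union>w\<in>W. {\<sigma> \<in> ?N \<rightarrow>\<^sub>E w. inj_on \<sigma> ?N})"
      by (auto simp: \<Sigma>_def PiE_iff intro!: bexI[of _ "\<sigma> ` ?N"])
  next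
    fix \<sigma> assume "\<sigma> \<in> (\<Union>w\<in>W. {\<sigma> \<in> ?N \<rightarrow>\<^sub>E w. inj_on \<sigma> ?N})"
    then obtain w where w: "w \<in> W" "\<sigma> \<in> ?N \<rightarrow>\<^sub>E w" "inj_on \<sigma> ?N" by blast
    have "finite w" using W w(1) PG(3) finite_subset by blast
    moreover have "\<sigma> ` ?N \<subseteq> w" using w(2) by auto
    moreover have "card (\<sigma> ` ?N) = card w" using W w by (simp add: card_image)
    ultimately have "\<sigma> ` ?N = w" by (simp add: card_subset_eq)
    then show "\<sigma> \<in> \<Sigma>" using w W by (auto simp: \<Sigma>_def PiE_iff)
  qed
  then have "card \<Sigma> = (\<Sum>w\<in>W. card {\<sigma> \<in> ?N \<rightarrow>\<^sub>E w. inj_on \<sigma> ?N})"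
  proof (simp only:, intro card_UN_disjoint finW ballI impI)
    fix w assume w: "w \<in> W"
    have "finite w" using W w PG(3) finite_subset by blast
    then have "finite (?N \<rightarrow>\<^sub>E w)" by (simp add: finite_PiE)
    then show "finite {\<sigma> \<in> ?N \<rightarrow>\<^sub>E w. inj_on \<sigma> ?N}" by (rule rev_finite_subset) auto
    fix w' assume w': "w' \<in> W" "w \<noteq> w'"
    have im: "\<sigma> ` ?N = v" if "v \<in> W" "\<sigma> \<in> ?N \<rightarrow>\<^sub>E v" "inj_on \<sigma> ?N" for v \<sigma>
    proof (rule card_subset_eq)
      show "finite v" using W that(1) PG(3) finite_subset by blast
      show "\<sigma> ` ?N \<subseteq> v" using that(2) by auto
      show "card (\<sigma> ` ?N) = card v" using W that by (simp add: card_image)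
    qed
    show "{\<sigma> \<in> ?N \<rightarrow>\<^sub>E w. inj_on \<sigma> ?N} \<inter> {\<sigma> \<in> ?N \<rightarrow>\<^sub>E w'. inj_on \<sigma> ?N} = {}"
    proof (rule ccontr)
      assume "\<not> ?thesis"
      then obtain \<sigma> where \<sigma>: "\<sigma> \<in> ?N \<rightarrow>\<^sub>E w" "\<sigma> \<in> ?N \<rightarrow>\<^sub>E w'" "inj_on \<sigma> ?N" by blast
      show False using im[OF w \<sigma>(1,3)] im[OF w'(1) \<sigma>(2,3)] w'(2) by simp
    qed
  qed
  also have "\<dots> = (\<Sum>w\<in>W. fact n)"
  proof (rule sum.cong[OF refl])
    fix w assume w: "w \<in> W"
    have "finite w" using W w PG(3) finite_subset by blast
    then show "card {\<sigma> \<in> ?N \<rightarrow>\<^sub>E w. inj_on \<sigma> ?N} = fact n" using card_bijections W w by blast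
  qed
  finally have c\<Sigma>: "card \<Sigma> = card W * fact n" by simp
  have sub: "(\<lambda>\<Gamma>. \<lparr>pverts = ?N, parcs = \<Gamma>\<rparr>) ` \<gamma> ` \<Sigma> \<subseteq> labeled X n"
  proof clarify
    fix \<sigma> assume s: "\<sigma> \<in> \<Sigma>"
    then have "inj_on \<sigma> ?N" "\<sigma> ` ?N \<subseteq> pverts G" using W by (auto simp: \<Sigma>_def)
    then show "\<lparr>pverts = ?N, parcs = \<gamma> \<sigma>\<rparr> \<in> labeled X n"
      using induced_copy_in_class[OF X G, of \<sigma> ?N]
      by (simp add: labeled_def \<gamma>_def del: atLeastAtMost_iff)
  qed
  have "inj_on (\<lambda>\<Gamma>. \<lparr>pverts = ?N, parcs = \<Gamma>\<rparr>) (\<gamma> ` \<Sigma>)" by (auto simp: inj_on_def)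
  then have "card (\<gamma> ` \<Sigma>) = card ((\<lambda>\<Gamma>. \<lparr>pverts = ?N, parcs = \<Gamma>\<rparr>) ` \<gamma> ` \<Sigma>)" by (rule card_image[symmetric])
  also have "\<dots> \<le> card (labeled X n)" by (rule card_mono[OF finite_labeled[OF X(1)] sub])
  finally have c\<gamma>: "card (\<gamma> ` \<Sigma>) \<le> card (labeled X n)" .
  have "card \<Sigma> \<le> card (\<Union>\<Gamma>\<in>\<gamma> ` \<Sigma>. {\<sigma>\<in>\<Sigma>. \<gamma> \<sigma> = \<Gamma>})"
    by (rule card_mono) (use fin\<Sigma> in auto)
  also have "\<dots> \<le> (\<Sum>\<Gamma>\<in>\<gamma> ` \<Sigma>. card {\<sigma>\<in>\<Sigma>. \<gamma> \<sigma> = \<Gamma>})" using fin\<Sigma> by (intro card_UN_le) auto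
  also have "\<dots> \<le> (\<Sum>\<Gamma>\<in>\<gamma> ` \<Sigma>. M)"
  proof (rule sum_mono)
    fix \<Gamma>
    have "{\<sigma>\<in>\<Sigma>. \<gamma> \<sigma> = \<Gamma>} = emb_fibre (adj G) (pverts G) W n \<Gamma>"
      by (auto simp: \<Sigma>_def \<gamma>_def emb_fibre_def)
    then show "card {\<sigma>\<in>\<Sigma>. \<gamma> \<sigma> = \<Gamma>} \<le> M" using M by simp
  qed
  also have "\<dots> = card (\<gamma> ` \<Sigma>) * M" by simp
  also have "\<dots> \<le> card (labeled X n) * M" using c\<gamma> by (rule mult_right_mono) simp
  finally have "real (card W * fact n) \<le> real (card (labeled X n) * M)" unfolding c\<Sigma> by (simp only: of_nat_le_iff)
  also have "\<dots> \<le> (fact n * c ^ n) * real M" using small[of n] by (simp add: mult_right_mono)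
  also have "\<dots> \<le> (fact n * real C ^ n) * real M"
  proof -
    have "c ^ n \<le> \<bar>c\<bar> ^ n" by (metis abs_ge_self power_abs)
    also have "\<dots> \<le> real C ^ n" unfolding C_def by (intro power_mono) linarith+
    finally show ?thesis by (intro mult_right_mono mult_left_mono) auto
  qed
  finally have "fact n * real (card W) \<le> fact n * (real C ^ n * real M)" by (simp add: ac_simps)
  then have "real (card W) \<le> real (C ^ n * M)" by simp
  then show "card W \<le> (nat \<lceil>\<bar>c\<bar>\<rceil> + 1) ^ n * M" unfolding C_def[symmetric] by (simp only: of_nat_le_iff)
qed

lemma weakly_sparse_biclique_free:
  assumes X: "graph_class X" and ws: "weakly_sparse X"
  obtains t where "t \<ge> 1" "\<And>G. G \<in> X \<Longrightarrow> biclique_free t (pverts G) (adj G)"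
proof -
  obtain t where t: "\<not> (\<exists>G\<in>X. \<exists>H :: nat pair_pre_digraph.
      complete_bipartite_digraph t t (with_proj H) \<and> subgraph (with_proj H) (with_proj G))"
    using ws by (auto simp: weakly_sparse_def)
  show ?thesis
  \<comment> \<open>\<open>weakly_sparse\<close> may hold with \<open>t = 0\<close>; adding 1
    ensures \<open>t \<ge> 1\<close>.\<close>
  proof (rule that[of "t + 1"])
    show "1 \<le> t + 1" by simp
    fix G assume G: "G \<in> X"
    have pg: "pair_graph G" using X G by (auto simp: graph_class_def)
    note PG = pair_graph_adj[OF pg]
    show "biclique_free (t + 1) (pverts G) (adj G)"
      unfolding biclique_free_def
    proof (intro allI impI notI)
      fix S S' assume S: "S \<subseteq> pverts G \<and> S' \<subseteq> pverts G \<and> card S = t + 1 \<and> card S' = t + 1"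
        and all: "\<forall>x\<in>S. \<forall>y\<in>S'. adj G x y"
      obtain U where U: "U \<subseteq> S" "card U = t" "finite U" by (metis S le_add1 obtain_subset_with_card_n)
      obtain U' where U': "U' \<subseteq> S'" "card U' = t" "finite U'" by (metis S le_add1 obtain_subset_with_card_n)
      define H where "H = \<lparr>pverts = U \<union> U', parcs = U \<times> U' \<union> U' \<times> U\<rparr>"
      have "U \<inter> U' = {}" using all U(1) U'(1) PG(2) unfolding irreflp_def by blast
      then have "complete_bipartite_digraph t t (with_proj H)"
        unfolding complete_bipartite_digraph_pair_def using U U' by (auto simp: H_def)
      moreover have "subgraph (with_proj H) (with_proj G)"
      proof -
        have "wf_digraph (with_proj H)" by unfold_locales (auto simp: H_def)
        moreover have "parcs H \<subseteq> parcs G"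
        proof -
          have "adj G x y \<and> adj G y x" if "x \<in> U" "y \<in> U'" for x y
            using all that U(1) U'(1) sympD[OF PG(1)] by blast
          then show ?thesis by (auto simp: H_def)
        qed
        moreover have "pverts H \<subseteq> pverts G" using S U U' by (auto simp: H_def)
        ultimately show ?thesis using PG(6) by (simp add: subgraph_def compatible_def)
      qed
      ultimately show False using t G by blast
    qed
  qed
qed

section \<open>Subdivided graphs as systems of connected items\<close>

lemma conn_vwalk:
  assumes "symp R" "xs \<noteq> []" "\<And>x y. (x, y) \<in> set (vwalk_arcs xs) \<Longrightarrow> R x y"
  shows "conn R (set xs)"
  using assms(2,3)
proof (induction xs rule: vwalk_arcs.induct)
  case (2 u)
  then show ?case using conn_singleton[of R u] by simp
next
  case (3 u v es)
  have "conn R (set (v # es))" using 3 by auto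
  moreover have "R v u" using 3(3)[of u v] assms(1) by (auto dest: sympD)
  ultimately have "conn R (insert u (set (v # es)))" using conn_insert[OF assms(1), of "set (v # es)" v u] by simp
  then show ?case by simp
qed simp

lemma vwalk_arcs_append_subset: "set (vwalk_arcs xs) \<subseteq> set (vwalk_arcs (xs @ ys))"
  by (induction xs rule: vwalk_arcs.induct) auto

lemma vwalk_arcs_Cons_subset: "set (vwalk_arcs xs) \<subseteq> set (vwalk_arcs (x # xs))"
  by (cases xs) auto

lemma vwalk_arcs_last: "xs \<noteq> [] \<Longrightarrow> (last xs, v) \<in> set (vwalk_arcs (xs @ [v]))"
  by (induction xs rule: vwalk_arcs.induct) auto

lemma average_degree_edges:
  assumes pg: "pair_graph G" and avg: "average_degree G > 2 * real N"
  shows "pverts G \<noteq> {}" "N * card (pverts G) < card (uedges (pverts G) (adj G))"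
proof -
  note PG = pair_graph_adj[OF pg]
  let ?E = "uedges (pverts G) (adj G)"
  \<comment> \<open>Division by zero gives the null graph average degree 0, which is not above
    \<open>2 * real N\<close>.\<close>
  show VN: "pverts G \<noteq> {}" using avg by (auto simp: average_degree_def)
  have "(\<Sum>v\<in>pverts G. out_degree (with_proj G) v) = (\<Sum>v\<in>pverts G. card {e \<in> parcs G. fst e = v})"
    by (simp add: out_degree_def out_arcs_def)
  also have "\<dots> = (\<Sum>v\<in>pverts G. \<Sum>e\<in>{e \<in> parcs G. fst e = v}. 1)" by simp
  also have "\<dots> = (\<Sum>e\<in>parcs G. 1)"
    by (rule sum.group) (use PG(3,4,5) in auto)
  finally have 1: "(\<Sum>v\<in>pverts G. out_degree (with_proj G) v) = card (parcs G)" by simp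
  have finE: "finite ?E" by (rule graph_on_finite[OF graph_on_uedges[OF PG(3,2)]])
  have "parcs G \<subseteq> (\<Union>e\<in>?E. {p. {fst p, snd p} = e})"
  proof
    fix p assume "p \<in> parcs G"
    then have "{fst p, snd p} \<in> ?E" using uedges_iff[OF PG(1)] PG(5)[of "fst p" "snd p"] by simp
    then show "p \<in> (\<Union>e\<in>?E. {p. {fst p, snd p} = e})" by blast
  qed
  moreover have fin2: "finite {p. {fst p, snd p} = e} \<and> card {p. {fst p, snd p} = e} \<le> 2" if "e \<in> ?E" for e
  proof -
    obtain u v where e: "e = {u, v}" using \<open>e \<in> ?E\<close> by (auto simp: uedges_def)
    have "{p. {fst p, snd p} = e} \<subseteq> {(u, v), (v, u)}" unfolding e by (auto simp: doubleton_eq_iff)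
    moreover have "card {(u, v), (v, u)} \<le> 2" by (cases "u = v") auto
    ultimately show ?thesis
      by (meson card_mono finite.emptyI finite_insert finite_subset order_trans)
  qed
  ultimately have "card (parcs G) \<le> card (\<Union>e\<in>?E. {p. {fst p, snd p} = e})"
    using finE by (intro card_mono) auto
  also have "\<dots> \<le> (\<Sum>e\<in>?E. card {p. {fst p, snd p} = e})" by (rule card_UN_le[OF finE])
  also have "\<dots> \<le> (\<Sum>e\<in>?E. 2)" using fin2 by (intro sum_mono) auto
  finally have 2: "card (parcs G) \<le> 2 * card ?E" by simp
  have pos: "real (card (pverts G)) > 0" using VN PG(3) by (simp add: card_gt_0_iff)
  have "average_degree G = real (card (parcs G)) / real (card (pverts G))"
    unfolding average_degree_def 1[symmetric] by simp
  then have "2 * real N * real (card (pverts G)) < real (card (parcs G))"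
    using avg pos_less_divide_eq[OF pos] by simp
  also have "\<dots> \<le> 2 * real (card ?E)" using 2 by linarith
  finally have "real (N * card (pverts G)) < real (card ?E)" by simp
  then show "N * card (pverts G) < card ?E" by (simp only: of_nat_less_iff)
qed

text \<open>For \<open>r = 0\<close> the graph \<open>G\<close> itself lies in \<open>K\<close>,
  against sparsity. Otherwise the interiors of the paths are nonempty connected items, and cleaning
  makes the subdivision induced. The factor 2 converts edges per vertex into average degree.\<close>

lemma subdivision_contradiction:
  fixes G H K :: "'a pair_pre_digraph"
  assumes pgK: "pair_graph K" and cnt: "counting c (pverts K) (adj K)" and c: "c \<ge> 1" and a: "a \<ge> 1"
    and sparse: "\<And>U. U \<subseteq> pverts K \<Longrightarrow> card (inside (uedges (pverts K) (adj K)) U) \<le> a * card U"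
    and sub: "is_subdivision r G H" and HK: "subgraph (with_proj H) (with_proj K)"
    and avg: "average_degree G > 2 * real (a + thr c (r + 1) ^ 8 * (16 * a * (r + 3) * (2 * a * r + 1)))"
  shows False
proof -
  define A where "A = pverts K"
  define V where "V = pverts G"
  define E where "E = uedges V (adj G)"
  let ?N = "a + thr c (r + 1) ^ 8 * (16 * a * (r + 3) * (2 * a * r + 1))"
  note PK = pair_graph_adj[OF pgK]
  have pgG: "pair_graph G" using sub by (simp add: is_subdivision_def)
  note PG = pair_graph_adj[OF pgG]
  have GE: "graph_on V E" unfolding E_def V_def by (rule graph_on_uedges[OF PG(3,2)])
  have VN: "V \<noteq> {}" and dens: "?N * card V < card E"
    unfolding V_def E_def using average_degree_edges[OF pgG avg] by auto
  obtain S where S0: "\<forall>(u, v)\<in>parcs G. length (S (u, v)) = r \<and> distinct (S (u, v)) \<and>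
        set (S (u, v)) \<inter> pverts G = {} \<and> S (v, u) = rev (S (u, v))"
    and disj0: "\<forall>(u, v)\<in>parcs G. \<forall>(x, y)\<in>parcs G. {u, v} \<noteq> {x, y} \<longrightarrow>
        set (S (u, v)) \<inter> set (S (x, y)) = {}"
    and vH: "pverts H = pverts G \<union> (\<Union>e\<in>parcs G. set (S e))"
    and pH: "parcs H = (\<Union>(u, v)\<in>parcs G. set (vwalk_arcs (u # S (u, v) @ [v])))"
    using conjunct2[OF sub[unfolded is_subdivision_def]] by (elim exE conjE)
  have S: "length (S (u, v)) = r \<and> distinct (S (u, v)) \<and> set (S (u, v)) \<inter> V = {} \<and>
      S (v, u) = rev (S (u, v))" if "(u, v) \<in> parcs G" for u v
    using bspec[OF S0 that] by (simp add: V_def)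
  have disj: "set (S (u, v)) \<inter> set (S (x, y)) = {}"
    if "(u, v) \<in> parcs G" "(x, y) \<in> parcs G" "{u, v} \<noteq> {x, y}" for u v x y
    using bspec[OF bspec[OF disj0 that(1), simplified] that(2)] that(3) by simp
  have HKv: "pverts H \<subseteq> A" and HKe: "parcs H \<subseteq> parcs K" using HK by (auto simp: subgraph_def A_def)
  have VA: "V \<subseteq> A" using vH HKv by (simp add: V_def)
  have walk: "adj K x y" if "(u, v) \<in> parcs G" "(x, y) \<in> set (vwalk_arcs (u # S (u, v) @ [v]))" for u v x y
    using that pH HKe by blast
  have EG: "(u, v) \<in> parcs G" if "{u, v} \<in> E" for u v
    using that uedges_iff[OF PG(1)] by (simp add: E_def)
  have edge: "\<exists>u v. e = {u, v} \<and> (u, v) \<in> parcs G" if "e \<in> E" for e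
    using that by (auto simp: E_def uedges_def)
  show False
  proof (cases "r = 0")
    case True
    have "E \<subseteq> inside (uedges A (adj K)) V"
    proof
      fix e assume "e \<in> E"
      then obtain u v where e: "e = {u, v}" "(u, v) \<in> parcs G" using edge by blast
      have "S (u, v) = []" using S[OF e(2)] True by simp
      then have "adj K u v" using walk[OF e(2), of u v] by simp
      moreover have "u \<in> V" "v \<in> V" using PG(5)[OF e(2)] by (auto simp: V_def)
      ultimately show "e \<in> inside (uedges A (adj K)) V"
        using VA uedges_iff[OF PK(1), of u v A] by (auto simp: inside_def e(1))
    qed
    moreover have "finite (inside (uedges A (adj K)) V)"
      using graph_on_finite[OF graph_on_uedges[OF PK(3,2)]] by (simp add: inside_def A_def)
    ultimately have "card E \<le> card (inside (uedges A (adj K)) V)" by (rule card_mono[rotated])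
    also have "\<dots> \<le> a * card V" using sparse VA by (simp add: A_def)
    also have "\<dots> \<le> ?N * card V" by (rule mult_right_mono) simp_all
    finally show False using dens by simp
  next
    case False
    \<comment> \<open>Items are indexed by unordered edges but \<open>S\<close> by arcs; the two
      arcs of an edge give the same set, as their lists are reverses of each other.\<close>
    define I where "I = (\<lambda>e. \<Union>p\<in>{p\<in>parcs G. {fst p, snd p} = e}. set (S p))"
    have Iuv: "I {u, v} = set (S (u, v))" if uv: "(u, v) \<in> parcs G" for u v
    proof -
      have eq: "set (S p) = set (S (u, v))" if p: "p \<in> parcs G" "{fst p, snd p} = {u, v}" for p
      proof -
        have "p = (u, v) \<or> p = (v, u)" using p(2) by (cases p) (auto simp: doubleton_eq_iff)
        then show ?thesis using S[OF uv] by auto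
      qed
      have "(u, v) \<in> {p\<in>parcs G. {fst p, snd p} = {u, v}}" using uv by simp
      then show ?thesis unfolding I_def using eq by blast
    qed
    have Sne: "S (u, v) \<noteq> []" if "(u, v) \<in> parcs G" for u v using S[OF that] False by auto
    have "\<exists>U F. model A (adj K) r U F I \<and> U \<noteq> {} \<and> thr c (r + 1) ^ 8 * card U \<le> card F"
    proof (rule model_cleaning[OF PK(1,2) _ a _ GE VA VN])
      show "finite A" using PK(3) by (simp add: A_def)
      show "card (inside (uedges A (adj K)) U) \<le> a * card U" if "U \<subseteq> A" for U
        using sparse that by (simp add: A_def)
      show "I e \<subseteq> A - V \<and> card (I e) = r \<and> conn (adj K) (I e)" if "e \<in> E" for e
      proof -
        obtain u v where e: "e = {u, v}" "(u, v) \<in> parcs G" using edge \<open>e \<in> E\<close> by blast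
        have Ie: "I e = set (S (u, v))" using Iuv[OF e(2)] e(1) by simp
        have "set (S (u, v)) \<subseteq> A" using e(2) vH HKv by blast
        moreover have "card (set (S (u, v))) = r" using S[OF e(2)] distinct_card by metis
        moreover have "conn (adj K) (set (S (u, v)))"
        proof (rule conn_vwalk[OF PK(1) Sne[OF e(2)]])
          fix x y assume "(x, y) \<in> set (vwalk_arcs (S (u, v)))"
          then have "(x, y) \<in> set (vwalk_arcs (u # S (u, v) @ [v]))"
            using vwalk_arcs_append_subset[of "S (u, v)" "[v]"] vwalk_arcs_Cons_subset[of "S (u, v) @ [v]" u]
            by blast
          then show "adj K x y" by (rule walk[OF e(2)])
        qed
        ultimately show ?thesis using S[OF e(2)] unfolding Ie by blast
      qed
      show "I e \<inter> I f = {}" if ef: "e \<in> E" "f \<in> E" "e \<noteq> f" for e f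
      proof -
        obtain u v where e: "e = {u, v}" "(u, v) \<in> parcs G" using edge[OF ef(1)] by blast
        obtain x y where f: "f = {x, y}" "(x, y) \<in> parcs G" using edge[OF ef(2)] by blast
        show ?thesis using disj[OF e(2) f(2)] ef(3) Iuv[OF e(2)] Iuv[OF f(2)] e(1) f(1) by simp
      qed
      show "\<exists>x\<in>I e. adj K x v" if ev: "e \<in> E" "v \<in> e" for e v
      proof -
        obtain u w where e: "e = {u, w}" "(u, w) \<in> parcs G" using edge[OF ev(1)] by blast
        then obtain u where e: "e = {u, v}" "(u, v) \<in> parcs G"
          using ev(2) PG(1) EG[of w u] ev(1) by (auto simp: insert_commute)
        let ?l = "last (S (u, v))"
        have "(?l, v) \<in> set (vwalk_arcs (S (u, v) @ [v]))" by (rule vwalk_arcs_last[OF Sne[OF e(2)]])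
        then have "(?l, v) \<in> set (vwalk_arcs (u # S (u, v) @ [v]))" using vwalk_arcs_Cons_subset by fast
        then have "adj K ?l v" by (rule walk[OF e(2)])
        moreover have "?l \<in> I e" using Iuv[OF e(2)] e(1) Sne[OF e(2)] by simp
        ultimately show ?thesis by blast
      qed
      show "?N * card V \<le> card E" using dens by simp
      show "1 \<le> thr c (r + 1) ^ 8" using thr_ge(1)[OF c, of "r + 1"] by simp
    qed
    then obtain U F where m: "model A (adj K) r U F I" "U \<noteq> {}" "thr c (r + 1) ^ 8 * card U \<le> card F"
      by blast
    show False
      by (rule no_dense_model[OF PK(1) _ _ c m(1) _ m(2,3)]) (use PK(3) cnt False in \<open>auto simp: A_def\<close>)
  qed
qed

theorem theorem1p1:
  fixes X :: "nat pair_pre_digraph set"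
  assumes "graph_class X"
    and "hereditary X"
    and "small X"
    and "weakly_sparse X"
  shows "bounded_expansion X"
proof -
  obtain c0 :: real where c0: "\<And>n. real (card (labeled X n)) \<le> fact n * c0 ^ n"
    using assms(3) by (auto simp: small_def)
  define c where "c = nat \<lceil>\<bar>c0\<bar>\<rceil> + 1"
  have c: "c \<ge> 1" by (simp add: c_def)
  have cnt: "counting c (pverts K) (adj K)" if "K \<in> X" for K
    unfolding c_def by (rule small_counting[OF assms(1,2) that c0])
  obtain t where t: "t \<ge> 1" and free: "\<And>K. K \<in> X \<Longrightarrow> biclique_free t (pverts K) (adj K)"
    using weakly_sparse_biclique_free[OF assms(1,4)] by blast
  obtain a where a: "a \<ge> 1" and sparse: "\<And>(A :: nat set) R U. symp R \<Longrightarrow> irreflp R \<Longrightarrow> finite A \<Longrightarrow>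
      counting c A R \<Longrightarrow> biclique_free t A R \<Longrightarrow> U \<subseteq> A \<Longrightarrow> card (inside (uedges A R) U) \<le> a * card U"
    by (rule bounded_density[OF c t]; rule that; assumption)
  \<comment> \<open>Twice the number of edges per vertex from which cleaning retains density
    \<open>thr c (r + 1) ^ 8\<close>.\<close>
  define f where "f = (\<lambda>r. 2 * real (a + thr c (r + 1) ^ 8 * (16 * a * (r + 3) * (2 * a * r + 1))))"
  have False if h: "average_degree G > f r" "is_subdivision r G H" "K \<in> X" "subgraph (with_proj H) (with_proj K)"
    for r and G H K :: "nat pair_pre_digraph"
  proof -
    have pg: "pair_graph K" using assms(1) h(3) by (auto simp: graph_class_def)
    note PK = pair_graph_adj[OF pg]
    show False
    proof (rule subdivision_contradiction[OF pg cnt[OF h(3)] c a _ h(2,4)])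
      show "card (inside (uedges (pverts K) (adj K)) U) \<le> a * card U" if "U \<subseteq> pverts K" for U
        by (rule sparse[OF PK(1,2,3) cnt[OF h(3)] free[OF h(3)] that])
    qed (use h(1) in \<open>simp add: f_def\<close>)
  qed
  then show ?thesis unfolding bounded_expansion_def by (intro exI[of _ f]) blast
qed

end
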